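(* Let $\bar\tau_0>0$ be a constant and let $\mathcal D\subset\big(C^3(\mathbb R)\cap W^{1,1}(\mathbb R)\big)^2$ be the open dense set of generic initial data described in the context. Consider initial data $(\tau_0,u_0)$ with $(\tau_0-\bar\tau_0,u_0)\in\mathcal D$ satisfying, for some positive constant $\bar c$, $\frac1{\bar c}\le\tau_0(x)\le\bar c$ for all $x$ and $$\min\Big\{\inf_x\big(u_0'-\tau_0^{-\frac{\gamma+1}{2}}\tau_0'\big)(x),\ \inf_x\big(u_0'+\tau_0^{-\frac{\gamma+1}{2}}\tau_0'\big)(x)\Big\}<0 .$$ Let $(\tau,u,\alpha,\beta,p,q,x,t)(X,Y)$ be the corresponding smooth solution of the semilinear system (S) on $\Omega_{t^*}$, and let $(\tau(x,t),u(x,t))$ be the solution of the Cauchy problem (E) on $\mathbb R\times[0,t^*]$. Then every singular point $(X_0,Y_0)$ on the boundary $t(X,Y)=t^*$ is of Type-1; that is, singularities of Type-2 and Type-3 cannot occur on $t(X,Y)=t^*$. Moreover, let $(X_0,Y_0)$ be a singular point on $t(X,Y)=t^*$ where $\alpha=-\pi$ (i.e. where $\partial_x\varpi_-$ blows up), and set $(x^*,t^* )=(x(X_0,Y_0),t(X_0,Y_0))$. Then there exists a constant $\zeta\ne0$ such that for $t\le t^*$, near $(x^*,t^* )$, $$\tau(x,t)=\tau(x^*,t^* )+\zeta\,\big[c(\tau(x^*,t^* ))(t-t^* )+(x-x^* )\big]^{\frac13}+O(1)\big(|t-t^*|+|x-x^*|\big)^{\frac49},$$ $$u(x,t)=u(x^*,t^*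 )+c(\tau(x^*,t^* ))\,\zeta\,\big[c(\tau(x^*,t^* ))(t-t^* )+(x-x^* )\big]^{\frac13}+O(1)\big(|t-t^*|+|x-x^*|\big)^{\frac49}.$$ In addition, the Riemann invariant $\varpi_+(x,t)$ is smooth (up to and) at the singular point $(x^*,t^* )$.
   Context: Fix $\gamma>1$ and put $c(\tau)=\tau^{-(\gamma+1)/2}$. $(\cdot)^{1/3}$ is the real cube root; $O(1)$ denotes a bounded factor near the point. (E) is the Cauchy problem $\tau_t-u_x=0$, $u_t+\big(\tfrac1\gamma\tau^{-\gamma}\big)_x=0$, $\tau>0$, with $\tau(x,0)=\tau_0(x)$, $u(x,0)=u_0(x)$. Set $\varpi_\pm=u\pm\frac{2}{\gamma-1}\tau^{-(\gamma-1)/2}$ (Riemann invariants), $R=\partial_x\varpi_-=u_x+c(\tau)\tau_x$, $S=\partial_x\varpi_+=u_x-c(\tau)\tau_x$, with initial values $R_0,S_0$. $t^*$ is the first time at which the smooth solution develops a singularity (one of $R,S$ blows up). Characteristic coordinates: let $x_\pm(s;x,t)$ solve $\frac{d}{ds}x_\pm=\pm c(\tau(x_\pm,s))$, $x_\pm(t;x,t)=x$, and set $X=x_-(0;x,t)$, $Y=-x_+(0;x,t)$. Set $\alpha=2\arctan R$, $\beta=2\arctan S$ (values in $[-\pi,\pi)$; blow-up of $R$, resp. $S$, corresponds to $\alpha=-\pi$, resp. $\beta=-\pi$), $p=\sqrt{1+R^2}/X_x$, $q=\sqrt{1+S^2}/(-Y_x)$. $\Omega_{t^*}$ is the image of $\mathbb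 R\times[0,t^*]$ under $(x,t)\mapsto(X,Y)$. As functions of $(X,Y)$, up to the boundary $t(X,Y)=t^*$, these satisfy (with $c=c(\tau)$, $c'=c'(\tau)$) (S): $\alpha_Y=\frac{c'}{2c^2}q\sin\frac\alpha2\sin\frac{\alpha-\beta}2$, $\beta_X=\frac{c'}{2c^2}p\sin\frac\beta2\sin\frac{\beta-\alpha}2$, $p_Y=\frac{c'}{4c^2}pq\cos\frac\alpha2\sin\frac{\beta-\alpha}2$, $q_X=\frac{c'}{4c^2}pq\cos\frac\beta2\sin\frac{\alpha-\beta}2$, $\tau_X=\frac1{2c}p\sin\frac\alpha2$, $\tau_Y=\frac1{2c}q\sin\frac\beta2$, $u_X=\frac12p\sin\frac\alpha2$, $u_Y=-\frac12q\sin\frac\beta2$, $t_X=\frac1{2c}p\cos\frac\alpha2$, $t_Y=\frac1{2c}q\cos\frac\beta2$, $x_X=\frac12p\cos\frac\alpha2$, $x_Y=-\frac12q\cos\frac\beta2$, with data on $X+Y=0$, at $(x,-x)$: $\tau=\tau_0(x)$, $u=u_0(x)$, $\alpha=2\arctan R_0(x)$, $\beta=2\arctan S_0(x)$, $p=\sqrt{1+R_0(x)^2}$, $q=\sqrt{1+S_0(x)^2}$, $t=0$, and $x$-coordinate $x$. The solution at $t=t^*$ is the one whose graph is $\{(t,x,\tau,u)(X,Y):(X,Y)\in\Omega_{t^*}\}$. A singular point is a point of the boundary $t(X,Y)=t^*$ at which $\alpha=-\pi$ or $\beta=-\pi$. The set $\mathcal D$: an open dense subset of $\big(C^3(\mathbb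 R)\cap W^{1,1}(\mathbb R)\big)^2$ (natural norm topology) such that for all data with $(\tau_0-\bar\tau_0,u_0)\in\mathcal D$ satisfying the two conditions of the claim, (a) the solution of (E) on $\mathbb R\times[0,t^*]$ is twice continuously differentiable off finitely many points of the line $t=t^*$, and (b) none of the values $(\alpha,\alpha_X,\alpha_{XX})=(-\pi,0,0)$, $(\beta,\beta_Y,\beta_{YY})=(-\pi,0,0)$, $(\alpha,\beta,\alpha_X)=(-\pi,-\pi,0)$, $(\alpha,\beta,\beta_Y)=(-\pi,-\pi,0)$ is attained on the boundary $t(X,Y)=t^*$. Types of singular points on $t(X,Y)=t^*$: Type-1: $\alpha=-\pi$, $\alpha_X=0$, $\beta\ne-\pi$, $\alpha_{XX}\ne0$ (or $\beta=-\pi$, $\beta_Y=0$, $\alpha\ne-\pi$, $\beta_{YY}\ne0$). Type-2: $\alpha=-\pi$, $\alpha_X\ne0$, $\beta\ne-\pi$ (or $\beta=-\pi$, $\beta_Y\ne0$, $\alpha\ne-\pi$). Type-3: $\alpha=-\pi$, $\beta=-\pi$, $\alpha_X\ne0$, $\beta_Y\ne0$.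
   Formalization: For the cube-root expansions, "smooth solution" is taken to mean that α is C³ near the singular point, since for general C³ data α is only C² and the 4/9 error can fail; "ϖ₊ is smooth" is taken to mean C¹ up to t=t*, since C² fails in general. *)

theory Defs
  imports "HOL-Analysis.Analysis" "HOL-Library.Landau_Symbols"
begin

section \<open>Functions of two real variables\<close>

definition pd1 :: "(real \<times> real \<Rightarrow> real) \<Rightarrow> real \<times> real \<Rightarrow> real" where
  "pd1 f z = deriv (\<lambda>s. f (s, snd z)) (fst z)"

definition pd2 :: "(real \<times> real \<Rightarrow> real) \<Rightarrow> real \<times> real \<Rightarrow> real" where
  "pd2 f z = deriv (\<lambda>s. f (fst z, s)) (snd z)"

text \<open>The class \<open>C\<^sup>k\<close> on a set that need not be open. At boundary points the derivatives are taken
  within the set (so one-sided in time on a strip); on open sets this is the usual notion.\<close>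

primrec Ck_on :: "nat \<Rightarrow> (real \<times> real) set \<Rightarrow> (real \<times> real \<Rightarrow> real) \<Rightarrow> bool" where
  "Ck_on 0 A f \<longleftrightarrow> continuous_on A f"
| "Ck_on (Suc k) A f \<longleftrightarrow>
     (\<exists>g h. (\<forall>z\<in>A. (f has_derivative (\<lambda>v. g z * fst v + h z * snd v)) (at z within A)) \<and>
            Ck_on k A g \<and> Ck_on k A h)"


section \<open>The space of initial data\<close>

text \<open>\<open>C\<^sup>3\<close> carries the norm given by the suprema of the derivatives of order at most 3, so its
  members have bounded derivatives. The weak derivative of a \<open>C\<^sup>1\<close> function is the classical one.\<close>

definition C3W11 :: "(real \<Rightarrow> real) set" where
  "C3W11 = {f. (\<forall>k<3. \<forall>x. (deriv ^^ k) f differentiable (at x)) \<and>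
               continuous_on UNIV ((deriv ^^ 3) f) \<and>
               (\<forall>k\<le>3. bounded (range ((deriv ^^ k) f))) \<and>
               integrable lborel f \<and> integrable lborel (deriv f)}"

definition C3W11_norm :: "(real \<Rightarrow> real) \<Rightarrow> real" where
  "C3W11_norm f = (\<Sum>k\<le>3. SUP x. \<bar>(deriv ^^ k) f x\<bar>) +
                  (LINT x|lborel. \<bar>f x\<bar>) + (LINT x|lborel. \<bar>deriv f x\<bar>)"

definition data_dist ::
  "(real \<Rightarrow> real) \<times> (real \<Rightarrow> real) \<Rightarrow> (real \<Rightarrow> real) \<times> (real \<Rightarrow> real) \<Rightarrow> real" where
  "data_dist a b = C3W11_norm (\<lambda>x. fst a x - fst b x) + C3W11_norm (\<lambda>x. snd a x - snd b x)"

definition open_dense_data :: "((real \<Rightarrow> real) \<times> (real \<Rightarrow> real)) set \<Rightarrow> bool" where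
  "open_dense_data D \<longleftrightarrow>
     D \<subseteq> C3W11 \<times> C3W11 \<and>
     (\<forall>a\<in>D. \<exists>\<epsilon>>0. \<forall>b \<in> C3W11 \<times> C3W11. data_dist a b < \<epsilon> \<longrightarrow> b \<in> D) \<and>
     (\<forall>a \<in> C3W11 \<times> C3W11. \<forall>\<epsilon>>0. \<exists>b\<in>D. data_dist a b < \<epsilon>)"


section \<open>The Cauchy problem\<close>

text \<open>Points of the physical plane are written \<open>(x, t)\<close>.\<close>

definition sound_speed :: "real \<Rightarrow> real \<Rightarrow> real" where
  "sound_speed \<gamma> \<tau> = \<tau> powr (- (\<gamma> + 1) / 2)"

definition riemann_plus ::
  "real \<Rightarrow> (real \<times> real \<Rightarrow> real) \<Rightarrow> (real \<times> real \<Rightarrow> real) \<Rightarrow> real \<times> real \<Rightarrow> real" where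
  "riemann_plus \<gamma> \<tau> u z = u z + 2 / (\<gamma> - 1) * \<tau> z powr (- (\<gamma> - 1) / 2)"

definition grad_R ::
  "real \<Rightarrow> (real \<times> real \<Rightarrow> real) \<Rightarrow> (real \<times> real \<Rightarrow> real) \<Rightarrow> real \<times> real \<Rightarrow> real" where
  "grad_R \<gamma> \<tau> u z = pd1 u z + sound_speed \<gamma> (\<tau> z) * pd1 \<tau> z"

definition grad_S ::
  "real \<Rightarrow> (real \<times> real \<Rightarrow> real) \<Rightarrow> (real \<times> real \<Rightarrow> real) \<Rightarrow> real \<times> real \<Rightarrow> real" where
  "grad_S \<gamma> \<tau> u z = pd1 u z - sound_speed \<gamma> (\<tau> z) * pd1 \<tau> z"

definition R0 :: "real \<Rightarrow> (real \<Rightarrow> real) \<Rightarrow> (real \<Rightarrow> real) \<Rightarrow> real \<Rightarrow> real" where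
  "R0 \<gamma> \<tau>0 u0 x = deriv u0 x + sound_speed \<gamma> (\<tau>0 x) * deriv \<tau>0 x"

definition S0 :: "real \<Rightarrow> (real \<Rightarrow> real) \<Rightarrow> (real \<Rightarrow> real) \<Rightarrow> real \<Rightarrow> real" where
  "S0 \<gamma> \<tau>0 u0 x = deriv u0 x - sound_speed \<gamma> (\<tau>0 x) * deriv \<tau>0 x"

definition data_conditions ::
  "real \<Rightarrow> real \<Rightarrow> (real \<Rightarrow> real) \<Rightarrow> (real \<Rightarrow> real) \<Rightarrow> bool" where
  "data_conditions \<gamma> cbar \<tau>0 u0 \<longleftrightarrow>
     (\<forall>x. 1 / cbar \<le> \<tau>0 x \<and> \<tau>0 x \<le> cbar) \<and>
     min (INF x. deriv u0 x - \<tau>0 x powr (- (\<gamma> + 1) / 2) * deriv \<tau>0 x)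
         (INF x. deriv u0 x + \<tau>0 x powr (- (\<gamma> + 1) / 2) * deriv \<tau>0 x) < 0"

text \<open>A classical solution before time \<open>T\<close>, with values also at \<open>t = T\<close>, where \<open>T\<close> is the first time
  at which \<open>R\<close> or \<open>S\<close> blows up. The values at \<open>t = T\<close> are tied to the solution in characteristic
  coordinates in \<open>char_solution\<close> below.\<close>

definition solution_until_blowup ::
  "real \<Rightarrow> (real \<Rightarrow> real) \<Rightarrow> (real \<Rightarrow> real) \<Rightarrow> real \<Rightarrow>
   (real \<times> real \<Rightarrow> real) \<Rightarrow> (real \<times> real \<Rightarrow> real) \<Rightarrow> bool" where
  "solution_until_blowup \<gamma> \<tau>0 u0 T \<tau> u \<longleftrightarrow>
     0 < T \<and>
     (\<forall>z \<in> UNIV \<times> {0..T}. \<tau> z > 0) \<and>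
     continuous_on (UNIV \<times> {0..T}) \<tau> \<and> continuous_on (UNIV \<times> {0..T}) u \<and>
     Ck_on 1 (UNIV \<times> {0..<T}) \<tau> \<and> Ck_on 1 (UNIV \<times> {0..<T}) u \<and>
     (\<forall>z \<in> UNIV \<times> {0<..<T}.
        pd2 \<tau> z - pd1 u z = 0 \<and> pd2 u z + pd1 (\<lambda>w. 1 / \<gamma> * \<tau> w powr (- \<gamma>)) z = 0) \<and>
     (\<forall>x. \<tau> (x, 0) = \<tau>0 x \<and> u (x, 0) = u0 x) \<and>
     (\<forall>T'. 0 \<le> T' \<and> T' < T \<longrightarrow>
        bounded (grad_R \<gamma> \<tau> u ` (UNIV \<times> {0..T'})) \<and>
        bounded (grad_S \<gamma> \<tau> u ` (UNIV \<times> {0..T'}))) \<and>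
     \<not> (bounded (grad_R \<gamma> \<tau> u ` (UNIV \<times> {0..<T})) \<and>
        bounded (grad_S \<gamma> \<tau> u ` (UNIV \<times> {0..<T})))"


section \<open>Characteristic coordinates\<close>

text \<open>\<open>\<xi>\<close> is the backward characteristic \<open>s \<mapsto> x\<^sub>\<plusminus>(s; x, t)\<close>; the sign is \<open>\<sigma> = \<plusminus>1\<close>.\<close>

definition is_characteristic ::
  "real \<Rightarrow> (real \<times> real \<Rightarrow> real) \<Rightarrow> real \<Rightarrow> real \<times> real \<Rightarrow> (real \<Rightarrow> real) \<Rightarrow> bool" where
  "is_characteristic \<gamma> \<tau> \<sigma> z \<xi> \<longleftrightarrow>
     \<xi> (snd z) = fst z \<and>
     (\<forall>s \<in> {0..snd z}.
        (\<xi> has_real_derivative \<sigma> * sound_speed \<gamma> (\<tau> (\<xi> s, s))) (at s within {0..snd z}))"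

definition char_coordinates ::
  "real \<Rightarrow> real \<Rightarrow> (real \<times> real \<Rightarrow> real) \<Rightarrow>
   (real \<times> real \<Rightarrow> real) \<Rightarrow> (real \<times> real \<Rightarrow> real) \<Rightarrow> bool" where
  "char_coordinates \<gamma> T \<tau> X Y \<longleftrightarrow>
     (\<forall>z \<in> UNIV \<times> {0..T}.
        (\<exists>\<xi>. is_characteristic \<gamma> \<tau> (- 1) z \<xi> \<and> X z = \<xi> 0) \<and>
        (\<exists>\<xi>. is_characteristic \<gamma> \<tau> 1 z \<xi> \<and> Y z = - \<xi> 0))"

definition Omega ::
  "real \<Rightarrow> (real \<times> real \<Rightarrow> real) \<Rightarrow> (real \<times> real \<Rightarrow> real) \<Rightarrow> (real \<times> real) set" where
  "Omega T X Y = (\<lambda>z. (X z, Y z)) ` (UNIV \<times> {0..T})"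

text \<open>The unknowns of the semilinear system, as functions of \<open>(X, Y)\<close>.\<close>

record char_fields =
  al :: "real \<times> real \<Rightarrow> real"
  be :: "real \<times> real \<Rightarrow> real"
  pp :: "real \<times> real \<Rightarrow> real"
  qq :: "real \<times> real \<Rightarrow> real"
  ta :: "real \<times> real \<Rightarrow> real"
  uu :: "real \<times> real \<Rightarrow> real"
  xx :: "real \<times> real \<Rightarrow> real"
  tt :: "real \<times> real \<Rightarrow> real"

definition semilinear_system_at :: "real \<Rightarrow> char_fields \<Rightarrow> real \<times> real \<Rightarrow> bool" where
  "semilinear_system_at \<gamma> F Z \<longleftrightarrow>
     (let c = sound_speed \<gamma> (ta F Z); c' = deriv (sound_speed \<gamma>) (ta F Z);
          \<alpha> = al F Z; \<beta> = be F Z; p = pp F Z; q = qq F Z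
      in pd2 (al F) Z = c' / (2 * c\<^sup>2) * q * sin (\<alpha> / 2) * sin ((\<alpha> - \<beta>) / 2) \<and>
         pd1 (be F) Z = c' / (2 * c\<^sup>2) * p * sin (\<beta> / 2) * sin ((\<beta> - \<alpha>) / 2) \<and>
         pd2 (pp F) Z = c' / (4 * c\<^sup>2) * p * q * cos (\<alpha> / 2) * sin ((\<beta> - \<alpha>) / 2) \<and>
         pd1 (qq F) Z = c' / (4 * c\<^sup>2) * p * q * cos (\<beta> / 2) * sin ((\<alpha> - \<beta>) / 2) \<and>
         pd1 (ta F) Z = 1 / (2 * c) * p * sin (\<alpha> / 2) \<and>
         pd2 (ta F) Z = 1 / (2 * c) * q * sin (\<beta> / 2) \<and>
         pd1 (uu F) Z = 1 / 2 * p * sin (\<alpha> / 2) \<and>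
         pd2 (uu F) Z = - (1 / 2) * q * sin (\<beta> / 2) \<and>
         pd1 (tt F) Z = 1 / (2 * c) * p * cos (\<alpha> / 2) \<and>
         pd2 (tt F) Z = 1 / (2 * c) * q * cos (\<beta> / 2) \<and>
         pd1 (xx F) Z = 1 / 2 * p * cos (\<alpha> / 2) \<and>
         pd2 (xx F) Z = - (1 / 2) * q * cos (\<beta> / 2))"

definition fields_Ck_on :: "nat \<Rightarrow> (real \<times> real) set \<Rightarrow> char_fields \<Rightarrow> bool" where
  "fields_Ck_on k A F \<longleftrightarrow>
     (\<forall>f \<in> {al F, be F, pp F, qq F, ta F, uu F, xx F, tt F}. Ck_on k A f)"

text \<open>The solution in characteristic coordinates that corresponds to \<open>(\<tau>, u)\<close>. Regularity up to the
  boundary of \<open>\<Omega>\<close> means \<open>C\<^sup>2\<close> on some open neighbourhood \<open>G\<close>, which is the regularity that \<open>C\<^sup>3\<close> data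
  provide; the system itself is only required on \<open>\<Omega>\<close>. The error exponent 4/9 in the cube-root
  expansions needs more: a third-order Taylor expansion of \<open>x\<close> in \<open>X\<close> with a quantitative remainder
  requires a modulus of continuity of \<open>\<alpha>\<^sub>X\<^sub>X\<close>. For that claim the solution being smooth is read as
  \<open>\<alpha>\<close> being \<open>C\<^sup>3\<close> near the singular point.\<close>

definition char_solution ::
  "real \<Rightarrow> (real \<Rightarrow> real) \<Rightarrow> (real \<Rightarrow> real) \<Rightarrow> real \<Rightarrow>
   (real \<times> real \<Rightarrow> real) \<Rightarrow> (real \<times> real \<Rightarrow> real) \<Rightarrow>
   (real \<times> real \<Rightarrow> real) \<Rightarrow> (real \<times> real \<Rightarrow> real) \<Rightarrow> char_fields \<Rightarrow> bool" where
  "char_solution \<gamma> \<tau>0 u0 T \<tau> u X Y F \<longleftrightarrow>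
     (\<exists>G. open G \<and> Omega T X Y \<subseteq> G \<and> fields_Ck_on 2 G F) \<and>
     (\<forall>z \<in> UNIV \<times> {0..T}. let Z = (X z, Y z) in
        xx F Z = fst z \<and> tt F Z = snd z \<and> ta F Z = \<tau> z \<and> uu F Z = u z) \<and>
     (\<forall>z \<in> UNIV \<times> {0..<T}. let Z = (X z, Y z) in
        al F Z = 2 * arctan (grad_R \<gamma> \<tau> u z) \<and>
        be F Z = 2 * arctan (grad_S \<gamma> \<tau> u z) \<and>
        pp F Z = sqrt (1 + (grad_R \<gamma> \<tau> u z)\<^sup>2) / pd1 X z \<and>
        qq F Z = sqrt (1 + (grad_S \<gamma> \<tau> u z)\<^sup>2) / (- pd1 Y z)) \<and>
     (\<forall>Z \<in> Omega T X Y. al F Z \<in> {- pi..<pi} \<and> be F Z \<in> {- pi..<pi}) \<and>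
     (\<forall>Z \<in> Omega T X Y. semilinear_system_at \<gamma> F Z) \<and>
     (\<forall>x. ta F (x, - x) = \<tau>0 x \<and> uu F (x, - x) = u0 x \<and>
          al F (x, - x) = 2 * arctan (R0 \<gamma> \<tau>0 u0 x) \<and>
          be F (x, - x) = 2 * arctan (S0 \<gamma> \<tau>0 u0 x) \<and>
          pp F (x, - x) = sqrt (1 + (R0 \<gamma> \<tau>0 u0 x)\<^sup>2) \<and>
          qq F (x, - x) = sqrt (1 + (S0 \<gamma> \<tau>0 u0 x)\<^sup>2) \<and>
          tt F (x, - x) = 0 \<and> xx F (x, - x) = x)"


section \<open>Singular points and generic data\<close>

definition final_boundary ::
  "real \<Rightarrow> (real \<times> real \<Rightarrow> real) \<Rightarrow> (real \<times> real \<Rightarrow> real) \<Rightarrow> char_fields \<Rightarrow>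
   (real \<times> real) set" where
  "final_boundary T X Y F = {Z \<in> Omega T X Y. tt F Z = T}"

definition singular_point ::
  "real \<Rightarrow> (real \<times> real \<Rightarrow> real) \<Rightarrow> (real \<times> real \<Rightarrow> real) \<Rightarrow> char_fields \<Rightarrow>
   real \<times> real \<Rightarrow> bool" where
  "singular_point T X Y F Z \<longleftrightarrow>
     Z \<in> final_boundary T X Y F \<and> (al F Z = - pi \<or> be F Z = - pi)"

definition type1 :: "char_fields \<Rightarrow> real \<times> real \<Rightarrow> bool" where
  "type1 F Z \<longleftrightarrow>
     (al F Z = - pi \<and> pd1 (al F) Z = 0 \<and> be F Z \<noteq> - pi \<and> pd1 (pd1 (al F)) Z \<noteq> 0) \<or>
     (be F Z = - pi \<and> pd2 (be F) Z = 0 \<and> al F Z \<noteq> - pi \<and> pd2 (pd2 (be F)) Z \<noteq> 0)"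

definition type2 :: "char_fields \<Rightarrow> real \<times> real \<Rightarrow> bool" where
  "type2 F Z \<longleftrightarrow>
     (al F Z = - pi \<and> pd1 (al F) Z \<noteq> 0 \<and> be F Z \<noteq> - pi) \<or>
     (be F Z = - pi \<and> pd2 (be F) Z \<noteq> 0 \<and> al F Z \<noteq> - pi)"

definition type3 :: "char_fields \<Rightarrow> real \<times> real \<Rightarrow> bool" where
  "type3 F Z \<longleftrightarrow>
     al F Z = - pi \<and> be F Z = - pi \<and> pd1 (al F) Z \<noteq> 0 \<and> pd2 (be F) Z \<noteq> 0"

definition generic_data ::
  "real \<Rightarrow> real \<Rightarrow> ((real \<Rightarrow> real) \<times> (real \<Rightarrow> real)) set \<Rightarrow> bool" where
  "generic_data \<gamma> taubar D \<longleftrightarrow>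
     open_dense_data D \<and>
     (\<forall>\<tau>0 u0 cbar T \<tau> u X Y F.
        ((\<lambda>x. \<tau>0 x - taubar), u0) \<in> D \<and> cbar > 0 \<and> data_conditions \<gamma> cbar \<tau>0 u0 \<and>
        solution_until_blowup \<gamma> \<tau>0 u0 T \<tau> u \<and> char_coordinates \<gamma> T \<tau> X Y \<and>
        char_solution \<gamma> \<tau>0 u0 T \<tau> u X Y F \<longrightarrow>
          (\<exists>E. finite E \<and>
               Ck_on 2 (UNIV \<times> {0..T} - E \<times> {T}) \<tau> \<and>
               Ck_on 2 (UNIV \<times> {0..T} - E \<times> {T}) u) \<and>
          (\<forall>Z \<in> final_boundary T X Y F.
             \<not> (al F Z = - pi \<and> pd1 (al F) Z = 0 \<and> pd1 (pd1 (al F)) Z = 0) \<and>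
             \<not> (be F Z = - pi \<and> pd2 (be F) Z = 0 \<and> pd2 (pd2 (be F)) Z = 0) \<and>
             \<not> (al F Z = - pi \<and> be F Z = - pi \<and> pd1 (al F) Z = 0) \<and>
             \<not> (al F Z = - pi \<and> be F Z = - pi \<and> pd2 (be F) Z = 0)))"

text \<open>The cube-root expansions with an error of order 4/9. The notation \<open>O(1)\<close> near the point and
  for \<open>t \<le> T\<close> is a Landau symbol for the filter of points of the closed strip tending to \<open>(xs, T)\<close>.
  The function \<open>root 3\<close> is odd.\<close>

definition cube_root_expansions ::
  "real \<Rightarrow> real \<Rightarrow> (real \<times> real \<Rightarrow> real) \<Rightarrow> (real \<times> real \<Rightarrow> real) \<Rightarrow> real \<Rightarrow> real \<Rightarrow> bool" where
  "cube_root_expansions \<gamma> T \<tau> u xs \<zeta> \<longleftrightarrow>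
     (let c = sound_speed \<gamma> (\<tau> (xs, T));
          \<F> = at (xs, T) within (UNIV \<times> {0..T}) in
        (\<lambda>(x, t). \<tau> (x, t) - \<tau> (xs, T) - \<zeta> * root 3 (c * (t - T) + (x - xs)))
          \<in> O[\<F>](\<lambda>(x, t). (\<bar>t - T\<bar> + \<bar>x - xs\<bar>) powr (4 / 9)) \<and>
        (\<lambda>(x, t). u (x, t) - u (xs, T) - c * \<zeta> * root 3 (c * (t - T) + (x - xs)))
          \<in> O[\<F>](\<lambda>(x, t). (\<bar>t - T\<bar> + \<bar>x - xs\<bar>) powr (4 / 9)))"

end

theory Submission imports Defs
begin

text \<open>
  Write \<open>U\<close> for the image of the times \<open>t < T\<close> under \<open>(x, t) \<mapsto> (X, Y)\<close>. In the plane of \<open>(X, Y)\<close> all fields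
  are \<open>C\<^sup>2\<close> in an open neighbourhood of \<open>\<Omega>\<close>, and the singularity is only that of the map back to the physical plane:
  \<open>t\<^sub>X\<close> and \<open>x\<^sub>X\<close> are positive multiples of \<open>cos (\<alpha> / 2)\<close>, which vanishes where \<open>\<alpha> = - \<pi>\<close>.

  \<^bold>\<open>Why only Type-1.\<close> Before \<open>T\<close> the gradients are finite, so \<open>- \<pi> < \<alpha>, \<beta> < \<pi>\<close> on \<open>U\<close>. Let \<open>\<alpha> = - \<pi>\<close> at a
  singular point \<open>(X0, Y0)\<close>. The segments of the row and the column through this point that end at it lie in
  \<open>U\<close> (\<open>left_segment\<close>, \<open>lower_segment\<close>), hence \<open>\<alpha>\<^sub>X \<le> 0\<close>. If \<open>\<alpha>\<^sub>X < 0\<close>, then \<open>t\<^sub>X\<^sub>X < 0\<close>, and \<open>t < T\<close> also in the quadrant to the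
  right of and below the point. By connectedness this quadrant belongs to \<open>U\<close> near the point, although \<open>\<alpha> < - \<pi>\<close>
  immediately to the right of the point: a contradiction (\<open>no_right_escape\<close>, \<open>a1_zero\<close>). So \<open>\<alpha>\<^sub>X = 0\<close>, and the values excluded for
  generic data give \<open>\<beta> \<noteq> - \<pi>\<close> and \<open>\<alpha>\<^sub>X\<^sub>X > 0\<close> (\<open>singular_type1\<close>). The case \<open>\<beta> = - \<pi>\<close> is its mirror image.

  \<^bold>\<open>Why the exponents 1/3 and 4/9.\<close> Put \<open>\<xi> = X - X0\<close>, \<open>\<eta> = Y - Y0\<close>. As \<open>cos (\<alpha> / 2)\<close> vanishes to second order in \<open>\<xi>\<close>, both
  \<open>t - T\<close> and \<open>x - x\<^sup>*\<close> are a linear term in \<open>\<eta>\<close>, plus a multiple of \<open>\<xi>\<^sup>3\<close>, plus a remainder bounded by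
  \<open>\<bar>\<xi> \<eta>\<bar> + \<xi>\<^sup>4 + \<eta>\<^sup>2\<close> (\<open>cubic_expansion\<close>). The terms in \<open>\<eta>\<close> cancel in \<open>c (t - T) + (x - x\<^sup>*)\<close>, which is therefore
  \<open>A \<xi>\<^sup>3\<close> up to an error of order \<open>d\<^bsup>4/3\<^esup>\<close>, where \<open>d = \<bar>t - T\<bar> + \<bar>x - x\<^sup>*\<bar>\<close>. Taking cube roots gives \<open>\<xi>\<close> up to \<open>d\<^bsup>4/9\<^esup>\<close>
  (\<open>cube_root_estimate\<close>), and \<open>\<tau>\<close> and \<open>u\<close> are affine in \<open>\<xi>\<close> up to \<open>\<xi>\<^sup>2 + \<bar>\<eta>\<bar>\<close> (\<open>singular_expansion\<close>). Both slopes
  are nonzero, and their quotient is \<open>c\<close>.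

  \<^bold>\<open>Why the other invariant is smooth.\<close> Near a singular point \<open>(x, t) \<mapsto> (X, Y)\<close> extends continuously to \<open>t = T\<close> as
  the inverse of an injective map on a compact set (\<open>local_inverse\<close>). The gradient of \<open>\<varpi>\<^sub>+\<close> is \<open>(S, - c S)\<close> with
  \<open>S = tan (\<beta> / 2)\<close>, which is continuous up to \<open>t = T\<close> since \<open>\<beta> \<noteq> - \<pi>\<close>; hence \<open>\<varpi>\<^sub>+\<close> is \<open>C\<^sup>1\<close> there.

  It remains to derive the geometry of \<open>U\<close> from the Cauchy problem. The Riemann invariants bound \<open>\<tau>\<close> away from zero, so the
  wave speed is bounded, and Lipschitz in \<open>x\<close> on earlier strips. Characteristics are thus unique before \<open>T\<close>, their feet depend
  continuously and monotonically on the point, and \<open>U\<close> is open off the line \<open>X + Y = 0\<close> and closed under going back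
  along characteristics. That a singular point is a limit of points of \<open>U\<close> uses genericity once more: an isolated
  point of \<open>\<Omega>\<close> would leave the second derivatives of the fields there undetermined, and they could be chosen so
  as to attain an excluded value (\<open>isolated_unless_limit\<close>, \<open>singular_is_limit\<close>).
\<close>

section \<open>Functions of class \<open>C\<^sup>k\<close> and their partial derivatives\<close>

lemma has_pd1:
  assumes "(f has_derivative (\<lambda>v. g * fst v + h * snd v)) (at z within A)"
    and "open I" "fst z \<in> I" "\<And>s. s \<in> I \<Longrightarrow> (s, snd z) \<in> A"
  shows "((\<lambda>s. f (s, snd z)) has_real_derivative g) (at (fst z))"
proof -
  have 1: "((\<lambda>s. (s, snd z)) has_derivative (\<lambda>v. (v, 0))) (at (fst z) within I)"
    by (rule has_derivative_Pair[OF has_derivative_ident has_derivative_const])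
  have 2: "(f has_derivative (\<lambda>v. g * fst v + h * snd v)) (at (fst z, snd z) within (\<lambda>s. (s, snd z)) ` I)"
    by (rule has_derivative_subset[of _ _ _ A]) (use assms(1,4) in auto)
  have "((\<lambda>s. f (s, snd z)) has_derivative (\<lambda>v. g * v)) (at (fst z) within I)"
    using has_derivative_in_compose[OF 1 2] by simp
  then show ?thesis
    unfolding has_field_derivative_def at_within_open[OF assms(3,2)] .
qed

lemma has_pd2:
  assumes "(f has_derivative (\<lambda>v. g * fst v + h * snd v)) (at z within A)"
    and "open I" "snd z \<in> I" "\<And>s. s \<in> I \<Longrightarrow> (fst z, s) \<in> A"
  shows "((\<lambda>s. f (fst z, s)) has_real_derivative h) (at (snd z))"
proof -
  have 1: "((\<lambda>s. (fst z, s)) has_derivative (\<lambda>v. (0, v))) (at (snd z) within I)"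
    by (rule has_derivative_Pair[OF has_derivative_const has_derivative_ident])
  have 2: "(f has_derivative (\<lambda>v. g * fst v + h * snd v)) (at (fst z, snd z) within (\<lambda>s. (fst z, s)) ` I)"
    by (rule has_derivative_subset[of _ _ _ A]) (use assms(1,4) in auto)
  have "((\<lambda>s. f (fst z, s)) has_derivative (\<lambda>v. h * v)) (at (snd z) within I)"
    using has_derivative_in_compose[OF 1 2] by simp
  then show ?thesis
    unfolding has_field_derivative_def at_within_open[OF assms(3,2)] .
qed

lemma open_slice1:
  assumes "open (G :: (real \<times> real) set)" shows "open {s. (s, y) \<in> G}"
proof -
  have "open ((\<lambda>s. (s, y)) -` G)"
    using assms by (rule open_vimage) (simp add: continuous_on_Pair)
  then show ?thesis by (simp add: vimage_def)
qed

lemma open_slice2: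
  assumes "open (G :: (real \<times> real) set)" shows "open {s. (x, s) \<in> G}"
proof -
  have "open ((\<lambda>s. (x, s)) -` G)"
    using assms by (rule open_vimage) (simp add: continuous_on_Pair)
  then show ?thesis by (simp add: vimage_def)
qed

lemma pd_of_has_derivative:
  assumes "(f has_derivative (\<lambda>v. g * fst v + h * snd v)) (at z)"
  shows "((\<lambda>s. f (s, snd z)) has_real_derivative g) (at (fst z))"
    and "((\<lambda>s. f (fst z, s)) has_real_derivative h) (at (snd z))"
    and "pd1 f z = g" and "pd2 f z = h"
proof -
  show 1: "((\<lambda>s. f (s, snd z)) has_real_derivative g) (at (fst z))"
    by (rule has_pd1[of f g h z UNIV UNIV]) (use assms in auto)
  show 2: "((\<lambda>s. f (fst z, s)) has_real_derivative h) (at (snd z))"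
    by (rule has_pd2[of f g h z UNIV UNIV]) (use assms in auto)
  show "pd1 f z = g" "pd2 f z = h"
    using 1 2 by (auto simp: pd1_def pd2_def DERIV_imp_deriv)
qed

lemma Ck_on_SucE:
  assumes "Ck_on (Suc k) A f"
  obtains g h where "\<And>z. z \<in> A \<Longrightarrow> (f has_derivative (\<lambda>v. g z * fst v + h z * snd v)) (at z within A)"
    "Ck_on k A g" "Ck_on k A h"
  using assms unfolding Ck_on.simps by blast

lemma Ck_on_SucI:
  assumes "\<And>z. z \<in> A \<Longrightarrow> (f has_derivative (\<lambda>v. g z * fst v + h z * snd v)) (at z within A)"
    and "Ck_on k A g" and "Ck_on k A h"
  shows "Ck_on (Suc k) A f"
  unfolding Ck_on.simps using assms by blast

text \<open>The existential quantifier over the two derivatives makes the defining equation a bad rewrite rule.\<close>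

declare Ck_on.simps(2) [simp del]

lemma Ck_on_cong:
  assumes "\<And>z. z \<in> A \<Longrightarrow> f z = g z" and "Ck_on k A f"
  shows "Ck_on k A g"
proof (cases k)
  case 0
  then show ?thesis using assms continuous_on_cong[of A A f g] by auto
next
  case (Suc n)
  obtain a b where ab: "\<And>z. z \<in> A \<Longrightarrow> (f has_derivative (\<lambda>v. a z * fst v + b z * snd v)) (at z within A)"
    "Ck_on n A a" "Ck_on n A b"
    using assms(2) Ck_on_SucE[of n A f] unfolding Suc by metis
  show ?thesis unfolding Suc
  proof (rule Ck_on_SucI[OF _ ab(2,3)])
    fix z assume z: "z \<in> A"
    show "(g has_derivative (\<lambda>v. a z * fst v + b z * snd v)) (at z within A)"
      by (rule has_derivative_transform[OF z _ ab(1)[OF z]]) (use assms(1) in simp)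
  qed
qed

lemma Ck_on_subset: "Ck_on k A f \<Longrightarrow> B \<subseteq> A \<Longrightarrow> Ck_on k B f"
proof (induction k arbitrary: f)
  case 0
  then show ?case by (auto intro: continuous_on_subset)
next
  case (Suc k)
  obtain g h where gh: "\<And>z. z \<in> A \<Longrightarrow> (f has_derivative (\<lambda>v. g z * fst v + h z * snd v)) (at z within A)"
    "Ck_on k A g" "Ck_on k A h"
    using Ck_on_SucE[OF Suc.prems(1)] by metis
  show ?case
  proof (rule Ck_on_SucI[where g=g and h=h])
    fix z assume "z \<in> B"
    then show "(f has_derivative (\<lambda>v. g z * fst v + h z * snd v)) (at z within B)"
      by (intro has_derivative_subset[OF gh(1) Suc.prems(2)]) (use Suc.prems(2) in auto)
  qed (use Suc.IH gh Suc.prems(2) in auto)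
qed

lemma Ck_on_SucD: "Ck_on (Suc k) A f \<Longrightarrow> Ck_on k A f"
proof (induction k arbitrary: f)
  case 0
  then show ?case unfolding Ck_on.simps continuous_on_eq_continuous_within
    using has_derivative_continuous by metis
next
  case (Suc k)
  obtain g h where gh: "\<And>z. z \<in> A \<Longrightarrow> (f has_derivative (\<lambda>v. g z * fst v + h z * snd v)) (at z within A)"
    "Ck_on (Suc k) A g" "Ck_on (Suc k) A h"
    using Ck_on_SucE[OF Suc.prems(1)] by metis
  show ?case by (rule Ck_on_SucI[OF gh(1)]) (use gh Suc.IH in auto)
qed

lemma Ck_on_continuous: "Ck_on k A f \<Longrightarrow> continuous_on A f"
  by (induction k) (auto dest: Ck_on_SucD)

lemma Ck_on_openI:
  assumes "\<And>z. z \<in> G \<Longrightarrow> (f has_derivative (\<lambda>v. g z * fst v + h z * snd v)) (at z)"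
    and "Ck_on k G g" and "Ck_on k G h"
  shows "Ck_on (Suc k) G f"
  by (rule Ck_on_SucI[OF has_derivative_at_withinI[OF assms(1)] assms(2,3)])

lemma Ck_on_openD:
  assumes "open G" "Ck_on (Suc k) G f"
  shows "\<And>z. z \<in> G \<Longrightarrow> (f has_derivative (\<lambda>v. pd1 f z * fst v + pd2 f z * snd v)) (at z)"
    and "Ck_on k G (pd1 f)" and "Ck_on k G (pd2 f)"
proof -
  obtain g h where gh: "\<And>z. z \<in> G \<Longrightarrow> (f has_derivative (\<lambda>v. g z * fst v + h z * snd v)) (at z within G)"
    "Ck_on k G g" "Ck_on k G h"
    using Ck_on_SucE[OF assms(2)] by metis
  have gh1: "(f has_derivative (\<lambda>v. g z * fst v + h z * snd v)) (at z)" if "z \<in> G" for z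
    using gh(1)[OF that] unfolding at_within_open[OF that assms(1)] .
  have eq: "g z = pd1 f z" "h z = pd2 f z" if "z \<in> G" for z
    using pd_of_has_derivative(3,4)[OF gh1[OF that]] by auto
  show "(f has_derivative (\<lambda>v. pd1 f z * fst v + pd2 f z * snd v)) (at z)" if "z \<in> G" for z
    using gh1[OF that] unfolding eq[OF that] .
  show "Ck_on k G (pd1 f)" by (rule Ck_on_cong[OF eq(1) gh(2)])
  show "Ck_on k G (pd2 f)" by (rule Ck_on_cong[OF eq(2) gh(3)])
qed

lemma Ck_on_const: "Ck_on k A (\<lambda>z. c)"
proof (induction k arbitrary: c)
  case (Suc k)
  show ?case
    by (rule Ck_on_openI[where g="\<lambda>z. 0" and h="\<lambda>z. 0"]) (use Suc in auto)
qed auto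

lemma Ck_on_add: "Ck_on k A f \<Longrightarrow> Ck_on k A g \<Longrightarrow> Ck_on k A (\<lambda>z. f z + g z)"
proof (induction k arbitrary: f g)
  case (Suc k)
  obtain a b where ab: "\<And>z. z \<in> A \<Longrightarrow> (f has_derivative (\<lambda>v. a z * fst v + b z * snd v)) (at z within A)"
    "Ck_on k A a" "Ck_on k A b" using Ck_on_SucE[OF Suc.prems(1)] by metis
  obtain c d where cd: "\<And>z. z \<in> A \<Longrightarrow> (g has_derivative (\<lambda>v. c z * fst v + d z * snd v)) (at z within A)"
    "Ck_on k A c" "Ck_on k A d" using Ck_on_SucE[OF Suc.prems(2)] by metis
  show ?case
  proof (rule Ck_on_SucI[where g="\<lambda>z. a z + c z" and h="\<lambda>z. b z + d z"])
    fix z assume z: "z \<in> A"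
    show "((\<lambda>z. f z + g z) has_derivative (\<lambda>v. (a z + c z) * fst v + (b z + d z) * snd v)) (at z within A)"
      by (rule has_derivative_eq_rhs[OF has_derivative_add[OF ab(1)[OF z] cd(1)[OF z]]])
        (auto simp: algebra_simps)
  qed (use Suc.IH ab cd in auto)
qed (auto intro: continuous_on_add)

lemma Ck_on_mult: "Ck_on k A f \<Longrightarrow> Ck_on k A g \<Longrightarrow> Ck_on k A (\<lambda>z. f z * g z)"
proof (induction k arbitrary: f g)
  case (Suc k)
  note S = Suc.prems[THEN Ck_on_SucD]
  obtain a b where ab: "\<And>z. z \<in> A \<Longrightarrow> (f has_derivative (\<lambda>v. a z * fst v + b z * snd v)) (at z within A)"
    "Ck_on k A a" "Ck_on k A b" using Ck_on_SucE[OF Suc.prems(1)] by metis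
  obtain c d where cd: "\<And>z. z \<in> A \<Longrightarrow> (g has_derivative (\<lambda>v. c z * fst v + d z * snd v)) (at z within A)"
    "Ck_on k A c" "Ck_on k A d" using Ck_on_SucE[OF Suc.prems(2)] by metis
  show ?case
  proof (rule Ck_on_SucI[where g="\<lambda>z. f z * c z + a z * g z" and h="\<lambda>z. f z * d z + b z * g z"])
    fix z assume z: "z \<in> A"
    show "((\<lambda>z. f z * g z) has_derivative
      (\<lambda>v. (f z * c z + a z * g z) * fst v + (f z * d z + b z * g z) * snd v)) (at z within A)"
      by (rule has_derivative_eq_rhs[OF has_derivative_mult[OF ab(1)[OF z] cd(1)[OF z]]])
        (auto simp: algebra_simps)
  qed (use Suc.IH ab cd S Ck_on_add in auto)
qed (auto intro: continuous_on_mult)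

lemma Ck_on_fst: "Ck_on k A fst"
proof (cases k)
  case (Suc n)
  show ?thesis unfolding Suc
    by (rule Ck_on_openI[where g="\<lambda>z. 1" and h="\<lambda>z. 0"])
      (simp_all add: Ck_on_const has_derivative_fst[OF has_derivative_ident])
qed (simp add: continuous_on_fst)

lemma Ck_on_glue:
  assumes "open A" "open B" "A \<inter> B = {}"
  shows "Ck_on k A f \<Longrightarrow> Ck_on k B g \<Longrightarrow> Ck_on k (A \<union> B) (\<lambda>z. if z \<in> A then f z else g z)"
proof (induction k arbitrary: f g)
  case 0
  have *: "continuous_on (A \<union> B) (\<lambda>z. if z \<in> A then f z else g z)"
  proof (rule continuous_on_open_Un[OF assms(1,2)])
    show "continuous_on A (\<lambda>z. if z \<in> A then f z else g z)"
      using 0(1) by (simp cong: continuous_on_cong)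
    have "z \<notin> A" if "z \<in> B" for z using that assms(3) by auto
    then show "continuous_on B (\<lambda>z. if z \<in> A then f z else g z)"
      using 0(2) by (simp cong: continuous_on_cong)
  qed
  then show ?case by simp
next
  case (Suc k)
  let ?h = "\<lambda>z. if z \<in> A then f z else g z"
  note f = Ck_on_openD[OF assms(1) Suc.prems(1)]
  note g = Ck_on_openD[OF assms(2) Suc.prems(2)]
  have "(?h has_derivative (\<lambda>v. (if z \<in> A then pd1 f z else pd1 g z) * fst v
       + (if z \<in> A then pd2 f z else pd2 g z) * snd v)) (at z)" if "z \<in> A \<union> B" for z
  proof (cases "z \<in> A")
    case True
    have "(?h has_derivative (\<lambda>v. pd1 f z * fst v + pd2 f z * snd v)) (at z)"
      by (rule has_derivative_transform_within_open[OF f(1)[OF True] assms(1) True]) auto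
    then show ?thesis using True by simp
  next
    case False
    then have B: "z \<in> B" using that by auto
    have "(?h has_derivative (\<lambda>v. pd1 g z * fst v + pd2 g z * snd v)) (at z)"
      by (rule has_derivative_transform_within_open[OF g(1)[OF B] assms(2) B]) (use assms(3) in auto)
    then show ?thesis using False by simp
  qed
  then show ?case
    by (rule Ck_on_openI) (use Suc.IH f g in auto)
qed

text \<open>The system is symmetric under the exchange of the two variables together with \<open>\<alpha>\<close> and \<open>\<beta>\<close>, \<open>p\<close> and \<open>q\<close>.
  The following lemmas transport results between the two families of characteristics.\<close>

lemma pd_swap: "pd1 (f \<circ> prod.swap) = pd2 f \<circ> prod.swap" "pd2 (f \<circ> prod.swap) = pd1 f \<circ> prod.swap"
  by (auto simp: pd1_def pd2_def fun_eq_iff)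

lemma open_swap: "open G \<Longrightarrow> open (prod.swap -` (G :: (real \<times> real) set))"
  by (rule open_vimage) (simp_all add: continuous_on_swap)

lemma Ck_on_swap:
  assumes "open G"
  shows "Ck_on k G f \<Longrightarrow> Ck_on k (prod.swap -` G) (f \<circ> prod.swap)"
proof (induction k arbitrary: f)
  case 0
  then show ?case
    unfolding Ck_on.simps
    by (intro continuous_on_compose) (auto intro: continuous_on_swap continuous_on_subset)
next
  case (Suc k)
  note f = Ck_on_openD[OF assms Suc.prems]
  have "((f \<circ> prod.swap) has_derivative (\<lambda>v. (pd2 f \<circ> prod.swap) z * fst v + (pd1 f \<circ> prod.swap) z * snd v)) (at z)"
    if "z \<in> prod.swap -` G" for z
  proof -
    have s: "(prod.swap has_derivative prod.swap) (at z)"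
      unfolding prod.swap_def
      by (rule has_derivative_Pair[OF has_derivative_snd[OF has_derivative_ident] has_derivative_fst[OF has_derivative_ident]])
    have "((\<lambda>x. f (prod.swap x)) has_derivative (\<lambda>v. pd1 f (prod.swap z) * fst (prod.swap v) + pd2 f (prod.swap z) * snd (prod.swap v))) (at z)"
      by (rule has_derivative_compose[OF s f(1)]) (use that in auto)
    then show ?thesis by (simp add: comp_def algebra_simps)
  qed
  then show ?case by (rule Ck_on_openI) (use Suc.IH f in auto)
qed

section \<open>Tools from real analysis\<close>

text \<open>A two-sided Gronwall estimate: \<open>D\<^sup>2 exp (- 2 L s)\<close> does not increase and \<open>D\<^sup>2 exp (2 L s)\<close> does not decrease. Both
  directions matter, since characteristics are traced backward as well as forward.\<close>

lemma gronwall_abs: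
  fixes D :: "real \<Rightarrow> real"
  assumes "a \<le> b" and cont: "continuous_on {a..b} D"
    and der: "\<And>s. a < s \<Longrightarrow> s < b \<Longrightarrow> (D has_real_derivative D' s) (at s)"
    and bound: "\<And>s. a < s \<Longrightarrow> s < b \<Longrightarrow> \<bar>D' s\<bar> \<le> L * \<bar>D s\<bar>"
  shows "\<bar>D b\<bar> \<le> exp (L * (b - a)) * \<bar>D a\<bar>" and "\<bar>D a\<bar> \<le> exp (L * (b - a)) * \<bar>D b\<bar>"
proof -
  have DD: "\<bar>D s * D' s\<bar> \<le> L * (D s)\<^sup>2" if "a < s" "s < b" for s
    using mult_left_mono[OF bound[OF that], of "\<bar>D s\<bar>"]
    by (simp add: abs_mult power2_eq_square algebra_simps)
  have "(D a)\<^sup>2 * exp (2 * L * a) \<le> (D b)\<^sup>2 * exp (2 * L * b)"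
  proof (rule DERIV_nonneg_imp_increasing_open[OF assms(1)])
    show "continuous_on {a..b} (\<lambda>s. (D s)\<^sup>2 * exp (2 * L * s))"
      by (intro continuous_intros cont)
    fix s assume s: "a < s" "s < b"
    have "((\<lambda>s. (D s)\<^sup>2 * exp (2 * L * s)) has_real_derivative
        2 * exp (2 * L * s) * (D s * D' s + L * (D s)\<^sup>2)) (at s)"
      by (auto intro!: derivative_eq_intros der[OF s] simp: power2_eq_square algebra_simps)
    moreover have "D s * D' s + L * (D s)\<^sup>2 \<ge> 0" using DD[OF s] by linarith
    ultimately show "\<exists>y. ((\<lambda>s. (D s)\<^sup>2 * exp (2 * L * s)) has_real_derivative y) (at s) \<and> 0 \<le> y"
      by (intro exI conjI) (assumption, simp)
  qed
  then have "(D a)\<^sup>2 \<le> (D b)\<^sup>2 * exp (2 * L * b) / exp (2 * L * a)"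
    by (simp add: field_simps)
  also have "\<dots> = (exp (L * (b - a)) * D b)\<^sup>2"
    by (simp add: power_mult_distrib exp_double[symmetric] exp_diff exp_minus field_simps)
  finally have "\<bar>D a\<bar> \<le> \<bar>exp (L * (b - a)) * D b\<bar>" by (simp only: abs_le_square_iff)
  then show "\<bar>D a\<bar> \<le> exp (L * (b - a)) * \<bar>D b\<bar>" by (simp add: abs_mult)
  have "- ((D a)\<^sup>2 * exp (- 2 * L * a)) \<le> - ((D b)\<^sup>2 * exp (- 2 * L * b))"
  proof (rule DERIV_nonneg_imp_increasing_open[OF assms(1)])
    show "continuous_on {a..b} (\<lambda>s. - ((D s)\<^sup>2 * exp (- 2 * L * s)))"
      by (intro continuous_intros cont)
    fix s assume s: "a < s" "s < b"
    have "((\<lambda>s. - ((D s)\<^sup>2 * exp (- 2 * L * s))) has_real_derivative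
        2 * exp (- 2 * L * s) * (L * (D s)\<^sup>2 - D s * D' s)) (at s)"
      by (auto intro!: derivative_eq_intros der[OF s] simp: power2_eq_square algebra_simps)
    moreover have "L * (D s)\<^sup>2 - D s * D' s \<ge> 0" using DD[OF s] by linarith
    ultimately show "\<exists>y. ((\<lambda>s. - ((D s)\<^sup>2 * exp (- 2 * L * s))) has_real_derivative y) (at s) \<and> 0 \<le> y"
      by (intro exI conjI) (assumption, simp)
  qed
  then have "(D b)\<^sup>2 \<le> (D a)\<^sup>2 * exp (- 2 * L * a) / exp (- 2 * L * b)"
    by (simp add: field_simps)
  also have "\<dots> = (exp (L * (b - a)) * D a)\<^sup>2"
    by (simp add: power_mult_distrib exp_double[symmetric] exp_diff exp_minus field_simps)
  finally have "\<bar>D b\<bar> \<le> \<bar>exp (L * (b - a)) * D a\<bar>" by (simp only: abs_le_square_iff)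
  then show "\<bar>D b\<bar> \<le> exp (L * (b - a)) * \<bar>D a\<bar>" by (simp add: abs_mult)
qed

text \<open>This keeps \<open>p\<close> and \<open>q\<close> positive: along a characteristic each of them solves a homogeneous linear equation.\<close>

lemma linear_ode_pos:
  fixes y k :: "real \<Rightarrow> real"
  assumes "a \<le> b" and cont: "continuous_on {a..b} y" "continuous_on {a..b} k"
    and der: "\<And>s. a < s \<Longrightarrow> s < b \<Longrightarrow> (y has_real_derivative k s * y s) (at s)"
    and "y a > 0"
  shows "y b > 0"
proof (rule ccontr)
  assume "\<not> y b > 0"
  then obtain c where c: "a \<le> c" "c \<le> b" "y c = 0"
    using IVT2'[of y b 0 a] assms by auto
  have "compact (k ` {a..b})"
    by (intro compact_continuous_image cont compact_Icc)
  then obtain L where L: "\<And>s. s \<in> {a..b} \<Longrightarrow> \<bar>k s\<bar> \<le> L"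
    using compact_imp_bounded bounded_iff by (metis image_eqI real_norm_def)
  have "\<bar>y a\<bar> \<le> exp (L * (c - a)) * \<bar>y c\<bar>"
  proof (rule gronwall_abs(2)[where D' = "\<lambda>s. k s * y s"])
    show "continuous_on {a..c} y" using cont(1) c by (auto intro: continuous_on_subset)
    fix s assume s: "a < s" "s < c"
    then show "(y has_real_derivative k s * y s) (at s)" using der c by auto
    show "\<bar>k s * y s\<bar> \<le> L * \<bar>y s\<bar>"
      using L[of s] s c by (simp add: abs_mult mult_right_mono)
  qed (use c in auto)
  then show False using c assms(5) by simp
qed

lemma second_order_upper:
  fixes g g' g'' :: "real \<Rightarrow> real"
  assumes "x0 \<le> x1"
    and g: "\<And>x. x0 \<le> x \<Longrightarrow> x \<le> x1 \<Longrightarrow> (g has_real_derivative g' x) (at x)"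
    and g': "\<And>x. x0 \<le> x \<Longrightarrow> x \<le> x1 \<Longrightarrow> (g' has_real_derivative g'' x) (at x)"
    and le: "\<And>x. x0 \<le> x \<Longrightarrow> x \<le> x1 \<Longrightarrow> g'' x \<le> - a"
  shows "g x1 \<le> g x0 + g' x0 * (x1 - x0) - a / 2 * (x1 - x0)\<^sup>2"
proof -
  have 1: "g' x + a * (x - x0) \<le> g' x0" if "x0 \<le> x" "x \<le> x1" for x
  proof -
    have "(\<lambda>s. g' s + a * (s - x0)) x \<le> (\<lambda>s. g' s + a * (s - x0)) x0"
    proof (rule DERIV_nonpos_imp_nonincreasing[OF that(1)])
      fix s assume s: "x0 \<le> s" "s \<le> x"
      then have "((\<lambda>s. g' s + a * (s - x0)) has_real_derivative g'' s + a) (at s)"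
        using that by (auto intro!: derivative_eq_intros g')
      then show "\<exists>y. ((\<lambda>s. g' s + a * (s - x0)) has_real_derivative y) (at s) \<and> y \<le> 0"
        using le[of s] s that by (intro exI[of _ "g'' s + a"]) auto
    qed
    then show ?thesis by simp
  qed
  have "(\<lambda>s. g s - g' x0 * (s - x0) + a / 2 * (s - x0)\<^sup>2) x1 \<le> (\<lambda>s. g s - g' x0 * (s - x0) + a / 2 * (s - x0)\<^sup>2) x0"
  proof (rule DERIV_nonpos_imp_nonincreasing[OF assms(1)])
    fix s assume s: "x0 \<le> s" "s \<le> x1"
    then have "((\<lambda>s. g s - g' x0 * (s - x0) + a / 2 * (s - x0)\<^sup>2) has_real_derivative g' s - g' x0 + a * (s - x0)) (at s)"
      by (auto intro!: derivative_eq_intros g)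
    then show "\<exists>y. ((\<lambda>s. g s - g' x0 * (s - x0) + a / 2 * (s - x0)\<^sup>2) has_real_derivative y) (at s) \<and> y \<le> 0"
      using 1[OF s] by (intro exI[of _ "g' s - g' x0 + a * (s - x0)"]) auto
  qed
  then show ?thesis by (simp add: algebra_simps)
qed

text \<open>One integration of an approximation by a monomial, as an application of the mean value theorem. Iterated, it gives
  Taylor expansions with explicit remainders; with \<open>k = 0\<close> it is the usual Lipschitz estimate.\<close>

lemma mvt_monomial:
  fixes g g' :: "real \<Rightarrow> real"
  assumes g: "\<And>s. s \<in> closed_segment x0 x \<Longrightarrow> (g has_real_derivative g' s) (at s)"
    and le: "\<And>s. s \<in> closed_segment x0 x \<Longrightarrow> \<bar>g' s - k * (s - x0) ^ n\<bar> \<le> B"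
  shows "\<bar>g x - g x0 - k / real (Suc n) * (x - x0) ^ Suc n\<bar> \<le> B * \<bar>x - x0\<bar>"
proof -
  let ?h = "\<lambda>s. g s - k / real (Suc n) * (s - x0) ^ Suc n"
  have d: "(?h has_real_derivative g' s - k * (s - x0) ^ n) (at s within closed_segment x0 x)"
    if "s \<in> closed_segment x0 x" for s
  proof -
    have "((\<lambda>s. k / real (Suc n) * (s - x0) ^ Suc n) has_real_derivative
         k / real (Suc n) * (real (Suc n) * (s - x0) ^ n)) (at s)"
      by (rule DERIV_cmult) (rule DERIV_cong[OF DERIV_power[OF DERIV_diff[OF DERIV_ident DERIV_const]]], simp)
    then have "((\<lambda>s. k / real (Suc n) * (s - x0) ^ Suc n) has_real_derivative k * (s - x0) ^ n) (at s)"
      by (simp del: of_nat_Suc power_Suc)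
    from DERIV_diff[OF g[OF that] this] show ?thesis
      by (rule has_field_derivative_at_within)
  qed
  have "norm (?h x - ?h x0) \<le> B * norm (x - x0)"
    by (rule field_differentiable_bound[OF convex_closed_segment d]) (use le in auto)
  then show ?thesis by (simp add: algebra_simps)
qed

text \<open>The function is constant only on one side, which is the situation at the end of a row in the domain.\<close>

lemma deriv_zero_left:
  fixes f :: "real \<Rightarrow> real"
  assumes "(f has_real_derivative D) (at x0)" and "\<epsilon> > 0"
    and "\<And>x. x0 - \<epsilon> < x \<Longrightarrow> x < x0 \<Longrightarrow> f x = f x0"
  shows "D = 0"
proof (rule ccontr)
  assume "D \<noteq> 0"
  then consider "D < 0" | "D > 0" by linarith
  then obtain d where d: "d > 0" "\<And>h. 0 < h \<Longrightarrow> h < d \<Longrightarrow> f (x0 - h) \<noteq> f x0"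
  proof cases
    case 1
    then show ?thesis using DERIV_neg_dec_left[OF assms(1)] that by (metis less_irrefl)
  next
    case 2
    then show ?thesis using DERIV_pos_inc_left[OF assms(1)] that by (metis less_irrefl)
  qed
  define h where "h = min d \<epsilon> / 2"
  have "0 < h" "h < d" "h < \<epsilon>" using d assms(2) by (auto simp: h_def)
  then show False using d(2)[of h] assms(3)[of "x0 - h"] by auto
qed

lemma continuous_agree_closure:
  fixes f g :: "'a::metric_space \<Rightarrow> 'b::metric_space"
  assumes "continuous_on G f" "continuous_on G g" "U \<subseteq> G" "\<And>z. z \<in> U \<Longrightarrow> f z = g z"
    and "z \<in> G" "z \<in> closure U"
  shows "f z = g z"
proof -
  obtain s where s: "\<And>n. s n \<in> U" "s \<longlonglongrightarrow> z"
    using assms(6) unfolding closure_sequential by blast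
  have sG: "eventually (\<lambda>n. s n \<in> G) sequentially" using s(1) assms(3) by (auto intro!: always_eventually)
  have "(\<lambda>n. f (s n)) \<longlonglongrightarrow> f z"
    by (rule continuous_on_tendsto_compose[OF assms(1) s(2) assms(5) sG])
  moreover have "(\<lambda>n. g (s n)) \<longlonglongrightarrow> g z"
    by (rule continuous_on_tendsto_compose[OF assms(2) s(2) assms(5) sG])
  moreover have "(\<lambda>n. f (s n)) = (\<lambda>n. g (s n))" using s(1) assms(4) by auto
  ultimately show ?thesis using LIMSEQ_unique by metis
qed

lemma continuous_le_closure:
  fixes f g :: "'a::metric_space \<Rightarrow> real"
  assumes "continuous_on G f" "continuous_on G g" "U \<subseteq> G" "\<And>z. z \<in> U \<Longrightarrow> f z \<le> g z"
    and "z \<in> G" "z \<in> closure U"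
  shows "f z \<le> g z"
proof -
  obtain s where s: "\<And>n. s n \<in> U" "s \<longlonglongrightarrow> z"
    using assms(6) unfolding closure_sequential by blast
  have sG: "eventually (\<lambda>n. s n \<in> G) sequentially" using s(1) assms(3) by (auto intro!: always_eventually)
  have "(\<lambda>n. f (s n)) \<longlonglongrightarrow> f z"
    by (rule continuous_on_tendsto_compose[OF assms(1) s(2) assms(5) sG])
  moreover have "(\<lambda>n. g (s n)) \<longlonglongrightarrow> g z"
    by (rule continuous_on_tendsto_compose[OF assms(2) s(2) assms(5) sG])
  ultimately show ?thesis using s(1) assms(4) by (intro LIMSEQ_le) auto
qed

text \<open>Boxes are convenient neighbourhoods because they contain, with two points, the corners of the axis-parallel
  rectangle that they span.\<close>

definition box_at :: "real \<times> real \<Rightarrow> real \<Rightarrow> (real \<times> real) set" where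
  "box_at z r = {fst z - r..fst z + r} \<times> {snd z - r..snd z + r}"

lemma mem_box_at: "(x, y) \<in> box_at z r \<longleftrightarrow> \<bar>x - fst z\<bar> \<le> r \<and> \<bar>y - snd z\<bar> \<le> r"
  by (auto simp: box_at_def)

lemma compact_box_at: "compact (box_at z r)" and convex_box_at: "convex (box_at z r)"
  by (auto simp: box_at_def intro: compact_Times convex_Times)

lemma box_at_mono: "r \<le> s \<Longrightarrow> box_at z r \<subseteq> box_at z s"
  by (auto simp: box_at_def)

lemma open_contains_box:
  assumes "open G" "z \<in> G"
  obtains r where "r > 0" "box_at z r \<subseteq> G"
proof -
  obtain e where e: "e > 0" "cball z e \<subseteq> G" using open_contains_cball assms by blast
  have "box_at z (e / 2) \<subseteq> cball z e"
  proof
    fix w assume "w \<in> box_at z (e / 2)"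
    then have "\<bar>fst z - fst w\<bar> + \<bar>snd z - snd w\<bar> \<le> e"
      by (cases w) (auto simp: mem_box_at abs_minus_commute)
    moreover have "dist z w \<le> \<bar>fst z - fst w\<bar> + \<bar>snd z - snd w\<bar>"
      by (simp add: dist_norm norm_prod_def sqrt_sum_squares_le_sum_abs)
    ultimately show "w \<in> cball z e" by simp
  qed
  then show ?thesis using that[of "e / 2"] e by auto
qed

lemma eventually_box:
  assumes "eventually P (nhds (z :: real \<times> real))"
  obtains r where "r > 0" "\<And>w. w \<in> box_at z r \<Longrightarrow> P w"
proof -
  obtain S where S: "open S" "z \<in> S" "\<And>w. w \<in> S \<Longrightarrow> P w"
    using assms unfolding eventually_nhds by blast
  obtain r where "r > 0" "box_at z r \<subseteq> S" by (rule open_contains_box[OF S(1,2)])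
  then show ?thesis using that S(3) by blast
qed

lemma eventually_less_nhds:
  fixes f :: "real \<times> real \<Rightarrow> real"
  assumes "open G" "continuous_on G f" "z \<in> G" "f z < a"
  shows "eventually (\<lambda>w. f w < a) (nhds z)"
proof -
  have "isCont f z" using assms(2,3) continuous_on_eq_continuous_at[OF assms(1)] by blast
  then have "(f \<longlongrightarrow> f z) (nhds z)" unfolding isCont_def tendsto_at_iff_tendsto_nhds .
  then show ?thesis using assms(4) by (rule order_tendstoD(2))
qed

lemma eventually_greater_nhds:
  fixes f :: "real \<times> real \<Rightarrow> real"
  assumes "open G" "continuous_on G f" "z \<in> G" "a < f z"
  shows "eventually (\<lambda>w. a < f w) (nhds z)"
  using eventually_less_nhds[of G "\<lambda>w. - f w" z "- a"] assms by (simp add: continuous_on_minus)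

lemma Ck_on_partials:
  assumes "open G" "Ck_on (Suc k) G f" "(x, y) \<in> G"
  shows "((\<lambda>s. f (s, y)) has_real_derivative pd1 f (x, y)) (at x)"
    and "((\<lambda>s. f (x, s)) has_real_derivative pd2 f (x, y)) (at y)"
  using pd_of_has_derivative(1,2)[OF Ck_on_openD(1)[OF assms]] by auto

lemma C1_lipschitz_box:
  assumes "open G" "Ck_on (Suc k) G f" "box_at z r \<subseteq> G"
  obtains K where "K \<ge> 0"
    "\<And>x y x' y'. (x, y) \<in> box_at z r \<Longrightarrow> (x', y') \<in> box_at z r \<Longrightarrow>
        \<bar>f (x', y') - f (x, y)\<bar> \<le> K * (\<bar>x' - x\<bar> + \<bar>y' - y\<bar>)"
proof -
  note f = Ck_on_openD[OF assms(1,2)]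
  have c: "continuous_on (box_at z r) (pd1 f)" "continuous_on (box_at z r) (pd2 f)"
    using f(2,3)[THEN Ck_on_continuous] assms(3) by (auto intro: continuous_on_subset)
  obtain K1 where K1: "\<And>w. w \<in> box_at z r \<Longrightarrow> \<bar>pd1 f w\<bar> \<le> K1"
    using compact_imp_bounded[OF compact_continuous_image[OF c(1) compact_box_at]]
    unfolding bounded_iff by (metis image_eqI real_norm_def)
  obtain K2 where K2: "\<And>w. w \<in> box_at z r \<Longrightarrow> \<bar>pd2 f w\<bar> \<le> K2"
    using compact_imp_bounded[OF compact_continuous_image[OF c(2) compact_box_at]]
    unfolding bounded_iff by (metis image_eqI real_norm_def)
  define K where "K = max 0 (max K1 K2)"
  have "\<bar>f (x', y') - f (x, y)\<bar> \<le> K * (\<bar>x' - x\<bar> + \<bar>y' - y\<bar>)"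
    if "(x, y) \<in> box_at z r" "(x', y') \<in> box_at z r" for x y x' y'
  proof -
    have 1: "\<bar>f (x', y) - f (x, y)\<bar> \<le> K * \<bar>x' - x\<bar>"
    proof -
      have in_box: "(s, y) \<in> box_at z r" if "s \<in> closed_segment x x'" for s
        using that \<open>(x, y) \<in> box_at z r\<close> \<open>(x', y') \<in> box_at z r\<close>
        by (auto simp: mem_box_at closed_segment_eq_real_ivl split: if_splits)
      have "\<bar>f (x', y) - f (x, y) - 0 / real (Suc 0) * (x' - x) ^ Suc 0\<bar> \<le> K * \<bar>x' - x\<bar>"
      proof (rule mvt_monomial[where g = "\<lambda>s. f (s, y)" and g' = "\<lambda>s. pd1 f (s, y)"])
        fix s assume "s \<in> closed_segment x x'"
        from in_box[OF this] show "((\<lambda>s. f (s, y)) has_real_derivative pd1 f (s, y)) (at s)"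
          "\<bar>pd1 f (s, y) - 0 * (s - x) ^ 0\<bar> \<le> K"
          using Ck_on_partials(1)[OF assms(1,2)] assms(3) K1 by (auto simp: K_def le_max_iff_disj)
      qed
      then show ?thesis by simp
    qed
    have 2: "\<bar>f (x', y') - f (x', y)\<bar> \<le> K * \<bar>y' - y\<bar>"
    proof -
      have in_box: "(x', s) \<in> box_at z r" if "s \<in> closed_segment y y'" for s
        using that \<open>(x, y) \<in> box_at z r\<close> \<open>(x', y') \<in> box_at z r\<close>
        by (auto simp: mem_box_at closed_segment_eq_real_ivl split: if_splits)
      have "\<bar>f (x', y') - f (x', y) - 0 / real (Suc 0) * (y' - y) ^ Suc 0\<bar> \<le> K * \<bar>y' - y\<bar>"
      proof (rule mvt_monomial[where g = "\<lambda>s. f (x', s)" and g' = "\<lambda>s. pd2 f (x', s)"])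
        fix s assume "s \<in> closed_segment y y'"
        from in_box[OF this] show "((\<lambda>s. f (x', s)) has_real_derivative pd2 f (x', s)) (at s)"
          "\<bar>pd2 f (x', s) - 0 * (s - y) ^ 0\<bar> \<le> K"
          using Ck_on_partials(2)[OF assms(1,2)] assms(3) K2 by (auto simp: K_def le_max_iff_disj)
      qed
      then show ?thesis by simp
    qed
    show ?thesis using 1 2 by (simp add: algebra_simps)
  qed
  then show ?thesis using that[of K] by (auto simp: K_def)
qed

section \<open>The characteristic plane near the final boundary\<close>

lemma closure_below:
  fixes x y :: real
  assumes "\<epsilon> > 0" "\<And>s. y - \<epsilon> < s \<Longrightarrow> s < y \<Longrightarrow> (x, s) \<in> U"
  shows "(x, y) \<in> closure U"
  unfolding closure_approachable
proof (intro allI impI)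
  fix e :: real assume "e > 0"
  then have "(x, y - min e \<epsilon> / 2) \<in> U" "dist (x, y - min e \<epsilon> / 2) (x, y) < e"
    using assms(1) by (auto intro!: assms(2) simp: dist_Pair_Pair dist_real_def)
  then show "\<exists>z\<in>U. dist z (x, y) < e" by blast
qed

lemma closure_left:
  fixes x y :: real
  assumes "\<epsilon> > 0" "\<And>s. x - \<epsilon> < s \<Longrightarrow> s < x \<Longrightarrow> (s, y) \<in> U"
  shows "(x, y) \<in> closure U"
  unfolding closure_approachable
proof (intro allI impI)
  fix e :: real assume "e > 0"
  then have "(x - min e \<epsilon> / 2, y) \<in> U" "dist (x - min e \<epsilon> / 2, y) (x, y) < e"
    using assms(1) by (auto intro!: assms(2) simp: dist_Pair_Pair dist_real_def)
  then show "\<exists>z\<in>U. dist z (x, y) < e" by blast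
qed

lemma swap_vimage_image: "prod.swap -` A = prod.swap ` A"
  by (force simp: prod.swap_def)

text \<open>The semilinear system near a final point \<open>(X0, Y0)\<close>, reduced to what the classification needs. Here \<open>a\<close> and \<open>b\<close> are \<open>\<alpha>\<close>
  and \<open>\<beta>\<close>, \<open>w\<close> is \<open>1 / (2 c)\<close>, and \<open>k\<close> and \<open>l\<close> are the logarithmic derivatives of \<open>p\<close> and \<open>q\<close>. The set \<open>U\<close> consists of the points of
  time less than \<open>T\<close>, where the system holds; the fields are smooth on the open set \<open>G\<close>. The assumption \<open>lower\<close> says
  that \<open>U\<close> contains the backward characteristic triangle of each of its points. All assumptions are invariant under
  exchange of the two variables.\<close>

locale char_plane =
  fixes U G :: "(real \<times> real) set" and T :: real
    and a b p q w t k l :: "real \<times> real \<Rightarrow> real" and X0 Y0 :: real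
  assumes open_G: "open G" and U_sub: "U \<subseteq> G" and Z0_G: "(X0, Y0) \<in> G"
    and C2_a: "Ck_on (Suc (Suc 0)) G a" and C2_b: "Ck_on (Suc (Suc 0)) G b"
    and C2_t: "Ck_on (Suc (Suc 0)) G t"
    and C1_p: "Ck_on (Suc 0) G p" and C1_q: "Ck_on (Suc 0) G q" and C1_w: "Ck_on (Suc 0) G w"
    and cont_k: "continuous_on G k" and cont_l: "continuous_on G l"
    and w_pos: "\<And>z. z \<in> G \<Longrightarrow> w z > 0"
    and diag: "\<And>x. (x, - x) \<in> U"
    and lower: "\<And>X Y X' Y'. (X, Y) \<in> U \<Longrightarrow> X' \<le> X \<Longrightarrow> Y' \<le> Y \<Longrightarrow> X' + Y' \<ge> 0 \<Longrightarrow> (X', Y') \<in> U"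
    and open_U: "open (U \<inter> {z. fst z + snd z > 0})"
    and closed_U: "\<And>z. z \<in> closure U \<Longrightarrow> z \<in> G \<Longrightarrow> t z < T \<Longrightarrow> z \<in> U"
    and t_U: "\<And>z. z \<in> U \<Longrightarrow> t z < T" and t_Z0: "t (X0, Y0) = T"
    and Z0_closure: "(X0, Y0) \<in> closure U" and sum_pos: "X0 + Y0 > 0"
    and p_diag: "\<And>x. p (x, - x) > 0" and q_diag: "\<And>x. q (x, - x) > 0"
    and a_U: "\<And>z. z \<in> U \<Longrightarrow> - pi < a z \<and> a z < pi"
    and b_U: "\<And>z. z \<in> U \<Longrightarrow> - pi < b z \<and> b z < pi"
    and a_Z0: "a (X0, Y0) < pi" and b_Z0: "b (X0, Y0) < pi"
    and t1: "\<And>z. z \<in> U \<Longrightarrow> pd1 t z = w z * p z * cos (a z / 2)"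
    and t2: "\<And>z. z \<in> U \<Longrightarrow> pd2 t z = w z * q z * cos (b z / 2)"
    and p2: "\<And>z. z \<in> U \<Longrightarrow> pd2 p z = k z * p z"
    and q1: "\<And>z. z \<in> U \<Longrightarrow> pd1 q z = l z * q z"
    and ab_eq: "a (X0, Y0) = b (X0, Y0) \<Longrightarrow> pd2 a (X0, Y0) = 0 \<and> pd1 b (X0, Y0) = 0"
    and gen_a: "\<not> (a (X0, Y0) = - pi \<and> pd1 a (X0, Y0) = 0 \<and> pd1 (pd1 a) (X0, Y0) = 0)"
    and gen_b: "\<not> (b (X0, Y0) = - pi \<and> pd2 b (X0, Y0) = 0 \<and> pd2 (pd2 b) (X0, Y0) = 0)"
    and gen_ab1: "\<not> (a (X0, Y0) = - pi \<and> b (X0, Y0) = - pi \<and> pd1 a (X0, Y0) = 0)"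
    and gen_ab2: "\<not> (a (X0, Y0) = - pi \<and> b (X0, Y0) = - pi \<and> pd2 b (X0, Y0) = 0)"
begin

lemma mirror:
  "char_plane (prod.swap -` U) (prod.swap -` G) T (b \<circ> prod.swap) (a \<circ> prod.swap)
     (q \<circ> prod.swap) (p \<circ> prod.swap) (w \<circ> prod.swap) (t \<circ> prod.swap)
     (l \<circ> prod.swap) (k \<circ> prod.swap) Y0 X0"
proof (unfold_locales, goal_cases)
  case 1 show ?case by (rule open_swap[OF open_G])
next
  case 2 show ?case using U_sub by auto
next
  case 3 show ?case using Z0_G by simp
next
  case 4 show ?case by (rule Ck_on_swap[OF open_G C2_b])
next
  case 5 show ?case by (rule Ck_on_swap[OF open_G C2_a])
next
  case 6 show ?case by (rule Ck_on_swap[OF open_G C2_t])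
next
  case 7 show ?case by (rule Ck_on_swap[OF open_G C1_q])
next
  case 8 show ?case by (rule Ck_on_swap[OF open_G C1_p])
next
  case 9 show ?case by (rule Ck_on_swap[OF open_G C1_w])
next
  case 10 show ?case using Ck_on_swap[OF open_G, of 0 l] cont_l by simp
next
  case 11 show ?case using Ck_on_swap[OF open_G, of 0 k] cont_k by simp
next
  case (12 z) then show ?case using w_pos by simp
next
  case (13 x) show ?case using diag[of "- x"] by simp
next
  case (14 X Y X' Y') then show ?case using lower[of Y X Y' X'] by simp
next
  case 15
  have "prod.swap -` U \<inter> {z. fst z + snd z > 0} = prod.swap -` (U \<inter> {z. fst z + snd z > 0})"
    by auto
  then show ?case using open_swap[OF open_U] by simp
next
  case (16 z)
  have "prod.swap ` closure (prod.swap -` U) \<subseteq> closure (prod.swap ` (prod.swap -` U))"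
    by (rule image_closure_subset[OF _ closed_closure closure_subset]) (rule continuous_on_swap)
  then have "prod.swap z \<in> closure U" using 16(1) by (auto simp: image_iff)
  then show ?case using 16 closed_U[of "prod.swap z"] by simp
next
  case (17 z) then show ?case using t_U by simp
next
  case 18 show ?case using t_Z0 by simp
next
  case 19
  have "prod.swap ` closure U \<subseteq> closure (prod.swap ` U)"
    by (rule image_closure_subset[OF _ closed_closure closure_subset]) (rule continuous_on_swap)
  then have "prod.swap (X0, Y0) \<in> closure (prod.swap ` U)" using Z0_closure by blast
  then show ?case by (simp add: swap_vimage_image)
next
  case 20 show ?case using sum_pos by simp
next
  case (21 x) show ?case using q_diag[of "- x"] by simp
next
  case (22 x) show ?case using p_diag[of "- x"] by simp
next
  case (23 z) then show ?case using b_U by simp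
next
  case (24 z) then show ?case using a_U by simp
next
  case 25 show ?case using b_Z0 by simp
next
  case 26 show ?case using a_Z0 by simp
next
  case (27 z) then show ?case using t2 by (simp add: pd_swap)
next
  case (28 z) then show ?case using t1 by (simp add: pd_swap)
next
  case (29 z) then show ?case using q1 by (simp add: pd_swap)
next
  case (30 z) then show ?case using p2 by (simp add: pd_swap)
next
  case 31 then show ?case using ab_eq by (simp add: pd_swap)
next
  case 32 show ?case using gen_b by (simp add: pd_swap)
next
  case 33 show ?case using gen_a by (simp add: pd_swap)
next
  case 34 show ?case using gen_ab2 by (auto simp: pd_swap)
next
  case 35 show ?case using gen_ab1 by (auto simp: pd_swap)
qed

lemmas cont_a = Ck_on_continuous[OF C2_a] and cont_b = Ck_on_continuous[OF C2_b]
  and cont_t = Ck_on_continuous[OF C2_t] and cont_p = Ck_on_continuous[OF C1_p]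
  and cont_q = Ck_on_continuous[OF C1_q] and cont_w = Ck_on_continuous[OF C1_w]
  and C1_a1 = Ck_on_openD(2)[OF open_G C2_a] and C1_t1 = Ck_on_openD(2)[OF open_G C2_t]
  and C1_b2 = Ck_on_openD(3)[OF open_G C2_b] and C1_t2 = Ck_on_openD(3)[OF open_G C2_t]

lemma closure_system:
  assumes "z \<in> G" "z \<in> closure U"
  shows "pd1 t z = w z * p z * cos (a z / 2)" "pd2 t z = w z * q z * cos (b z / 2)"
    "pd2 p z = k z * p z" "pd1 q z = l z * q z"
    "- pi \<le> a z" "a z \<le> pi" "- pi \<le> b z" "b z \<le> pi" "t z \<le> T"
proof -
  note cl = continuous_agree_closure[OF _ _ U_sub _ assms]
  show "pd1 t z = w z * p z * cos (a z / 2)"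
    by (rule cl) (auto intro!: continuous_on_mult continuous_on_cos continuous_on_divide continuous_on_const cont_a cont_p cont_w Ck_on_continuous[OF C1_t1] simp: t1)
  show "pd2 t z = w z * q z * cos (b z / 2)"
    by (rule cl) (auto intro!: continuous_on_mult continuous_on_cos continuous_on_divide continuous_on_const cont_b cont_q cont_w Ck_on_continuous[OF C1_t2] simp: t2)
  show "pd2 p z = k z * p z"
    by (rule cl) (auto intro!: continuous_on_mult continuous_on_cos continuous_on_divide continuous_on_const cont_p cont_k Ck_on_continuous[OF Ck_on_openD(3)[OF open_G C1_p]] simp: p2)
  show "pd1 q z = l z * q z"
    by (rule cl) (auto intro!: continuous_on_mult continuous_on_cos continuous_on_divide continuous_on_const cont_q cont_l Ck_on_continuous[OF Ck_on_openD(2)[OF open_G C1_q]] simp: q1)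
  note le = continuous_le_closure[OF _ _ U_sub _ assms]
  show "- pi \<le> a z" by (rule le) (use a_U cont_a in \<open>auto intro: less_imp_le\<close>)
  show "a z \<le> pi" by (rule le) (use a_U cont_a in \<open>auto intro: less_imp_le\<close>)
  show "- pi \<le> b z" by (rule le) (use b_U cont_b in \<open>auto intro: less_imp_le\<close>)
  show "b z \<le> pi" by (rule le) (use b_U cont_b in \<open>auto intro: less_imp_le\<close>)
  show "t z \<le> T" by (rule le) (use t_U cont_t in \<open>auto intro: less_imp_le\<close>)
qed

lemma boundary_time: "z \<in> G \<Longrightarrow> z \<in> closure U \<Longrightarrow> z \<notin> U \<Longrightarrow> t z = T"
  using closure_system(9) closed_U by fastforce

lemma p_pos_column:
  assumes "(X, Y) \<in> G" "X + Y \<ge> 0" and U: "\<And>s. - X \<le> s \<Longrightarrow> s < Y \<Longrightarrow> (X, s) \<in> U"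
  shows "p (X, Y) > 0"
proof (rule linear_ode_pos[of "- X" Y "\<lambda>s. p (X, s)" "\<lambda>s. k (X, s)"])
  have in_G: "(X, s) \<in> G" if "s \<in> {- X..Y}" for s
    using U[of s] U_sub assms(1) that by (cases "s = Y") auto
  have c: "continuous_on {- X..Y} (\<lambda>s. (X, s))" by (simp add: continuous_on_Pair)
  show "continuous_on {- X..Y} (\<lambda>s. p (X, s))" "continuous_on {- X..Y} (\<lambda>s. k (X, s))"
    by (rule continuous_on_compose2[OF cont_p c], use in_G in auto)
      (rule continuous_on_compose2[OF cont_k c], use in_G in auto)
  fix s assume s: "- X < s" "s < Y"
  then show "((\<lambda>s. p (X, s)) has_real_derivative k (X, s) * p (X, s)) (at s)"
    using Ck_on_partials(2)[OF open_G C1_p in_G[of s]] p2[of "(X, s)"] U[of s] by simp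
qed (use assms(2) p_diag in auto)

lemma q_pos_row:
  assumes "(X, Y) \<in> G" "X + Y \<ge> 0" and U: "\<And>s. - Y \<le> s \<Longrightarrow> s < X \<Longrightarrow> (s, Y) \<in> U"
  shows "q (X, Y) > 0"
  using char_plane.p_pos_column[OF mirror, of Y X] assms by (simp add: add.commute)

lemma quadrant:
  assumes "X < X0" "Y < Y0" "X + Y \<ge> 0"
  shows "(X, Y) \<in> U"
proof -
  have "min (X0 - X) (Y0 - Y) > 0" using assms by simp
  then obtain z where z: "z \<in> U" "dist z (X0, Y0) < min (X0 - X) (Y0 - Y)"
    using Z0_closure unfolding closure_approachable by blast
  have "\<bar>fst z - X0\<bar> \<le> dist z (X0, Y0)" "\<bar>snd z - Y0\<bar> \<le> dist z (X0, Y0)"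
    using dist_fst_le[of z "(X0, Y0)"] dist_snd_le[of z "(X0, Y0)"] by (auto simp: dist_real_def)
  then have "X \<le> fst z" "Y \<le> snd z" using z(2) by auto
  then show ?thesis using lower[of "fst z" "snd z" X Y] z(1) assms by simp
qed

text \<open>Otherwise, by monotonicity of \<open>U\<close>, a whole segment of the row that ends at the singular point has time \<open>T\<close>. On it
  \<open>t\<^sub>X = 0\<close>, hence \<open>\<alpha> = - \<pi>\<close>, and \<open>\<alpha>\<^sub>X\<close> and \<open>\<alpha>\<^sub>X\<^sub>X\<close> vanish at the singular point, which is excluded for generic data.\<close>

lemma left_segment:
  assumes a: "a (X0, Y0) = - pi" and X: "X < X0" "X + Y0 \<ge> 0"
  shows "(X, Y0) \<in> U"
proof (rule ccontr)
  assume notU: "(X, Y0) \<notin> U"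
  have "eventually (\<lambda>z. z \<in> G \<and> a z < 0) (nhds (X0, Y0))"
    using eventually_nhds_in_open[OF open_G Z0_G] eventually_less_nhds[OF open_G cont_a Z0_G, of 0] a
    by (auto intro: eventually_conj)
  then obtain r where r: "r > 0" "\<And>z. z \<in> box_at (X0, Y0) r \<Longrightarrow> z \<in> G \<and> a z < 0"
    by (rule eventually_box) blast
  define \<epsilon> where "\<epsilon> = min r (X0 - X)"
  have \<epsilon>: "\<epsilon> > 0" "\<epsilon> \<le> r" "\<epsilon> \<le> X0 - X" using r X by (auto simp: \<epsilon>_def)
  have bd: "(s, Y0) \<in> G" "a (s, Y0) < 0" "(s, Y0) \<in> closure U" "t (s, Y0) = T" if s: "X0 - \<epsilon> < s" "s < X0" for s
  proof -
    have "(s, Y0) \<in> box_at (X0, Y0) r" using s \<epsilon> by (simp add: mem_box_at)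
    then show 1: "(s, Y0) \<in> G" "a (s, Y0) < 0" using r by auto
    have "(s, Y0) \<notin> U" using lower[of s Y0 X Y0] notU s \<epsilon> X by auto
    moreover show 2: "(s, Y0) \<in> closure U"
      by (rule closure_below[of "s + Y0"]) (use s \<epsilon> X in \<open>auto intro!: quadrant\<close>)
    ultimately show "t (s, Y0) = T" using boundary_time 1 by blast
  qed
  have a_eq: "a (s, Y0) = - pi" if s: "X0 - \<epsilon> < s" "s < X0" for s
  proof -
    have "pd1 t (s, Y0) = 0"
    proof (rule deriv_zero_left)
      show "((\<lambda>s. t (s, Y0)) has_real_derivative pd1 t (s, Y0)) (at s)"
        by (rule Ck_on_partials(1)[OF open_G C2_t bd(1)[OF s]])
      show "s - (X0 - \<epsilon>) > 0" using s by simp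
    qed (use s bd(4) in auto)
    then have "w (s, Y0) * p (s, Y0) * cos (a (s, Y0) / 2) = 0"
      using closure_system(1) bd[OF s] by simp
    moreover have "p (s, Y0) > 0"
      by (rule p_pos_column) (use s bd[OF s] \<epsilon> X in \<open>auto intro!: quadrant\<close>)
    ultimately have "cos (a (s, Y0) / 2) = 0" using w_pos[OF bd(1)[OF s]] by simp
    moreover have "cos (a (s, Y0) / 2) > 0" if "a (s, Y0) > - pi"
      by (rule cos_gt_zero_pi) (use that bd(2)[OF s] pi_gt_zero in linarith)+
    ultimately show ?thesis using closure_system(5)[OF bd(1)[OF s] bd(3)[OF s]] by fastforce
  qed
  have a1: "pd1 a (s, Y0) = 0" if s: "X0 - \<epsilon> < s" "s \<le> X0" for s
  proof (rule deriv_zero_left)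
    have "(s, Y0) \<in> G" using bd(1)[of s] s Z0_G by (cases "s = X0") auto
    then show "((\<lambda>s. a (s, Y0)) has_real_derivative pd1 a (s, Y0)) (at s)"
      by (rule Ck_on_partials(1)[OF open_G C2_a])
    show "s - (X0 - \<epsilon>) > 0" using s by simp
    show "a (x, Y0) = a (s, Y0)" if "s - (s - (X0 - \<epsilon>)) < x" "x < s" for x
      using a_eq[of x] a_eq[of s] a that s by (cases "s = X0") auto
  qed
  have "pd1 (pd1 a) (X0, Y0) = 0"
  proof (rule deriv_zero_left)
    show "((\<lambda>s. pd1 a (s, Y0)) has_real_derivative pd1 (pd1 a) (X0, Y0)) (at X0)"
      by (rule Ck_on_partials(1)[OF open_G C1_a1 Z0_G])
    show "pd1 a (x, Y0) = pd1 a (X0, Y0)" if "X0 - \<epsilon> < x" "x < X0" for x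
      using a1[of x] a1[of X0] that \<epsilon> by simp
  qed (rule \<epsilon>)
  then show False using gen_a a a1[of X0] \<epsilon> by simp
qed

lemma q_pos: "a (X0, Y0) = - pi \<Longrightarrow> q (X0, Y0) > 0"
  by (rule q_pos_row[OF Z0_G]) (use sum_pos left_segment in auto)

text \<open>If \<open>\<beta> = - \<pi>\<close> too, this is the mirror image of the previous lemma. Otherwise \<open>t\<^sub>Y > 0\<close> at the singular point, so that
  time cannot be constantly \<open>T\<close> just below it.\<close>

lemma lower_segment:
  assumes a: "a (X0, Y0) = - pi" and Y: "Y < Y0" "X0 + Y \<ge> 0"
  shows "(X0, Y) \<in> U"
proof (cases "b (X0, Y0) = - pi")
  case True
  then show ?thesis using char_plane.left_segment[OF mirror, of Y] Y by (simp add: add.commute)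
next
  case False
  show ?thesis
  proof (rule ccontr)
    assume notU: "(X0, Y) \<notin> U"
    obtain r where r: "r > 0" "box_at (X0, Y0) r \<subseteq> G"
      by (rule open_contains_box[OF open_G Z0_G])
    define \<epsilon> where "\<epsilon> = min r (Y0 - Y)"
    have \<epsilon>: "\<epsilon> > 0" "\<epsilon> \<le> r" "\<epsilon> \<le> Y0 - Y" using r Y by (auto simp: \<epsilon>_def)
    have T: "t (X0, s) = T" if s: "Y0 - \<epsilon> < s" "s < Y0" for s
    proof -
      have "(X0, s) \<in> box_at (X0, Y0) r" using s \<epsilon> by (simp add: mem_box_at)
      then have 1: "(X0, s) \<in> G" using r by auto
      have "(X0, s) \<notin> U" using lower[of X0 s X0 Y] notU s \<epsilon> Y by auto
      moreover have "(X0, s) \<in> closure U"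
        by (rule closure_left[of "X0 + s"]) (use s \<epsilon> Y in \<open>auto intro!: quadrant\<close>)
      ultimately show "t (X0, s) = T" using boundary_time 1 by blast
    qed
    have "pd2 t (X0, Y0) = 0"
    proof (rule deriv_zero_left)
      show "((\<lambda>s. t (X0, s)) has_real_derivative pd2 t (X0, Y0)) (at Y0)"
        by (rule Ck_on_partials(2)[OF open_G C2_t Z0_G])
    qed (use \<epsilon> T t_Z0 in auto)
    then have "cos (b (X0, Y0) / 2) = 0"
      using closure_system(2)[OF Z0_G Z0_closure] q_pos[OF a] w_pos[OF Z0_G] by simp
    moreover have "cos (b (X0, Y0) / 2) > 0"
      by (rule cos_gt_zero_pi) (use closure_system(7)[OF Z0_G Z0_closure] False b_Z0 in linarith)+
    ultimately show False by simp
  qed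
qed

lemma p_pos: "a (X0, Y0) = - pi \<Longrightarrow> p (X0, Y0) > 0"
  by (rule p_pos_column[OF Z0_G]) (use sum_pos lower_segment in auto)

lemma a1_nonpos:
  assumes a: "a (X0, Y0) = - pi"
  shows "pd1 a (X0, Y0) \<le> 0"
proof (rule ccontr)
  assume "\<not> pd1 a (X0, Y0) \<le> 0"
  then obtain d where d: "d > 0" "\<And>h. 0 < h \<Longrightarrow> h < d \<Longrightarrow> a (X0 - h, Y0) < a (X0, Y0)"
    using DERIV_pos_inc_left[OF Ck_on_partials(1)[OF open_G C2_a Z0_G]] by force
  define h where "h = min d (X0 + Y0) / 2"
  have h: "0 < h" "h < d" "h < X0 + Y0" using d sum_pos by (auto simp: h_def)
  then have "(X0 - h, Y0) \<in> U" by (intro left_segment a) auto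
  then show False using a_U d(2)[OF h(1,2)] a by fastforce
qed

text \<open>The equation for \<open>t\<^sub>X\<close> is known on \<open>U\<close> only. It can be differentiated at the singular point along the row, and in the next
  lemma along the column, because both segments that end there lie in \<open>U\<close>.\<close>

lemma t11:
  assumes a: "a (X0, Y0) = - pi"
  shows "pd1 (pd1 t) (X0, Y0) = w (X0, Y0) * p (X0, Y0) * pd1 a (X0, Y0) / 2"
proof -
  let ?d = "\<lambda>s. pd1 t (s, Y0) - w (s, Y0) * p (s, Y0) * cos (a (s, Y0) / 2)"
  note D = Ck_on_partials(1)[OF open_G _ Z0_G]
  have "(?d has_real_derivative pd1 (pd1 t) (X0, Y0) - w (X0, Y0) * p (X0, Y0) * pd1 a (X0, Y0) / 2) (at X0)"
    using a by (auto intro!: derivative_eq_intros D[OF C1_t1] D[OF C1_w] D[OF C1_p] D[OF C2_a] simp: cos_minus)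
  then have "pd1 (pd1 t) (X0, Y0) - w (X0, Y0) * p (X0, Y0) * pd1 a (X0, Y0) / 2 = 0"
  proof (rule deriv_zero_left[OF _ sum_pos])
    fix x assume x: "X0 - (X0 + Y0) < x" "x < X0"
    then have "(x, Y0) \<in> U" by (intro left_segment a) auto
    then show "?d x = ?d X0" using t1 closure_system(1)[OF Z0_G Z0_closure] by simp
  qed
  then show ?thesis by simp
qed

lemma t12:
  assumes a: "a (X0, Y0) = - pi"
  shows "pd2 (pd1 t) (X0, Y0) = w (X0, Y0) * p (X0, Y0) * pd2 a (X0, Y0) / 2"
proof -
  let ?d = "\<lambda>s. pd1 t (X0, s) - w (X0, s) * p (X0, s) * cos (a (X0, s) / 2)"
  note D = Ck_on_partials(2)[OF open_G _ Z0_G]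
  have "(?d has_real_derivative pd2 (pd1 t) (X0, Y0) - w (X0, Y0) * p (X0, Y0) * pd2 a (X0, Y0) / 2) (at Y0)"
    using a by (auto intro!: derivative_eq_intros D[OF C1_t1] D[OF C1_w] D[OF C1_p] D[OF C2_a] simp: cos_minus)
  then have "pd2 (pd1 t) (X0, Y0) - w (X0, Y0) * p (X0, Y0) * pd2 a (X0, Y0) / 2 = 0"
  proof (rule deriv_zero_left[OF _ sum_pos])
    fix x assume x: "Y0 - (X0 + Y0) < x" "x < Y0"
    then have "(X0, x) \<in> U" by (intro lower_segment a) auto
    then show "?d x = ?d Y0" using t1 closure_system(1)[OF Z0_G Z0_closure] by simp
  qed
  then show ?thesis by simp
qed

text \<open>\<open>U\<close> is open and relatively closed where time is less than \<open>T\<close>, off the line \<open>X + Y = 0\<close>.\<close>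

lemma connected_in_U:
  assumes "connected C" "C \<subseteq> G" "\<And>z. z \<in> C \<Longrightarrow> t z < T" "\<And>z. z \<in> C \<Longrightarrow> fst z + snd z > 0"
    and "C \<inter> U \<noteq> {}"
  shows "C \<subseteq> U"
proof -
  have 1: "C \<inter> U = C \<inter> (U \<inter> {z. fst z + snd z > 0})" using assms(4) by auto
  have 2: "C \<inter> U = C \<inter> closure U" using closed_U assms(2,3) closure_subset by blast
  have "openin (top_of_set C) (C \<inter> U)" unfolding 1 by (rule openin_open_Int[OF open_U])
  moreover have "closedin (top_of_set C) (C \<inter> U)" unfolding 2 by (rule closedin_closed_Int) simp
  ultimately show ?thesis using assms(1,5) unfolding connected_clopen by blast
qed

text \<open>If time is less than \<open>T\<close> in the quadrant to the right of and below the singular point, this quadrant is connected through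
  the column below the point to \<open>U\<close>, and so belongs to it locally. But \<open>\<alpha>\<^sub>X < 0\<close> makes \<open>\<alpha> < - \<pi>\<close> just to the right of the point.\<close>

lemma no_right_escape:
  assumes a: "a (X0, Y0) = - pi" "pd1 a (X0, Y0) < 0"
    and ev: "eventually (\<lambda>z. fst z \<ge> X0 \<longrightarrow> snd z \<le> Y0 \<longrightarrow> z \<noteq> (X0, Y0) \<longrightarrow> t z < T) (nhds (X0, Y0))"
  shows False
proof -
  have "eventually (\<lambda>z. fst z + snd z > 0) (nhds (X0, Y0))"
    using eventually_greater_nhds[of UNIV "\<lambda>z. fst z + snd z" "(X0, Y0)" 0] sum_pos
    by (simp add: continuous_on_add continuous_on_fst continuous_on_snd)
  then have "eventually (\<lambda>z. z \<in> G \<and> fst z + snd z > 0 \<and>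
      (fst z \<ge> X0 \<longrightarrow> snd z \<le> Y0 \<longrightarrow> z \<noteq> (X0, Y0) \<longrightarrow> t z < T)) (nhds (X0, Y0))"
    using ev eventually_nhds_in_open[OF open_G Z0_G] by (intro eventually_conj)
  then obtain r where r: "r > 0" "\<And>z. z \<in> box_at (X0, Y0) r \<Longrightarrow> z \<in> G \<and> fst z + snd z > 0 \<and>
      (fst z \<ge> X0 \<longrightarrow> snd z \<le> Y0 \<longrightarrow> z \<noteq> (X0, Y0) \<longrightarrow> t z < T)"
    by (rule eventually_box) blast
  obtain d where d: "d > 0" "\<And>h. 0 < h \<Longrightarrow> h < d \<Longrightarrow> a (X0, Y0) > a (X0 + h, Y0)"
    using DERIV_neg_dec_right[OF Ck_on_partials(1)[OF open_G C2_a Z0_G] a(2)] by blast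
  define h where "h = min d r / 2"
  have h: "0 < h" "h < d" "h < r" using d r by (auto simp: h_def)
  have "(X0 + h, s) \<in> U" if s: "Y0 - r < s" "s < Y0" for s
  proof -
    have box: "z \<in> box_at (X0, Y0) r \<and> fst z \<ge> X0 \<and> snd z \<le> Y0 \<and> z \<noteq> (X0, Y0)"
      if "z \<in> {X0..X0 + h} \<times> {s}" for z
      using that s h by (auto simp: mem_box_at)
    have X0s: "(X0, s) \<in> {X0..X0 + h} \<times> {s}" using h by auto
    have "{X0..X0 + h} \<times> {s} \<subseteq> U"
    proof (rule connected_in_U)
      show "connected ({X0..X0 + h} \<times> {s})" by (intro connected_Times) auto
      have "(X0, s) \<in> U"
        using box[OF X0s] r(2)[of "(X0, s)"] s by (intro lower_segment a) auto
      then show "{X0..X0 + h} \<times> {s} \<inter> U \<noteq> {}" using X0s by blast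
    qed (use box r(2) in blast)+
    then show ?thesis using h by auto
  qed
  then have "(X0 + h, Y0) \<in> closure U" using r(1) by (intro closure_below[of r]) auto
  moreover have "(X0 + h, Y0) \<in> box_at (X0, Y0) r" using h by (simp add: mem_box_at)
  ultimately have "(X0 + h, Y0) \<in> U" using r(2)[of "(X0 + h, Y0)"] h by (auto intro: closed_U)
  then show False using a_U[of "(X0 + h, Y0)"] d(2)[OF h(1,2)] a(1) by simp
qed

end

section \<open>Every singular point is of Type-1\<close>

context char_plane
begin

text \<open>If \<open>\<alpha>\<^sub>X < 0\<close>, then \<open>t\<close> is strictly concave in \<open>X\<close> near the singular point, with \<open>t\<^sub>X = 0\<close> there. When \<open>\<beta> \<noteq> - \<pi>\<close>, moving down decreases \<open>t\<close>
  at a linear rate, which dominates the growth of \<open>t\<^sub>X\<close>. When \<open>\<beta> = - \<pi>\<close>, the point is a candidate for Type-3: then \<open>t\<close> is strictly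
  concave in \<open>Y\<close> too, and \<open>t\<^sub>X\<^sub>Y = 0\<close> because \<open>\<alpha>\<^sub>Y\<close> has the factor \<open>sin ((\<alpha> - \<beta>) / 2)\<close>, so the point is a strict maximum of
  \<open>t\<close>. In both cases the quadrant below and to the right has time less than \<open>T\<close>.\<close>

lemma a1_zero:
  assumes a: "a (X0, Y0) = - pi"
  shows "pd1 a (X0, Y0) = 0"
proof (rule ccontr)
  assume "pd1 a (X0, Y0) \<noteq> 0"
  then have neg: "pd1 a (X0, Y0) < 0" using a1_nonpos[OF a] by simp
  note pos = w_pos[OF Z0_G] p_pos[OF a] q_pos[OF a]
  have t1_0: "pd1 t (X0, Y0) = 0"
    using closure_system(1)[OF Z0_G Z0_closure] a by (simp add: cos_minus)
  define A where "A = - pd1 (pd1 t) (X0, Y0) / 2"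
  have "w (X0, Y0) * p (X0, Y0) * pd1 a (X0, Y0) < 0"
    using pos neg by (intro mult_pos_neg mult_pos_pos)
  then have A: "A > 0" using t11[OF a] by (simp add: A_def)
  have evA: "eventually (\<lambda>z. pd1 (pd1 t) z < - A) (nhds (X0, Y0))"
    by (rule eventually_less_nhds[OF open_G _ Z0_G])
      (use Ck_on_openD(2)[OF open_G C1_t1] A in \<open>auto simp: A_def\<close>)
  have right: "t (X, Y) \<le> t (X0, Y) + pd1 t (X0, Y) * (X - X0) - A / 2 * (X - X0)\<^sup>2"
    if box: "\<And>z. z \<in> box_at (X0, Y0) r \<Longrightarrow> z \<in> G \<and> pd1 (pd1 t) z < - A"
      and X: "(X, Y) \<in> box_at (X0, Y0) r" "X \<ge> X0" for X Y r
  proof (rule second_order_upper[where g'' = "\<lambda>s. pd1 (pd1 t) (s, Y)"])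
    fix s assume "X0 \<le> s" "s \<le> X"
    then have "(s, Y) \<in> box_at (X0, Y0) r" using X by (auto simp: mem_box_at)
    from box[OF this] show "((\<lambda>s. t (s, Y)) has_real_derivative pd1 t (s, Y)) (at s)"
      "((\<lambda>s. pd1 t (s, Y)) has_real_derivative pd1 (pd1 t) (s, Y)) (at s)"
      "pd1 (pd1 t) (s, Y) \<le> - A"
      using Ck_on_partials(1)[OF open_G C2_t] Ck_on_partials(1)[OF open_G C1_t1] by auto
  qed (rule X)
  show False
  proof (cases "b (X0, Y0) = - pi")
    case False
    have "cos (b (X0, Y0) / 2) > 0"
      by (rule cos_gt_zero_pi) (use closure_system(7)[OF Z0_G Z0_closure] False b_Z0 in linarith)+
    then have "pd2 t (X0, Y0) > 0"
      using closure_system(2)[OF Z0_G Z0_closure] pos by simp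
    define \<kappa> where "\<kappa> = pd2 t (X0, Y0) / 2"
    have \<kappa>: "\<kappa> > 0" using \<open>pd2 t (X0, Y0) > 0\<close> by (simp add: \<kappa>_def)
    have "eventually (\<lambda>z. \<kappa> < pd2 t z) (nhds (X0, Y0))"
      by (rule eventually_greater_nhds[OF open_G Ck_on_continuous[OF C1_t2] Z0_G])
        (use \<kappa> in \<open>auto simp: \<kappa>_def\<close>)
    then have "eventually (\<lambda>z. z \<in> G \<and> pd1 (pd1 t) z < - A \<and> \<kappa> < pd2 t z) (nhds (X0, Y0))"
      using evA eventually_nhds_in_open[OF open_G Z0_G] by (intro eventually_conj)
    then obtain r where r: "r > 0" "\<And>z. z \<in> box_at (X0, Y0) r \<Longrightarrow>
        z \<in> G \<and> pd1 (pd1 t) z < - A \<and> \<kappa> < pd2 t z"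
      by (rule eventually_box) blast
    have rG: "box_at (X0, Y0) r \<subseteq> G" using r by auto
    obtain K where K: "K \<ge> 0" "\<And>x y x' y'. (x, y) \<in> box_at (X0, Y0) r \<Longrightarrow> (x', y') \<in> box_at (X0, Y0) r \<Longrightarrow>
        \<bar>pd1 t (x', y') - pd1 t (x, y)\<bar> \<le> K * (\<bar>x' - x\<bar> + \<bar>y' - y\<bar>)"
      by (rule C1_lipschitz_box[OF open_G C1_t1 rG]) blast
    \<comment> \<open>The radius is such that the linear decrease with slope \<open>\<kappa>\<close> downward beats \<open>t\<^sub>X \<le> K (Y0 - Y)\<close> to the right.\<close>
    define r' where "r' = min r (\<kappa> / (K + 1))"
    have r': "r' > 0" "r' \<le> r" "r' \<le> \<kappa> / (K + 1)" using r(1) K(1) \<kappa> by (auto simp: r'_def)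
    have le: "t (X, Y) < T" if X: "X0 \<le> X" "X \<le> X0 + r'" "Y \<le> Y0" "Y0 - r' \<le> Y" "(X, Y) \<noteq> (X0, Y0)" for X Y
    proof -
      have in_box: "(X, Y) \<in> box_at (X0, Y0) r" "(X0, Y) \<in> box_at (X0, Y0) r" "(X0, Y0) \<in> box_at (X0, Y0) r"
        using X r' by (auto simp: mem_box_at)
      have 1: "t (X, Y) \<le> t (X0, Y) + pd1 t (X0, Y) * (X - X0) - A / 2 * (X - X0)\<^sup>2"
        by (rule right[of r]) (use r in_box X in auto)
      have "(\<lambda>s. t (X0, s) - \<kappa> * s) Y \<le> (\<lambda>s. t (X0, s) - \<kappa> * s) Y0"
      proof (rule DERIV_nonneg_imp_nondecreasing[OF X(3)])
        fix s assume "Y \<le> s" "s \<le> Y0"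
        then have "(X0, s) \<in> box_at (X0, Y0) r" using X r' by (auto simp: mem_box_at)
        then have s: "(X0, s) \<in> G" "\<kappa> < pd2 t (X0, s)" using r(2) by auto
        have "((\<lambda>s. t (X0, s) - \<kappa> * s) has_real_derivative pd2 t (X0, s) - \<kappa>) (at s)"
          by (auto intro!: derivative_eq_intros Ck_on_partials(2)[OF open_G C2_t s(1)])
        then show "\<exists>y. ((\<lambda>s. t (X0, s) - \<kappa> * s) has_real_derivative y) (at s) \<and> 0 \<le> y"
          using s(2) by (intro exI[of _ "pd2 t (X0, s) - \<kappa>"]) simp
      qed
      then have 2: "t (X0, Y) \<le> T - \<kappa> * (Y0 - Y)" using t_Z0 by (simp add: algebra_simps)
      have "\<bar>pd1 t (X0, Y) - pd1 t (X0, Y0)\<bar> \<le> K * (\<bar>X0 - X0\<bar> + \<bar>Y - Y0\<bar>)"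
        by (rule K(2)[OF in_box(3,2)])
      then have 3: "pd1 t (X0, Y) \<le> K * (Y0 - Y)" using t1_0 X by simp
      have "pd1 t (X0, Y) * (X - X0) \<le> K * (Y0 - Y) * (X - X0)"
        by (rule mult_right_mono[OF 3]) (use X in simp)
      then have 4: "t (X, Y) \<le> T - (Y0 - Y) * (\<kappa> - K * (X - X0)) - A / 2 * (X - X0)\<^sup>2"
        using 1 2 by (simp add: algebra_simps)
      have "K * (X - X0) \<le> K * (\<kappa> / (K + 1))"
        by (rule mult_left_mono) (use X r' K in auto)
      also have "\<dots> < \<kappa>" using \<kappa> K(1) by (simp add: field_simps)
      finally have 5: "\<kappa> - K * (X - X0) > 0" by simp
      show ?thesis
      proof (cases "Y = Y0")
        case True
        then have "A / 2 * (X - X0)\<^sup>2 > 0" using X A by auto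
        then show ?thesis using 4 True by simp
      next
        case False
        then have "(Y0 - Y) * (\<kappa> - K * (X - X0)) > 0" using X 5 by auto
        moreover have "A / 2 * (X - X0)\<^sup>2 \<ge> 0" using A by simp
        ultimately show ?thesis using 4 by linarith
      qed
    qed
    have "eventually (\<lambda>z. z \<in> ball (X0, Y0) r') (nhds (X0, Y0))"
      using r'(1) by (intro eventually_nhds_in_open) auto
    then have "eventually (\<lambda>z. fst z \<ge> X0 \<longrightarrow> snd z \<le> Y0 \<longrightarrow> z \<noteq> (X0, Y0) \<longrightarrow> t z < T) (nhds (X0, Y0))"
    proof (rule eventually_mono, intro impI)
      fix z assume z: "z \<in> ball (X0, Y0) r'" "fst z \<ge> X0" "snd z \<le> Y0" "z \<noteq> (X0, Y0)"
      have "\<bar>fst z - X0\<bar> \<le> r'" "\<bar>snd z - Y0\<bar> \<le> r'"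
        using z(1) dist_fst_le[of z "(X0, Y0)"] dist_snd_le[of z "(X0, Y0)"]
        by (auto simp: dist_real_def dist_commute)
      then show "t z < T" using le[of "fst z" "snd z"] z by auto
    qed
    then show False by (rule no_right_escape[OF a neg])
  next
    case True
    have b2: "pd2 b (X0, Y0) < 0"
      using char_plane.a1_nonpos[OF mirror] True gen_ab2 a by (simp add: pd_swap less_le)
    have t22: "pd2 (pd2 t) (X0, Y0) = w (X0, Y0) * q (X0, Y0) * pd2 b (X0, Y0) / 2"
      using char_plane.t11[OF mirror] True by (simp add: pd_swap)
    have t2_0: "pd2 t (X0, Y0) = 0"
      using closure_system(2)[OF Z0_G Z0_closure] True by (simp add: cos_minus)
    have t12_0: "pd2 (pd1 t) (X0, Y0) = 0" using t12[OF a] ab_eq a True by simp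
    define B where "B = - pd2 (pd2 t) (X0, Y0) / 2"
    have "w (X0, Y0) * q (X0, Y0) * pd2 b (X0, Y0) < 0"
      using pos b2 by (intro mult_pos_neg mult_pos_pos)
    then have B: "B > 0" using t22 by (simp add: B_def)
    \<comment> \<open>Small enough for the mixed term to be absorbed into the two squares.\<close>
    define \<epsilon> where "\<epsilon> = min A B / 2"
    have \<epsilon>: "\<epsilon> > 0" "\<epsilon> \<le> A / 2" "\<epsilon> \<le> B / 2" using A B by (auto simp: \<epsilon>_def)
    have "eventually (\<lambda>z. pd2 (pd2 t) z < - B) (nhds (X0, Y0))"
      by (rule eventually_less_nhds[OF open_G _ Z0_G])
        (use Ck_on_openD(3)[OF open_G C1_t2] B in \<open>auto simp: B_def\<close>)
    moreover have "eventually (\<lambda>z. \<bar>pd2 (pd1 t) z\<bar> < \<epsilon>) (nhds (X0, Y0))"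
      by (rule eventually_less_nhds[OF open_G _ Z0_G])
        (use Ck_on_openD(3)[OF open_G C1_t1] \<epsilon> t12_0 in \<open>auto intro: continuous_on_rabs\<close>)
    ultimately have "eventually (\<lambda>z. z \<in> G \<and> pd1 (pd1 t) z < - A \<and> pd2 (pd2 t) z < - B \<and> \<bar>pd2 (pd1 t) z\<bar> < \<epsilon>) (nhds (X0, Y0))"
      using evA eventually_nhds_in_open[OF open_G Z0_G] by (intro eventually_conj)
    then obtain r where r: "r > 0" "\<And>z. z \<in> box_at (X0, Y0) r \<Longrightarrow>
        z \<in> G \<and> pd1 (pd1 t) z < - A \<and> pd2 (pd2 t) z < - B \<and> \<bar>pd2 (pd1 t) z\<bar> < \<epsilon>"
      by (rule eventually_box) blast
    have le: "t (X, Y) < T" if X: "X0 \<le> X" "X \<le> X0 + r" "Y \<le> Y0" "Y0 - r \<le> Y" "(X, Y) \<noteq> (X0, Y0)" for X Y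
    proof -
      have in_box: "(X, Y) \<in> box_at (X0, Y0) r" "(X0, Y) \<in> box_at (X0, Y0) r" "(X0, Y0) \<in> box_at (X0, Y0) r"
        using X r by (auto simp: mem_box_at)
      have col: "(X0, s) \<in> box_at (X0, Y0) r" if "Y \<le> s" "s \<le> Y0" for s
        using X that by (auto simp: mem_box_at)
      have 1: "t (X, Y) \<le> t (X0, Y) + pd1 t (X0, Y) * (X - X0) - A / 2 * (X - X0)\<^sup>2"
        by (rule right[of r]) (use r in_box X in auto)
      have "(\<lambda>s. t (X0, Y0 - s)) (Y0 - Y) \<le> (\<lambda>s. t (X0, Y0 - s)) 0 + (\<lambda>s. - pd2 t (X0, Y0 - s)) 0 * ((Y0 - Y) - 0) - B / 2 * ((Y0 - Y) - 0)\<^sup>2"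
      proof (rule second_order_upper[where g'' = "\<lambda>s. pd2 (pd2 t) (X0, Y0 - s)"])
        fix s assume s: "0 \<le> s" "s \<le> Y0 - Y"
        then have rs: "(X0, Y0 - s) \<in> G" "pd2 (pd2 t) (X0, Y0 - s) < - B" using r(2)[OF col[of "Y0 - s"]] by auto
        have d: "((\<lambda>s. Y0 - s) has_real_derivative - 1) (at s)" by (auto intro!: derivative_eq_intros)
        show "((\<lambda>s. t (X0, Y0 - s)) has_real_derivative - pd2 t (X0, Y0 - s)) (at s)"
          using DERIV_chain2[OF Ck_on_partials(2)[OF open_G C2_t rs(1)] d] by simp
        show "((\<lambda>s. - pd2 t (X0, Y0 - s)) has_real_derivative pd2 (pd2 t) (X0, Y0 - s)) (at s)"
          using DERIV_minus[OF DERIV_chain2[OF Ck_on_partials(2)[OF open_G C1_t2 rs(1)] d]] by simp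
        show "pd2 (pd2 t) (X0, Y0 - s) \<le> - B" using rs by simp
      qed (use X in simp)
      then have 2: "t (X0, Y) \<le> T - B / 2 * (Y0 - Y)\<^sup>2" using t_Z0 t2_0 by simp
      have "\<bar>pd1 t (X0, Y) - pd1 t (X0, Y0) - 0 / real (Suc 0) * (Y - Y0) ^ Suc 0\<bar> \<le> \<epsilon> * \<bar>Y - Y0\<bar>"
      proof (rule mvt_monomial[where g = "\<lambda>s. pd1 t (X0, s)" and g' = "\<lambda>s. pd2 (pd1 t) (X0, s)"])
        fix s assume "s \<in> closed_segment Y0 Y"
        then have "Y \<le> s" "s \<le> Y0" using X by (auto simp: closed_segment_eq_real_ivl split: if_splits)
        from r(2)[OF col[OF this]] show "((\<lambda>s. pd1 t (X0, s)) has_real_derivative pd2 (pd1 t) (X0, s)) (at s)"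
          "\<bar>pd2 (pd1 t) (X0, s) - 0 * (s - Y0) ^ 0\<bar> \<le> \<epsilon>"
          using Ck_on_partials(2)[OF open_G C1_t1] by auto
      qed
      then have 3: "pd1 t (X0, Y) \<le> \<epsilon> * (Y0 - Y)" using t1_0 X by simp
      have "pd1 t (X0, Y) * (X - X0) \<le> \<epsilon> * (Y0 - Y) * (X - X0)"
        by (rule mult_right_mono[OF 3]) (use X in simp)
      moreover have "(Y0 - Y) * (X - X0) \<le> ((Y0 - Y)\<^sup>2 + (X - X0)\<^sup>2) / 2"
      proof -
        have half: "2 * x \<le> y \<Longrightarrow> x \<le> y / 2" for x y :: real by simp
        show ?thesis by (rule half) (use sum_squares_bound[of "Y0 - Y" "X - X0"] in \<open>simp only: mult.assoc\<close>)
      qed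
      from mult_left_mono[OF this less_imp_le[OF \<epsilon>(1)]]
      have "\<epsilon> * (Y0 - Y) * (X - X0) \<le> \<epsilon> / 2 * (Y0 - Y)\<^sup>2 + \<epsilon> / 2 * (X - X0)\<^sup>2"
        by (simp only: mult.assoc distrib_left add_divide_distrib times_divide_eq_left times_divide_eq_right)
      moreover have "\<epsilon> / 2 * (Y0 - Y)\<^sup>2 \<le> B / 4 * (Y0 - Y)\<^sup>2"
        by (rule mult_right_mono) (use \<epsilon> in auto)
      moreover have "\<epsilon> / 2 * (X - X0)\<^sup>2 \<le> A / 4 * (X - X0)\<^sup>2"
        by (rule mult_right_mono) (use \<epsilon> in auto)
      moreover have "B / 4 * (Y0 - Y)\<^sup>2 + A / 4 * (X - X0)\<^sup>2 > 0"
      proof (cases "X = X0")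
        case True
        then have "(Y0 - Y)\<^sup>2 > 0" using X by auto
        then show ?thesis using True B by simp
      next
        case False
        then have "A / 4 * (X - X0)\<^sup>2 > 0" using A by simp
        moreover have "B / 4 * (Y0 - Y)\<^sup>2 \<ge> 0" using B by simp
        ultimately show ?thesis by linarith
      qed
      ultimately show ?thesis using 1 2 by linarith
    qed
    have "eventually (\<lambda>z. z \<in> ball (X0, Y0) r) (nhds (X0, Y0))"
      using r(1) by (intro eventually_nhds_in_open) auto
    then have "eventually (\<lambda>z. fst z \<ge> X0 \<longrightarrow> snd z \<le> Y0 \<longrightarrow> z \<noteq> (X0, Y0) \<longrightarrow> t z < T) (nhds (X0, Y0))"
    proof (rule eventually_mono, intro impI)
      fix z assume z: "z \<in> ball (X0, Y0) r" "fst z \<ge> X0" "snd z \<le> Y0" "z \<noteq> (X0, Y0)"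
      have "\<bar>fst z - X0\<bar> \<le> r" "\<bar>snd z - Y0\<bar> \<le> r"
        using z(1) dist_fst_le[of z "(X0, Y0)"] dist_snd_le[of z "(X0, Y0)"]
        by (auto simp: dist_real_def dist_commute)
      then show "t z < T" using le[of "fst z" "snd z"] z by auto
    qed
    then show False by (rule no_right_escape[OF a neg])
  qed
qed

text \<open>Once \<open>\<alpha>\<^sub>X = 0\<close>, genericity excludes \<open>\<beta> = - \<pi>\<close> and \<open>\<alpha>\<^sub>X\<^sub>X = 0\<close>. The sign of \<open>\<alpha>\<^sub>X\<^sub>X\<close> comes from the row to the left of the singular point,
  where \<open>\<alpha> > - \<pi>\<close>.\<close>

lemma singular_type1:
  assumes a: "a (X0, Y0) = - pi"
  shows "pd1 a (X0, Y0) = 0" "b (X0, Y0) \<noteq> - pi" "pd1 (pd1 a) (X0, Y0) > 0"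
proof -
  show a1: "pd1 a (X0, Y0) = 0" by (rule a1_zero[OF a])
  show "b (X0, Y0) \<noteq> - pi" using gen_ab1 a a1 by blast
  have "\<not> pd1 (pd1 a) (X0, Y0) < 0"
  proof
    assume "pd1 (pd1 a) (X0, Y0) < 0"
    then obtain d where d: "d > 0" "\<And>h. 0 < h \<Longrightarrow> h < d \<Longrightarrow> pd1 a (X0, Y0) < pd1 a (X0 - h, Y0)"
      using DERIV_neg_dec_left[OF Ck_on_partials(1)[OF open_G C1_a1 Z0_G]] by blast
    define h where "h = min d (X0 + Y0) / 2"
    have h: "0 < h" "h < d" "h < X0 + Y0" using d sum_pos by (auto simp: h_def)
    have in_U: "(s, Y0) \<in> U" if "X0 - h \<le> s" "s < X0" for s
      using that h by (intro left_segment a) auto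
    have in_G: "(s, Y0) \<in> G" if "X0 - h \<le> s" "s \<le> X0" for s
      using that in_U[of s] U_sub Z0_G by (cases "s = X0") auto
    have "a (X0 - h, Y0) < a (X0, Y0)"
    proof (rule DERIV_pos_imp_increasing_open[where f = "\<lambda>s. a (s, Y0)"])
      fix s assume s: "X0 - h < s" "s < X0"
      then show "\<exists>y. ((\<lambda>s. a (s, Y0)) has_real_derivative y) (at s) \<and> 0 < y"
        using Ck_on_partials(1)[OF open_G C2_a in_G[of s]] d(2)[of "X0 - s"] h a1
        by (intro exI[of _ "pd1 a (s, Y0)"]) auto
    next
      show "continuous_on {X0 - h..X0} (\<lambda>s. a (s, Y0))"
        by (rule continuous_on_compose2[OF cont_a]) (use in_G in \<open>auto simp: continuous_on_Pair\<close>)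
    qed (use h in simp)
    then show False using a a_U[OF in_U[of "X0 - h"]] h by simp
  qed
  then show "pd1 (pd1 a) (X0, Y0) > 0" using gen_a a a1 by linarith
qed

lemma closure_lower:
  assumes "(X, Y) \<in> closure U" "X' \<le> X" "Y' \<le> Y" "X' + Y' > 0"
  shows "(X', Y') \<in> closure U"
  unfolding closure_approachable
proof (intro allI impI)
  fix e :: real assume e: "e > 0"
  define d where "d = min e ((X' + Y') / 2)"
  have "d > 0" using e assms(4) by (simp add: d_def)
  then obtain z where "z \<in> U" "dist z (X, Y) < d"
    using assms(1) unfolding closure_approachable by blast
  then obtain u v where z: "(u, v) \<in> U" "dist (u, v) (X, Y) < d" by (metis prod.collapse)
  have "\<bar>u - X\<bar> < d" "\<bar>v - Y\<bar> < d"
    using z(2) dist_fst_le[of "(u, v)" "(X, Y)"] dist_snd_le[of "(u, v)" "(X, Y)"]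
    by (auto simp: dist_real_def)
  then have le: "- d < u - X" "- d < v - Y" by (simp_all add: abs_less_iff)
  have "d \<le> (X' + Y') / 2" "d \<le> e" unfolding d_def by (rule min.cobounded2, rule min.cobounded1)
  moreover from this(1) le have "0 \<le> X' + (u - X) + (Y' + (v - Y))" by (simp add: field_simps)
  then have "(X' + (u - X), Y' + (v - Y)) \<in> U"
    using assms(2,3) by (intro lower[OF z(1)]) auto
  moreover have "dist (X' + (u - X), Y' + (v - Y)) (X', Y') = dist (u, v) (X, Y)"
    by (simp add: dist_Pair_Pair dist_real_def)
  ultimately show "\<exists>y\<in>U. dist y (X', Y') < e"
    using z(2) by (intro bexI[of _ "(X' + (u - X), Y' + (v - Y))"]) linarith+
qed

end

section \<open>Inverting the characteristic coordinates near a singular point\<close>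

text \<open>In addition to the time function, the space coordinate \<open>x\<close> and the inverse \<open>Zm\<close> of \<open>(x, t)\<close> on \<open>U\<close>.\<close>

locale char_plane_flow = char_plane +
  fixes x :: "real \<times> real \<Rightarrow> real" and Zm :: "real \<times> real \<Rightarrow> real \<times> real"
  assumes C2_x: "Ck_on (Suc (Suc 0)) G x"
    and x1: "\<And>z. z \<in> U \<Longrightarrow> pd1 x z = 1 / 2 * p z * cos (a z / 2)"
    and x2: "\<And>z. z \<in> U \<Longrightarrow> pd2 x z = - (1 / 2) * q z * cos (b z / 2)"
    and T_pos: "T > 0"
    and cont_Zm: "continuous_on (UNIV \<times> {0..<T}) Zm"
    and Zm_right: "\<And>z. z \<in> UNIV \<times> {0..<T} \<Longrightarrow> Zm z \<in> U \<and> x (Zm z) = fst z \<and> t (Zm z) = snd z"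
    and Zm_left: "\<And>z. z \<in> U \<Longrightarrow> 0 \<le> t z \<and> Zm (x z, t z) = z"
begin

lemmas cont_x = Ck_on_continuous[OF C2_x]

lemma closure_system_x:
  assumes "z \<in> G" "z \<in> closure U"
  shows "pd1 x z = 1 / 2 * p z * cos (a z / 2)" "pd2 x z = - (1 / 2) * q z * cos (b z / 2)"
    and "t z \<ge> 0"
proof -
  note cl = continuous_agree_closure[OF _ _ U_sub _ assms]
  note c = Ck_on_openD[OF open_G C2_x]
  show "pd1 x z = 1 / 2 * p z * cos (a z / 2)"
    by (rule cl) (auto intro!: continuous_on_mult continuous_on_cos continuous_on_divide continuous_on_const
       cont_a cont_p Ck_on_continuous[OF c(2)] simp: x1)
  show "pd2 x z = - (1 / 2) * q z * cos (b z / 2)"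
    by (rule cl) (auto intro!: continuous_on_mult continuous_on_minus continuous_on_cos continuous_on_divide continuous_on_const
       cont_b cont_q Ck_on_continuous[OF c(3)] simp: x2)
  show "t z \<ge> 0"
    by (rule continuous_le_closure[OF _ _ U_sub _ assms]) (use Zm_left cont_t in auto)
qed

lemma signs_near_singular_point:
  assumes a: "a (X0, Y0) = - pi"
  obtains r where "r > 0"
    "\<And>z. z \<in> box_at (X0, Y0) r \<Longrightarrow> z \<in> G \<and> fst z + snd z > 0 \<and> a z < 0 \<and> p z > 0 \<and> q z > 0
        \<and> cos (b z / 2) > 0 \<and> pd1 (pd1 a) z > 0"
proof -
  have b: "cos (b (X0, Y0) / 2) > 0"
    by (rule cos_gt_zero_pi)
      (use closure_system(7)[OF Z0_G Z0_closure] singular_type1(2)[OF a] b_Z0 in linarith)+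
  have "continuous_on G (\<lambda>z. cos (b z / 2))"
    using cont_b by (intro continuous_on_cos continuous_on_divide) auto
  then have evb: "eventually (\<lambda>z. cos (b z / 2) > 0) (nhds (X0, Y0))"
    by (rule eventually_greater_nhds[where f = "\<lambda>z. cos (b z / 2)", OF open_G _ Z0_G b])
  have sum: "eventually (\<lambda>z. fst z + snd z > 0) (nhds (X0, Y0))"
    using eventually_greater_nhds[of UNIV "\<lambda>z. fst z + snd z" "(X0, Y0)" 0] sum_pos
    by (simp add: continuous_on_add continuous_on_fst continuous_on_snd)
  have "continuous_on G (pd1 (pd1 a))" using Ck_on_openD(2)[OF open_G C1_a1] by simp
  from eventually_greater_nhds[OF open_G this Z0_G singular_type1(3)[OF a]]
  have "eventually (\<lambda>z. z \<in> G \<and> fst z + snd z > 0 \<and> a z < 0 \<and> p z > 0 \<and> q z > 0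
        \<and> cos (b z / 2) > 0 \<and> pd1 (pd1 a) z > 0) (nhds (X0, Y0))"
    using eventually_nhds_in_open[OF open_G Z0_G] sum evb
      eventually_less_nhds[OF open_G cont_a Z0_G, of 0]
      eventually_greater_nhds[OF open_G cont_p Z0_G p_pos[OF a]]
      eventually_greater_nhds[OF open_G cont_q Z0_G q_pos[OF a]] a
    by (intro eventually_conj) auto
  then show ?thesis by (rule eventually_box) (rule that)
qed

text \<open>On the part \<open>L\<close> of the closure of \<open>U\<close> in a small box, \<open>t\<close> increases in both variables, whereas \<open>x\<close> increases in \<open>X\<close> and decreases
  in \<open>Y\<close>, and \<open>t\<close> does so strictly in \<open>X\<close> since \<open>\<alpha>\<^sub>X\<^sub>X > 0\<close>. Hence \<open>(x, t)\<close> is injective on the compact set \<open>L\<close>, and its inverse is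
  continuous. The image of \<open>L\<close> contains a neighbourhood of the singular point in the strip, by connectedness: the image of
  the outer boundary of \<open>L\<close> stays away from that point, so \<open>Zm\<close> cannot leave the box on a small half ball.\<close>

lemma local_inverse:
  assumes a: "a (X0, Y0) = - pi"
  obtains \<delta> Zt where "\<delta> > 0"
    and "continuous_on (ball (x (X0, Y0), T) \<delta> \<inter> UNIV \<times> {0..T}) Zt"
    and "Zt (x (X0, Y0), T) = (X0, Y0)"
    and "\<And>z. z \<in> ball (x (X0, Y0), T) \<delta> \<inter> UNIV \<times> {0..T} \<Longrightarrow>
        Zt z \<in> G \<and> Zt z \<in> closure U \<and> x (Zt z) = fst z \<and> t (Zt z) = snd z \<and> cos (b (Zt z) / 2) > 0"
    and "\<And>z. z \<in> ball (x (X0, Y0), T) \<delta> \<inter> UNIV \<times> {0..T} \<Longrightarrow> snd z < T \<Longrightarrow> Zt z = Zm z"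
proof -
  obtain r where r: "r > 0" "\<And>z. z \<in> box_at (X0, Y0) r \<Longrightarrow> z \<in> G \<and> fst z + snd z > 0 \<and> a z < 0 \<and> p z > 0 \<and> q z > 0
        \<and> cos (b z / 2) > 0 \<and> pd1 (pd1 a) z > 0"
    by (rule signs_near_singular_point[OF a]) blast
  let ?N = "box_at (X0, Y0) r"
  define L where "L = ?N \<inter> closure U"
  define \<Phi> where "\<Phi> = (\<lambda>z. (x z, t z))"
  have LG: "z \<in> G" "z \<in> closure U" "z \<in> ?N" if "z \<in> L" for z using that r(2) by (auto simp: L_def)
  have compL: "compact L" unfolding L_def by (intro compact_Int_closed compact_box_at) simp
  have Z0L: "(X0, Y0) \<in> L" using r(1) Z0_closure by (simp add: L_def mem_box_at)
  have L_lower: "(X', Y') \<in> L" if "(X, Y) \<in> L" "X' \<le> X" "Y' \<le> Y" "(X', Y') \<in> ?N" for X Y X' Y'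
    using that r(2)[OF that(4)] closure_lower[of X Y X' Y'] by (auto simp: L_def)
  have in_N: "(s, Y) \<in> ?N" if "(X1, Y) \<in> ?N" "(X2, Y) \<in> ?N" "X1 \<le> s" "s \<le> X2" for s X1 X2 Y
    using that by (auto simp: mem_box_at)
  have in_N': "(X, s) \<in> ?N" if "(X, Y1) \<in> ?N" "(X, Y2) \<in> ?N" "Y1 \<le> s" "s \<le> Y2" for s X Y1 Y2
    using that by (auto simp: mem_box_at)
  have corner: "(X1, Y2) \<in> ?N" if "(X1, Y1) \<in> ?N" "(X2, Y2) \<in> ?N" for X1 Y1 X2 Y2
    using that by (auto simp: mem_box_at)
  have cos_a: "cos (a z / 2) \<ge> 0" "cos (a z / 2) = 0 \<Longrightarrow> a z = - pi" if z: "z \<in> L" for z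
  proof -
    have 1: "- pi \<le> a z" "a z < 0"
      using closure_system(5)[OF LG(1,2)[OF z]] r(2)[OF LG(3)[OF z]] by auto
    show "cos (a z / 2) \<ge> 0" by (rule cos_ge_zero) (use 1 in auto)
    have "cos (a z / 2) > 0" if "a z > - pi" by (rule cos_gt_zero_pi) (use that 1 pi_gt_zero in linarith)+
    then show "cos (a z / 2) = 0 \<Longrightarrow> a z = - pi" using 1 by fastforce
  qed
  have t1_ge: "pd1 t z \<ge> 0" and x1_ge: "pd1 x z \<ge> 0" and t2_gt: "pd2 t z > 0" and x2_lt: "pd2 x z < 0"
    if z: "z \<in> L" for z
  proof -
    note eqs = closure_system(1,2)[OF LG(1,2)[OF z]] closure_system_x(1,2)[OF LG(1,2)[OF z]]
    have pos: "p z > 0" "q z > 0" "cos (b z / 2) > 0" "w z > 0"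
      using r(2)[OF LG(3)[OF z]] w_pos[OF LG(1)[OF z]] by auto
    have "p z * cos (a z / 2) \<ge> 0" using pos(1) cos_a(1)[OF z] by simp
    then show "pd1 t z \<ge> 0" "pd1 x z \<ge> 0"
      using mult_nonneg_nonneg[of "w z" "p z * cos (a z / 2)"] pos(4) eqs by (auto simp: mult.assoc)
    have "q z * cos (b z / 2) > 0" using pos by simp
    then show "pd2 t z > 0" "pd2 x z < 0"
      using mult_pos_pos[of "w z" "q z * cos (b z / 2)"] pos(4) eqs by (auto simp: mult.assoc)
  qed
  have col_t: "t (X, Y1) < t (X, Y2)" if "(X, Y2) \<in> L" "(X, Y1) \<in> ?N" "Y1 < Y2" for X Y1 Y2
  proof (rule DERIV_pos_imp_increasing[where f = "\<lambda>s. t (X, s)"])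
    fix s assume "Y1 \<le> s" "s \<le> Y2"
    then have "(X, s) \<in> L" using that in_N'[OF that(2) LG(3)[OF that(1)]] by (intro L_lower[OF that(1)]) auto
    then show "\<exists>y. ((\<lambda>s. t (X, s)) has_real_derivative y) (at s) \<and> 0 < y"
      using Ck_on_partials(2)[OF open_G C2_t LG(1)] t2_gt by blast
  qed (rule that(3))
  have col_x: "x (X, Y2) < x (X, Y1)" if "(X, Y2) \<in> L" "(X, Y1) \<in> ?N" "Y1 < Y2" for X Y1 Y2
  proof (rule DERIV_neg_imp_decreasing[where f = "\<lambda>s. x (X, s)"])
    fix s assume "Y1 \<le> s" "s \<le> Y2"
    then have "(X, s) \<in> L" using that in_N'[OF that(2) LG(3)[OF that(1)]] by (intro L_lower[OF that(1)]) auto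
    then show "\<exists>y. ((\<lambda>s. x (X, s)) has_real_derivative y) (at s) \<and> y < 0"
      using Ck_on_partials(2)[OF open_G C2_x LG(1)] x2_lt by blast
  qed (rule that(3))
  have row_L: "(s, Y) \<in> L" if "(X2, Y) \<in> L" "(X1, Y) \<in> ?N" "X1 \<le> s" "s \<le> X2" for X1 X2 Y s
    using that in_N[OF that(2) LG(3)[OF that(1)]] by (intro L_lower[OF that(1)]) auto
  have row_x: "x (X1, Y) \<le> x (X2, Y)" if "(X2, Y) \<in> L" "(X1, Y) \<in> ?N" "X1 \<le> X2" for X1 X2 Y
  proof (rule DERIV_nonneg_imp_nondecreasing[where f = "\<lambda>s. x (s, Y)"])
    fix s assume "X1 \<le> s" "s \<le> X2"
    then have "(s, Y) \<in> L" using that row_L by blast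
    then show "\<exists>y. ((\<lambda>s. x (s, Y)) has_real_derivative y) (at s) \<and> 0 \<le> y"
      using Ck_on_partials(1)[OF open_G C2_x LG(1)] x1_ge by blast
  qed (rule that(3))
  have row_t: "t (X1, Y) \<le> t (X2, Y)" if "(X2, Y) \<in> L" "(X1, Y) \<in> ?N" "X1 \<le> X2" for X1 X2 Y
  proof (rule DERIV_nonneg_imp_nondecreasing[where f = "\<lambda>s. t (s, Y)"])
    fix s assume "X1 \<le> s" "s \<le> X2"
    then have "(s, Y) \<in> L" using that row_L by blast
    then show "\<exists>y. ((\<lambda>s. t (s, Y)) has_real_derivative y) (at s) \<and> 0 \<le> y"
      using Ck_on_partials(1)[OF open_G C2_t LG(1)] t1_ge by blast
  qed (rule that(3))
  \<comment> \<open>If \<open>t\<close> were constant on a piece of a row, then \<open>\<alpha> = - \<pi>\<close> there and \<open>\<alpha>\<^sub>X\<^sub>X = 0\<close>.\<close>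
  have row_t_strict: "t (X1, Y) < t (X2, Y)" if h: "(X2, Y) \<in> L" "(X1, Y) \<in> ?N" "X1 < X2" for X1 X2 Y
  proof (rule ccontr)
    assume not: "\<not> t (X1, Y) < t (X2, Y)"
    have rowL: "(s, Y) \<in> L" if "X1 \<le> s" "s \<le> X2" for s using row_L[OF h(1,2)] that by blast
    have const: "t (s, Y) = t (X1, Y)" if s: "X1 \<le> s" "s \<le> X2" for s
      using row_t[OF rowL[OF s] h(2) s(1)] row_t[OF h(1) LG(3)[OF rowL[OF s]] s(2)] not by linarith
    have a_eq: "a (s, Y) = - pi" if s: "X1 < s" "s \<le> X2" for s
    proof -
      have sL: "(s, Y) \<in> L" using rowL s by simp
      have "pd1 t (s, Y) = 0"
      proof (rule deriv_zero_left)
        show "((\<lambda>s. t (s, Y)) has_real_derivative pd1 t (s, Y)) (at s)"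
          by (rule Ck_on_partials(1)[OF open_G C2_t LG(1)[OF sL]])
        show "s - X1 > 0" using s by simp
        show "t (y, Y) = t (s, Y)" if "s - (s - X1) < y" "y < s" for y
          using const[of y] const[of s] that s by simp
      qed
      then have "cos (a (s, Y) / 2) = 0"
        using closure_system(1)[OF LG(1,2)[OF sL]] w_pos[OF LG(1)[OF sL]] r(2)[OF LG(3)[OF sL]] by simp
      then show ?thesis by (rule cos_a(2)[OF sL])
    qed
    have a1_eq: "pd1 a (s, Y) = 0" if s: "X1 < s" "s \<le> X2" for s
    proof (rule deriv_zero_left)
      have sL: "(s, Y) \<in> L" using rowL s by simp
      show "((\<lambda>s. a (s, Y)) has_real_derivative pd1 a (s, Y)) (at s)"
        by (rule Ck_on_partials(1)[OF open_G C2_a LG(1)[OF sL]])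
      show "s - X1 > 0" using s by simp
      show "a (y, Y) = a (s, Y)" if "s - (s - X1) < y" "y < s" for y
        using a_eq[of y] a_eq[of s] that s by simp
    qed
    have "pd1 (pd1 a) (X2, Y) = 0"
    proof (rule deriv_zero_left)
      show "((\<lambda>s. pd1 a (s, Y)) has_real_derivative pd1 (pd1 a) (X2, Y)) (at X2)"
        by (rule Ck_on_partials(1)[OF open_G C1_a1 LG(1)[OF h(1)]])
      show "X2 - X1 > 0" using h by simp
      show "pd1 a (y, Y) = pd1 a (X2, Y)" if "X2 - (X2 - X1) < y" "y < X2" for y
        using a1_eq[of y] a1_eq[of X2] that h by simp
    qed
    then show False using r(2)[OF LG(3)[OF h(1)]] by simp
  qed
  have no_eq: False if 1: "(X1, Y1) \<in> L" "(X2, Y2) \<in> L" "\<Phi> (X1, Y1) = \<Phi> (X2, Y2)" and lt: "X1 < X2"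
    for X1 Y1 X2 Y2
  proof -
    have c: "(X2, Y1) \<in> ?N" "(X1, Y2) \<in> ?N" using corner LG(3) 1 by blast+
    have eq: "x (X1, Y1) = x (X2, Y2)" "t (X1, Y1) = t (X2, Y2)" using 1(3) by (auto simp: \<Phi>_def)
    show False
    proof (cases "Y1 \<le> Y2")
      case True
      then have c1: "(X2, Y1) \<in> L" using L_lower[OF 1(2)] c by simp
      have "t (X1, Y1) < t (X2, Y1)" by (rule row_t_strict[OF c1 LG(3)[OF 1(1)] lt])
      moreover have "t (X2, Y1) \<le> t (X2, Y2)"
        using col_t[OF 1(2) c(1)] True by (cases "Y1 = Y2") auto
      ultimately show False using eq by simp
    next
      case False
      have "x (X1, Y1) < x (X1, Y2)" using col_x[OF 1(1) c(2)] False by simp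
      also have "x (X1, Y2) \<le> x (X2, Y2)" by (rule row_x[OF 1(2) c(2)]) (use lt in simp)
      finally show False using eq by simp
    qed
  qed
  have inj: "inj_on \<Phi> L"
  proof (rule inj_onI)
    fix z1 z2 assume z: "z1 \<in> L" "z2 \<in> L" "\<Phi> z1 = \<Phi> z2"
    obtain X1 Y1 X2 Y2 where zz: "z1 = (X1, Y1)" "z2 = (X2, Y2)" by (cases z1, cases z2)
    have X: "X1 = X2"
      using no_eq[OF z(1,2,3)[unfolded zz]] no_eq[OF z(2,1)[unfolded zz] z(3)[unfolded zz, symmetric]]
      by (meson linorder_neqE_linordered_idom)
    have "\<not> Y1 < Y2" "\<not> Y2 < Y1"
      using col_t[of X1 Y2 Y1] col_t[of X1 Y1 Y2] z zz X LG(3) by (auto simp: \<Phi>_def)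
    then show "z1 = z2" using zz X by simp
  qed
  have cont\<Phi>: "continuous_on L \<Phi>"
    unfolding \<Phi>_def using LG(1) cont_x cont_t
    by (intro continuous_on_Pair) (auto intro: continuous_on_subset)
  \<comment> \<open>The part of \<open>L\<close> on the outer boundary of the box.\<close>
  define bd where "bd = L - {X0 - r<..<X0 + r} \<times> {Y0 - r<..<Y0 + r}"
  have bd_sub: "bd \<subseteq> L" by (auto simp: bd_def)
  have "compact bd" unfolding bd_def by (intro compact_diff compL open_Times) auto
  then have "closed (\<Phi> ` bd)"
    by (intro compact_imp_closed compact_continuous_image continuous_on_subset[OF cont\<Phi> bd_sub])
  moreover have "(x (X0, Y0), T) \<notin> \<Phi> ` bd"
  proof
    assume "(x (X0, Y0), T) \<in> \<Phi> ` bd"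
    then obtain z where z: "z \<in> bd" "\<Phi> z = \<Phi> (X0, Y0)" using t_Z0 by (auto simp: \<Phi>_def)
    then have "z = (X0, Y0)" using inj_onD[OF inj] bd_sub Z0L by blast
    then show False using z(1) r(1) by (simp add: bd_def)
  qed
  ultimately have "open (- \<Phi> ` bd)" "(x (X0, Y0), T) \<in> - \<Phi> ` bd" by auto
  then obtain \<delta>1 where \<delta>1: "\<delta>1 > 0" "ball (x (X0, Y0), T) \<delta>1 \<subseteq> - \<Phi> ` bd"
    by (rule openE)
  let ?z0 = "(x (X0, Y0), T)"
  let ?V = "ball ?z0 \<delta>1 \<inter> UNIV \<times> {0..T}"
  let ?W = "ball ?z0 \<delta>1 \<inter> UNIV \<times> {0..<T}"
  have Zm_L: "Zm z \<in> L" "\<Phi> (Zm z) = z" if "z \<in> ?W" "Zm z \<in> ?N" for z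
    using Zm_right[of z] that closure_subset by (auto simp: L_def \<Phi>_def)
  have contW: "continuous_on ?W Zm" by (rule continuous_on_subset[OF cont_Zm]) auto
  have Zm_N: "Zm z \<in> ?N" if "z \<in> ?W" for z
  proof -
    have conn: "connected ?W" by (intro convex_connected convex_Int convex_ball convex_Times) auto
    have closed: "closedin (top_of_set ?W) (?W \<inter> Zm -` ?N)"
      by (rule continuous_closedin_preimage[OF contW compact_imp_closed[OF compact_box_at]])
    have eqN: "?W \<inter> Zm -` ?N = ?W \<inter> Zm -` ({X0 - r<..<X0 + r} \<times> {Y0 - r<..<Y0 + r})"
    proof (intro equalityI subsetI)
      fix z assume z: "z \<in> ?W \<inter> Zm -` ?N"
      then have zW: "z \<in> ?W" "Zm z \<in> ?N" by auto
      have "z \<notin> \<Phi> ` bd" using zW(1) \<delta>1(2) by auto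
      then have "Zm z \<notin> bd" using Zm_L(2)[OF zW] by (metis image_eqI)
      then show "z \<in> ?W \<inter> Zm -` ({X0 - r<..<X0 + r} \<times> {Y0 - r<..<Y0 + r})"
        using zW Zm_L(1)[OF zW] by (simp add: bd_def)
    qed (auto simp: box_at_def)
    have opn: "openin (top_of_set ?W) (?W \<inter> Zm -` ?N)"
      unfolding eqN by (rule continuous_openin_preimage_gen[OF contW]) (intro open_Times open_greaterThanLessThan)
    have ne: "?W \<inter> Zm -` ?N \<noteq> {}"
    proof -
      have "continuous_on G \<Phi>" unfolding \<Phi>_def by (intro continuous_on_Pair cont_x cont_t)
      then have "open (G \<inter> \<Phi> -` ball ?z0 \<delta>1)"
        by (rule continuous_open_preimage) (auto intro: open_G)
      define S where "S = ({X0 - r<..<X0 + r} \<times> {Y0 - r<..<Y0 + r}) \<inter> (G \<inter> \<Phi> -` ball ?z0 \<delta>1)"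
      have opS: "open S" unfolding S_def
        by (rule open_Int[OF open_Times[OF open_greaterThanLessThan open_greaterThanLessThan]])
          (rule \<open>open (G \<inter> \<Phi> -` ball ?z0 \<delta>1)\<close>)
      have "(X0, Y0) \<in> S" using r(1) \<delta>1(1) Z0_G t_Z0 by (simp add: \<Phi>_def S_def)
      then have "S \<inter> closure U \<noteq> {}" using Z0_closure by blast
      then have "S \<inter> U \<noteq> {}" using open_Int_closure_eq_empty[OF opS, of U] by simp
      then obtain z where z: "z \<in> U" "z \<in> S" by blast
      have "\<Phi> z \<in> ball ?z0 \<delta>1" using z(2) by (simp add: S_def)
      moreover have "\<Phi> z \<in> UNIV \<times> {0..<T}"
        using conjunct1[OF Zm_left[OF z(1)]] t_U[OF z(1)] by (simp add: \<Phi>_def)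
      moreover have "Zm (\<Phi> z) = z" using conjunct2[OF Zm_left[OF z(1)]] by (simp add: \<Phi>_def)
      moreover have "z \<in> ?N" using z(2) by (simp add: S_def mem_Times_iff box_at_def)
      ultimately show ?thesis by auto
    qed
    have "?W \<inter> Zm -` ?N = {} \<or> ?W \<inter> Zm -` ?N = ?W"
      by (rule conn[unfolded connected_clopen, THEN spec, THEN mp]) (rule conjI[OF opn closed])
    then have "?W \<inter> Zm -` ?N = ?W" using ne by argo
    then have "z \<in> ?W \<inter> Zm -` ?N" using that by (simp only:)
    then show ?thesis by simp
  qed
  have W_img: "?W \<subseteq> \<Phi> ` L"
  proof
    fix z assume z: "z \<in> ?W"
    show "z \<in> \<Phi> ` L"
      using imageI[OF Zm_L(1)[OF z Zm_N[OF z]], of \<Phi>] by (simp only: Zm_L(2)[OF z Zm_N[OF z]])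
  qed
  have closed_img: "closed (\<Phi> ` L)"
    by (intro compact_imp_closed compact_continuous_image cont\<Phi> compL)
  \<comment> \<open>Points of time \<open>T\<close> are limits of points below them, and the image of \<open>L\<close> is closed.\<close>
  have V_img: "?V \<subseteq> \<Phi> ` L"
  proof
    fix z assume z: "z \<in> ?V"
    show "z \<in> \<Phi> ` L"
    proof (cases "snd z < T")
      case True
      then have "z \<in> ?W" using z by (simp add: mem_Times_iff)
      then show ?thesis using W_img by (rule subsetD[rotated])
    next
      case False
      then have zT: "z = (fst z, T)" using z by (simp add: mem_Times_iff prod_eq_iff)
      have "z \<in> ball ?z0 \<delta>1" using z by (rule IntD1)
      then obtain e where e: "e > 0" "ball z e \<subseteq> ball ?z0 \<delta>1" by (rule openE[OF open_ball])
      have "(fst z, T) \<in> closure (\<Phi> ` L)"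
      proof (rule closure_below)
        show "min e T > 0" using e T_pos by simp
        fix s assume s: "T - min e T < s" "s < T"
        have "dist z (fst z, s) < e" by (subst zT) (use s in \<open>simp add: dist_Pair_Pair dist_real_def\<close>)
        then have "(fst z, s) \<in> ball ?z0 \<delta>1" using e(2) by (meson mem_ball subsetD)
        moreover have "s \<in> {0..<T}" using s by auto
        ultimately show "(fst z, s) \<in> \<Phi> ` L" using W_img by blast
      qed
      then have "(fst z, T) \<in> \<Phi> ` L" by (simp only: closure_closed[OF closed_img])
      then show ?thesis by (subst zT)
    qed
  qed
  define Zt where "Zt = the_inv_into L \<Phi>"
  have Zt: "Zt z \<in> L" "\<Phi> (Zt z) = z" if "z \<in> ?V" for z
  proof -
    have "z \<in> \<Phi> ` L" using V_img that by blast
    then show "Zt z \<in> L" "\<Phi> (Zt z) = z"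
      unfolding Zt_def by (auto intro: the_inv_into_into[OF inj] f_the_inv_into_f[OF inj])
  qed
  show ?thesis
  proof (rule that[OF \<delta>1(1), of Zt])
    show "continuous_on ?V Zt"
      unfolding Zt_def by (rule continuous_on_subset[OF continuous_on_inv_into[OF cont\<Phi> compL inj] V_img])
    have "Zt (\<Phi> (X0, Y0)) = (X0, Y0)" unfolding Zt_def by (rule the_inv_into_f_f[OF inj Z0L])
    then show "Zt ?z0 = (X0, Y0)" using t_Z0 by (simp add: \<Phi>_def)
    fix z assume z: "z \<in> ?V"
    show "Zt z \<in> G \<and> Zt z \<in> closure U \<and> x (Zt z) = fst z \<and> t (Zt z) = snd z \<and> cos (b (Zt z) / 2) > 0"
    proof (intro conjI)
      show "x (Zt z) = fst z" "t (Zt z) = snd z"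
        using arg_cong[OF Zt(2)[OF z], of fst] arg_cong[OF Zt(2)[OF z], of snd] by (simp_all add: \<Phi>_def)
    qed (use LG[OF Zt(1)[OF z]] r(2)[OF LG(3)[OF Zt(1)[OF z]]] in auto)
    show "Zt z = Zm z" if "snd z < T"
    proof -
      have W: "z \<in> ?W" using z that by (simp add: mem_Times_iff)
      show ?thesis
        by (rule inj_onD[OF inj trans[OF Zt(2)[OF z] Zm_L(2)[OF W Zm_N[OF W], symmetric]]
            Zt(1)[OF z] Zm_L(1)[OF W Zm_N[OF W]]])
    qed
  qed
qed

end

section \<open>The cube root estimate\<close>

lemma abs_diff_cube_le: "\<bar>x - y\<bar> ^ 3 \<le> 4 * \<bar>x ^ 3 - y ^ 3\<bar>" for x y :: real
proof -
  have "(x - y)\<^sup>2 \<le> 4 * (x\<^sup>2 + x * y + y\<^sup>2)"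
    using zero_le_power2[of "x + y"] by (simp add: power2_eq_square algebra_simps)
  also have "\<dots> \<le> 4 * \<bar>x\<^sup>2 + x * y + y\<^sup>2\<bar>" by (rule mult_left_mono[OF abs_ge_self]) simp
  finally have "\<bar>x - y\<bar> * (x - y)\<^sup>2 \<le> \<bar>x - y\<bar> * (4 * \<bar>x\<^sup>2 + x * y + y\<^sup>2\<bar>)"
    by (rule mult_left_mono) simp
  also have "\<dots> = 4 * \<bar>(x - y) * (x\<^sup>2 + x * y + y\<^sup>2)\<bar>" by (simp add: abs_mult)
  also have "(x - y) * (x\<^sup>2 + x * y + y\<^sup>2) = x ^ 3 - y ^ 3"
    by (simp add: power2_eq_square power3_eq_cube algebra_simps)
  also have "\<bar>x - y\<bar> * (x - y)\<^sup>2 = \<bar>x - y\<bar> ^ 3"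
    by (simp add: power3_eq_cube power2_eq_square)
  finally show ?thesis .
qed

lemma abs_diff_root3_le: "\<bar>x - root 3 y\<bar> \<le> root 3 (4 * \<bar>x ^ 3 - y\<bar>)" for x y :: real
proof -
  have "\<bar>x - root 3 y\<bar> ^ 3 \<le> 4 * \<bar>x ^ 3 - y\<bar>"
    using abs_diff_cube_le[of x "root 3 y"] by (simp add: odd_real_root_pow)
  then have "root 3 (\<bar>x - root 3 y\<bar> ^ 3) \<le> root 3 (4 * \<bar>x ^ 3 - y\<bar>)" by simp
  then show ?thesis by (simp add: real_root_power_cancel)
qed

lemma abs_sin_minus_le: "\<bar>sin y - y\<bar> \<le> \<bar>y\<bar> ^ 3 / 2" for y :: real
proof -
  have "\<bar>sin y - sin 0 - 1 / real (Suc 0) * (y - 0) ^ Suc 0\<bar> \<le> y\<^sup>2 / 2 * \<bar>y - 0\<bar>"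
  proof (rule mvt_monomial[where g' = cos])
    fix s assume s: "s \<in> closed_segment 0 y"
    show "(sin has_real_derivative cos s) (at s)" by (rule DERIV_sin)
    have "\<bar>s\<bar> \<le> \<bar>y\<bar>" using s by (auto simp: closed_segment_eq_real_ivl split: if_splits)
    then have "\<bar>s / 2\<bar> \<le> \<bar>y / 2\<bar>" by simp
    moreover have "\<bar>sin (s / 2)\<bar> \<le> \<bar>s / 2\<bar>" by (rule abs_sin_x_le_abs_x)
    ultimately have "\<bar>sin (s / 2)\<bar> \<le> \<bar>y / 2\<bar>" by linarith
    then have "(sin (s / 2))\<^sup>2 \<le> (y / 2)\<^sup>2" by (simp only: abs_le_square_iff)
    moreover have "cos s = 1 - 2 * (sin (s / 2))\<^sup>2" using cos_double_sin[of "s / 2"] by simp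
    ultimately show "\<bar>cos s - 1 * (s - 0) ^ 0\<bar> \<le> y\<^sup>2 / 2" by (simp add: power_divide)
  qed
  then show ?thesis by (simp add: power3_eq_cube power2_eq_square)
qed

text \<open>The hypotheses give \<open>\<xi> = O(d\<^bsup>1/3\<^esup>)\<close> and \<open>\<eta> = O(d)\<close>, so the remainder is of order \<open>d\<^bsup>4/3\<^esup>\<close>. This error in the cube of \<open>\<xi>\<close> becomes
  an error \<open>d\<^bsup>4/9\<^esup>\<close> in \<open>\<xi>\<close>, because the cube root is uniformly Hoelder continuous with exponent 1/3. The radius \<open>\<rho>\<close> serves to absorb
  the remainder into the leading terms \<open>\<kappa> \<eta>\<close> and \<open>A \<xi>\<^sup>3\<close>.\<close>

lemma cube_root_estimate:
  fixes \<kappa> A C kt c0 :: real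
  assumes "\<kappa> > 0" "A > 0" "C \<ge> 0"
  obtains \<rho> M where "\<rho> > 0" "M \<ge> 0"
    "\<And>\<xi> \<eta> dt dx d. \<lbrakk>\<bar>\<xi>\<bar> \<le> \<rho>; \<bar>\<eta>\<bar> \<le> \<rho>; d = \<bar>dt\<bar> + \<bar>dx\<bar>; d \<le> 1;
       \<bar>dt - \<kappa> * \<eta> - kt * \<xi> ^ 3\<bar> \<le> C * (\<bar>\<xi> * \<eta>\<bar> + \<xi> ^ 4 + \<eta>\<^sup>2);
       \<bar>c0 * dt + dx - A * \<xi> ^ 3\<bar> \<le> C * (\<bar>\<xi> * \<eta>\<bar> + \<xi> ^ 4 + \<eta>\<^sup>2)\<rbrakk> \<Longrightarrow>
       \<bar>\<xi> - root 3 ((c0 * dt + dx) / A)\<bar> \<le> M * d powr (4 / 9) \<and> \<xi>\<^sup>2 + \<bar>\<eta>\<bar> \<le> M * d powr (4 / 9)"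
proof -
  define m where "m = 2 * (1 + \<bar>kt\<bar> + C) / \<kappa>"
  have m: "m \<ge> 0" using assms by (simp add: m_def)
  define \<rho> where "\<rho> = min 1 (min (\<kappa> / (4 * (C + 1))) (A / (2 * (C + 1) * (2 * m + 1))))"
  have den: "C + 1 > 0" "2 * m + 1 > 0" using assms m by auto
  have \<rho>: "\<rho> > 0" "\<rho> \<le> 1" "\<rho> \<le> \<kappa> / (4 * (C + 1))" "\<rho> \<le> A / (2 * (C + 1) * (2 * m + 1))"
    using assms den by (auto simp: \<rho>_def)
  have \<rho>1: "2 * C * \<rho> \<le> \<kappa> / 2"
  proof -
    have "4 * (C + 1) * \<rho> \<le> \<kappa>" using \<rho>(3) den by (simp add: field_simps)
    moreover have "4 * C * \<rho> \<le> 4 * (C + 1) * \<rho>" using \<rho>(1) by (simp add: algebra_simps)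
    ultimately show ?thesis by linarith
  qed
  have \<rho>2: "C * \<rho> * (2 * m + 1) \<le> A / 2"
  proof -
    have "2 * (C + 1) * (2 * m + 1) * \<rho> \<le> A"
    proof -
      have "2 * (C + 1) * (2 * m + 1) > 0" using den by simp
      from \<rho>(4)[unfolded pos_le_divide_eq[OF this]] show ?thesis by (simp only: mult.commute)
    qed
    moreover have "2 * C * (2 * m + 1) * \<rho> \<le> 2 * (C + 1) * (2 * m + 1) * \<rho>"
      using \<rho>(1) den by (intro mult_right_mono) auto
    ultimately show ?thesis by (simp add: algebra_simps)
  qed
  define m3 where "m3 = 2 * (\<bar>c0\<bar> + 1) / A + 1"
  have m3: "m3 \<ge> 0" using assms by (simp add: m3_def)
  define m4 where "m4 = m * (1 + m3)"
  have m4: "m4 \<ge> 0" using m m3 by (simp add: m4_def)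
  define m5 where "m5 = root 3 m3 * m4 + root 3 m3 * m3 + m4\<^sup>2"
  have m5: "m5 \<ge> 0" using m3 m4 by (simp add: m5_def)
  define M where "M = root 3 (4 * C * m5 / A) + ((root 3 m3)\<^sup>2 + m4)"
  have M1: "root 3 (4 * C * m5 / A) \<ge> 0" "(root 3 m3)\<^sup>2 + m4 \<ge> 0" using assms m4 m5 by auto
  show ?thesis
  proof (rule that[OF \<rho>(1), of M])
    show "M \<ge> 0" using M1 by (simp add: M_def)
    fix \<xi> \<eta> dt dx d :: real
    define R where "R = \<bar>\<xi> * \<eta>\<bar> + \<xi> ^ 4 + \<eta>\<^sup>2"
    define Q where "Q = c0 * dt + dx"
    assume h: "\<bar>\<xi>\<bar> \<le> \<rho>" "\<bar>\<eta>\<bar> \<le> \<rho>" "d = \<bar>dt\<bar> + \<bar>dx\<bar>" "d \<le> 1"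
      "\<bar>dt - \<kappa> * \<eta> - kt * \<xi> ^ 3\<bar> \<le> C * (\<bar>\<xi> * \<eta>\<bar> + \<xi> ^ 4 + \<eta>\<^sup>2)"
      "\<bar>c0 * dt + dx - A * \<xi> ^ 3\<bar> \<le> C * (\<bar>\<xi> * \<eta>\<bar> + \<xi> ^ 4 + \<eta>\<^sup>2)"
    note hR = h(5,6)[folded R_def Q_def]
    have d0: "d \<ge> 0" using h(3) by simp
    define X where "X = \<bar>\<xi>\<bar> ^ 3"
    have X0: "X \<ge> 0" by (simp add: X_def)
    have xi4: "\<xi> ^ 4 = \<bar>\<xi>\<bar> * X" unfolding X_def
      by (simp add: power4_eq_xxxx power3_eq_cube flip: abs_mult)
    have eta2: "\<eta>\<^sup>2 = \<bar>\<eta>\<bar> * \<bar>\<eta>\<bar>" by (simp add: power2_eq_square)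
    have R1: "R \<le> 2 * \<rho> * \<bar>\<eta>\<bar> + \<rho> * X"
    proof -
      have "\<bar>\<xi> * \<eta>\<bar> \<le> \<rho> * \<bar>\<eta>\<bar>" unfolding abs_mult by (rule mult_right_mono[OF h(1)]) simp
      moreover have "\<xi> ^ 4 \<le> \<rho> * X" unfolding xi4 by (rule mult_right_mono[OF h(1) X0])
      moreover have "\<eta>\<^sup>2 \<le> \<rho> * \<bar>\<eta>\<bar>" unfolding eta2 by (rule mult_right_mono[OF h(2)]) simp
      ultimately show ?thesis unfolding R_def by linarith
    qed
    have CR: "C * R \<le> 2 * C * \<rho> * \<bar>\<eta>\<bar> + C * \<rho> * X"
      using mult_left_mono[OF R1 assms(3)] by (simp add: algebra_simps)
    have "\<bar>kt * \<xi> ^ 3\<bar> = \<bar>kt\<bar> * X" by (simp add: X_def abs_mult power_abs)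
    moreover have "\<bar>\<kappa> * \<eta>\<bar> = \<kappa> * \<bar>\<eta>\<bar>" using assms(1) by (simp add: abs_mult)
    ultimately have "\<kappa> * \<bar>\<eta>\<bar> \<le> \<bar>dt\<bar> + \<bar>kt\<bar> * X + C * R" using hR(1) by linarith
    moreover have "2 * C * \<rho> * \<bar>\<eta>\<bar> \<le> \<kappa> / 2 * \<bar>\<eta>\<bar>" by (rule mult_right_mono[OF \<rho>1]) simp
    moreover have "C * \<rho> * X \<le> C * X" using \<rho>(2) assms(3) X0 mult_right_mono[OF mult_left_le[OF \<rho>(2) assms(3)] X0] by simp
    ultimately have "\<kappa> / 2 * \<bar>\<eta>\<bar> \<le> d + (\<bar>kt\<bar> + C) * X"
      using CR h(3) abs_ge_zero[of dx] distrib_right[of "\<bar>kt\<bar>" C X] by linarith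
    also have "\<dots> \<le> (1 + \<bar>kt\<bar> + C) * (d + X)"
    proof -
      have "0 \<le> (\<bar>kt\<bar> + C) * d" using assms d0 by simp
      then show ?thesis using X0 by (simp add: algebra_simps)
    qed
    finally have eta: "\<bar>\<eta>\<bar> \<le> m * (d + X)"
      using assms(1) by (simp add: m_def field_simps)
    have AX: "\<bar>A * \<xi> ^ 3\<bar> = A * X" using assms(2) by (simp add: X_def abs_mult power_abs)
    have Qd: "\<bar>Q\<bar> \<le> (\<bar>c0\<bar> + 1) * d"
    proof -
      have "\<bar>Q\<bar> \<le> \<bar>c0\<bar> * \<bar>dt\<bar> + \<bar>dx\<bar>" unfolding Q_def using abs_triangle_ineq[of "c0 * dt" dx] by (simp add: abs_mult)
      moreover have "0 \<le> \<bar>c0\<bar> * \<bar>dx\<bar>" by simp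
      ultimately show ?thesis unfolding h(3)
        using abs_ge_zero[of dt] by (simp only: distrib_left distrib_right mult_1)
    qed
    have "A * X \<le> \<bar>Q\<bar> + C * R" using hR(2) AX by linarith
    also have "C * R \<le> 2 * C * \<rho> * (m * (d + X)) + C * \<rho> * X"
    proof -
      have "2 * C * \<rho> * \<bar>\<eta>\<bar> \<le> 2 * C * \<rho> * (m * (d + X))"
        by (rule mult_left_mono[OF eta]) (use assms \<rho>(1) in simp)
      then show ?thesis using CR by linarith
    qed
    also have "\<dots> \<le> C * \<rho> * (2 * m + 1) * (d + X)"
    proof -
      have "0 \<le> C * \<rho> * d" using assms \<rho>(1) d0 by simp
      then show ?thesis by (simp add: algebra_simps)
    qed
    also have "\<dots> \<le> A / 2 * (d + X)" by (rule mult_right_mono[OF \<rho>2]) (use d0 X0 in simp)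
    finally have "A / 2 * X \<le> (\<bar>c0\<bar> + 1) * d + A / 2 * d" using Qd distrib_left[of "A / 2" d X] by linarith
    then have X: "X \<le> m3 * d" using assms(2) by (simp add: m3_def field_simps)
    have "m * (d + X) \<le> m * (d + m3 * d)" by (rule mult_left_mono) (use X m in auto)
    then have eta': "\<bar>\<eta>\<bar> \<le> m4 * d" using eta by (simp add: m4_def algebra_simps)
    define e where "e = root 3 d"
    have e0: "e \<ge> 0" using d0 by (simp add: e_def)
    have e3: "e ^ 3 = d" by (simp add: e_def odd_real_root_pow)
    have e1: "e \<le> 1" unfolding e_def using h(4) by simp
    have de: "d \<le> e" unfolding e3[symmetric] using power_decreasing[of 1 3 e] e0 e1 by simp
    have xi: "\<bar>\<xi>\<bar> \<le> root 3 m3 * e"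
    proof -
      have "root 3 X \<le> root 3 (m3 * d)" using X by simp
      then show ?thesis by (simp add: X_def real_root_power_cancel real_root_mult e_def)
    qed
    have r0: "root 3 m3 \<ge> 0" using m3 by simp
    have R2: "R \<le> m5 * (e * d)"
    proof -
      have "\<bar>\<xi> * \<eta>\<bar> \<le> (root 3 m3 * e) * (m4 * d)"
        unfolding abs_mult by (rule mult_mono[OF xi eta']) (use r0 e0 in auto)
      moreover have "\<xi> ^ 4 \<le> (root 3 m3 * e) * (m3 * d)"
        unfolding xi4 by (rule mult_mono[OF xi X]) (use r0 e0 X0 in auto)
      moreover have "\<eta>\<^sup>2 \<le> (m4 * d) * (m4 * d)"
        unfolding eta2 by (rule mult_mono[OF eta' eta']) (use m4 d0 in auto)
      moreover have "(m4 * d) * (m4 * d) \<le> m4\<^sup>2 * (e * d)"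
      proof -
        have "d * d \<le> e * d" by (rule mult_right_mono[OF de d0])
        from mult_left_mono[OF this, of "m4\<^sup>2"] show ?thesis by (simp add: power2_eq_square algebra_simps)
      qed
      ultimately show ?thesis unfolding R_def m5_def by (simp add: algebra_simps)
    qed
    have "A * \<bar>\<xi> ^ 3 - Q / A\<bar> = \<bar>Q - A * \<xi> ^ 3\<bar>"
    proof -
      have "A * (\<xi> ^ 3 - Q / A) = A * \<xi> ^ 3 - Q" using assms(2) by (simp add: algebra_simps)
      then have "\<bar>A * (\<xi> ^ 3 - Q / A)\<bar> = \<bar>Q - A * \<xi> ^ 3\<bar>" by simp
      then show ?thesis using assms(2) by (simp add: abs_mult)
    qed
    also have "\<dots> \<le> C * (m5 * (e * d))" using hR(2) mult_left_mono[OF R2 assms(3)] by linarith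
    finally have "4 * \<bar>\<xi> ^ 3 - Q / A\<bar> \<le> 4 * C * m5 / A * (e * d)"
      using assms(2) by (simp add: field_simps)
    then have "root 3 (4 * \<bar>\<xi> ^ 3 - Q / A\<bar>) \<le> root 3 (4 * C * m5 / A * (e * d))" by simp
    then have 1: "\<bar>\<xi> - root 3 (Q / A)\<bar> \<le> root 3 (4 * C * m5 / A) * root 3 (e * d)"
      using abs_diff_root3_le[of \<xi> "Q / A"] by (simp only: real_root_mult)
    have ed: "root 3 (e * d) = d powr (4 / 9)"
    proof (cases "d = 0")
      case False
      then have dp: "d > 0" using d0 by simp
      have "e = d powr (1 / 3)" unfolding e_def using dp by (simp add: root_powr_inverse)
      then have "e * d = d powr (4 / 3)" using dp by (simp add: powr_mult_base mult.commute)
      then show ?thesis using dp by (simp add: root_powr_inverse powr_powr)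
    qed simp
    have "\<xi>\<^sup>2 + \<bar>\<eta>\<bar> \<le> ((root 3 m3)\<^sup>2 + m4) * e\<^sup>2"
    proof -
      have "\<bar>\<xi>\<bar>\<^sup>2 \<le> (root 3 m3 * e)\<^sup>2" by (rule power_mono[OF xi]) simp
      moreover have "d \<le> e\<^sup>2" unfolding e3[symmetric] by (rule power_decreasing) (use e0 e1 in auto)
      then have "m4 * d \<le> m4 * e\<^sup>2" by (rule mult_left_mono[OF _ m4])
      ultimately show ?thesis using eta' by (simp add: power_mult_distrib algebra_simps)
    qed
    also have "e\<^sup>2 \<le> d powr (4 / 9)"
    proof (cases "d = 0")
      case True then show ?thesis by (simp add: e_def)
    next
      case False
      then have dp: "d > 0" using d0 by simp
      have "e\<^sup>2 = d powr (2 / 3)" unfolding e_def using dp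
        by (simp add: root_powr_inverse powr_powr flip: powr_numeral)
      also have "\<dots> \<le> d powr (4 / 9)" by (rule powr_mono') (use dp h(4) in auto)
      finally show ?thesis .
    qed
    finally have 2: "\<xi>\<^sup>2 + \<bar>\<eta>\<bar> \<le> ((root 3 m3)\<^sup>2 + m4) * d powr (4 / 9)"
      using M1(2) by (simp add: mult_left_mono)
    have p0: "d powr (4 / 9) \<ge> 0" by simp
    show "\<bar>\<xi> - root 3 ((c0 * dt + dx) / A)\<bar> \<le> M * d powr (4 / 9) \<and> \<xi>\<^sup>2 + \<bar>\<eta>\<bar> \<le> M * d powr (4 / 9)"
    proof
      show "\<bar>\<xi> - root 3 ((c0 * dt + dx) / A)\<bar> \<le> M * d powr (4 / 9)"
        using 1 mult_nonneg_nonneg[OF M1(2) p0] unfolding ed Q_def M_def by (simp add: distrib_right)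
      show "\<xi>\<^sup>2 + \<bar>\<eta>\<bar> \<le> M * d powr (4 / 9)"
        using 2 mult_nonneg_nonneg[OF M1(1) p0] unfolding M_def by (simp add: distrib_right)
    qed
  qed
qed

section \<open>Expansions at a singular point\<close>

context char_plane_flow
begin

text \<open>This is where \<open>\<alpha>\<close> has to be \<open>C\<^sup>3\<close>: the cubic remainder needs \<open>\<alpha>\<^sub>X\<^sub>X\<close> to be Lipschitz.\<close>

lemma expansion_a:
  assumes a: "a (X0, Y0) = - pi" and G': "open G'" "(X0, Y0) \<in> G'" "Ck_on 3 G' a"
  obtains r C where "r > 0" "C \<ge> 0"
    "\<And>s. \<bar>s - X0\<bar> \<le> r \<Longrightarrow> \<bar>cos (a (s, Y0) / 2) - pd1 (pd1 a) (X0, Y0) / 4 * (s - X0)\<^sup>2\<bar> \<le> C * \<bar>s - X0\<bar> ^ 3"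
proof -
  define k where "k = pd1 (pd1 a) (X0, Y0)"
  have k: "k > 0" using singular_type1(3)[OF a] by (simp add: k_def)
  have C3: "Ck_on (Suc (Suc (Suc 0))) G' a" using G'(3) by (simp add: numeral_3_eq_3)
  note C2 = Ck_on_openD(2)[OF G'(1) C3]
  note C1 = Ck_on_openD(2)[OF G'(1) C2]
  obtain r0 where r0: "r0 > 0" "box_at (X0, Y0) r0 \<subseteq> G'" by (rule open_contains_box[OF G'(1,2)])
  define r where "r = min r0 1"
  have r: "r > 0" "r \<le> r0" "r \<le> 1" using r0 by (auto simp: r_def)
  have rG: "box_at (X0, Y0) r \<subseteq> G'" using r0 box_at_mono[OF r(2)] by blast
  obtain K where K: "K \<ge> 0" "\<And>x y x' y'. (x, y) \<in> box_at (X0, Y0) r \<Longrightarrow> (x', y') \<in> box_at (X0, Y0) r \<Longrightarrow>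
        \<bar>pd1 (pd1 a) (x', y') - pd1 (pd1 a) (x, y)\<bar> \<le> K * (\<bar>x' - x\<bar> + \<bar>y' - y\<bar>)"
    by (rule C1_lipschitz_box[OF G'(1) C1 rG]) blast
  have row: "(s, Y0) \<in> G'" "(s, Y0) \<in> box_at (X0, Y0) r" if "\<bar>s - X0\<bar> \<le> r" for s
    using that rG r(1) by (auto simp: mem_box_at subset_iff)
  have seg: "\<bar>s' - X0\<bar> \<le> \<bar>s - X0\<bar>" if "s' \<in> closed_segment X0 s" for s s'
    using that by (auto simp: closed_segment_eq_real_ivl split: if_splits)
  have 2: "\<bar>pd1 (pd1 a) (s, Y0) - k\<bar> \<le> K * \<bar>s - X0\<bar>" if "\<bar>s - X0\<bar> \<le> r" for s
    using K(2)[OF row(2)[of X0] row(2)[OF that]] r(1) by (simp add: k_def)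
  have 1: "\<bar>pd1 a (s, Y0) - k * (s - X0) ^ 1\<bar> \<le> K * \<bar>s - X0\<bar>\<^sup>2" if s: "\<bar>s - X0\<bar> \<le> r" for s
  proof -
    have "\<bar>pd1 a (s, Y0) - pd1 a (X0, Y0) - k / real (Suc 0) * (s - X0) ^ Suc 0\<bar> \<le> K * \<bar>s - X0\<bar> * \<bar>s - X0\<bar>"
    proof (rule mvt_monomial[where g = "\<lambda>s. pd1 a (s, Y0)" and g' = "\<lambda>s. pd1 (pd1 a) (s, Y0)"])
      fix s' assume "s' \<in> closed_segment X0 s"
      from seg[OF this] have s': "\<bar>s' - X0\<bar> \<le> \<bar>s - X0\<bar>" "\<bar>s' - X0\<bar> \<le> r" using s by auto
      show "((\<lambda>s. pd1 a (s, Y0)) has_real_derivative pd1 (pd1 a) (s', Y0)) (at s')"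
        by (rule Ck_on_partials(1)[OF G'(1) C2 row(1)[OF s'(2)]])
      show "\<bar>pd1 (pd1 a) (s', Y0) - k * (s' - X0) ^ 0\<bar> \<le> K * \<bar>s - X0\<bar>"
        using 2[OF s'(2)] mult_left_mono[OF s'(1) K(1)] by simp
    qed
    then show ?thesis using a1_zero[OF a] by (simp add: power2_eq_square)
  qed
  have 0: "\<bar>a (s, Y0) + pi - k / 2 * (s - X0)\<^sup>2\<bar> \<le> K * \<bar>s - X0\<bar> ^ 3" if s: "\<bar>s - X0\<bar> \<le> r" for s
  proof -
    have "\<bar>a (s, Y0) - a (X0, Y0) - k / real (Suc 1) * (s - X0) ^ Suc 1\<bar> \<le> K * \<bar>s - X0\<bar>\<^sup>2 * \<bar>s - X0\<bar>"
    proof (rule mvt_monomial[where g = "\<lambda>s. a (s, Y0)" and g' = "\<lambda>s. pd1 a (s, Y0)"])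
      fix s' assume "s' \<in> closed_segment X0 s"
      from seg[OF this] have s': "\<bar>s' - X0\<bar> \<le> \<bar>s - X0\<bar>" "\<bar>s' - X0\<bar> \<le> r" using s by auto
      show "((\<lambda>s. a (s, Y0)) has_real_derivative pd1 a (s', Y0)) (at s')"
        by (rule Ck_on_partials(1)[OF G'(1) C3 row(1)[OF s'(2)]])
      have "\<bar>s' - X0\<bar>\<^sup>2 \<le> \<bar>s - X0\<bar>\<^sup>2" by (rule power_mono[OF s'(1)]) simp
      from mult_left_mono[OF this K(1)]
      show "\<bar>pd1 a (s', Y0) - k * (s' - X0) ^ 1\<bar> \<le> K * \<bar>s - X0\<bar>\<^sup>2"
        using 1[OF s'(2)] by linarith
    qed
    then show ?thesis using a by (simp add: power2_eq_square power3_eq_cube)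
  qed
  define M where "M = (k + K) ^ 3 + K"
  show ?thesis
  proof (rule that[OF r(1), of M])
    show "M \<ge> 0" using k K(1) by (simp add: M_def)
    fix s assume s: "\<bar>s - X0\<bar> \<le> r"
    define \<xi> where "\<xi> = \<bar>s - X0\<bar>"
    have \<xi>: "0 \<le> \<xi>" "\<xi> \<le> 1" using s r by (auto simp: \<xi>_def)
    define y where "y = (a (s, Y0) + pi) / 2"
    have cosy: "cos (a (s, Y0) / 2) = sin y"
      by (simp add: y_def add_divide_distrib sin_add)
    have y: "\<bar>y - k / 4 * \<xi>\<^sup>2\<bar> \<le> K / 2 * \<xi> ^ 3"
      using 0[OF s] by (simp add: y_def \<xi>_def power2_abs abs_le_iff field_simps)
    have "\<xi> ^ 3 \<le> \<xi>\<^sup>2" using \<xi> by (intro power_decreasing) auto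
    then have "K / 2 * \<xi> ^ 3 \<le> K / 2 * \<xi>\<^sup>2" using K(1) by (intro mult_left_mono) auto
    moreover have "0 \<le> k / 4 * \<xi>\<^sup>2" using k by simp
    ultimately have "\<bar>y\<bar> \<le> k / 4 * \<xi>\<^sup>2 + K / 2 * \<xi>\<^sup>2" using y by linarith
    also have "\<dots> \<le> (k + K) * \<xi>\<^sup>2"
    proof -
      have "k / 4 * \<xi>\<^sup>2 \<le> k * \<xi>\<^sup>2" "K / 2 * \<xi>\<^sup>2 \<le> K * \<xi>\<^sup>2" using k K(1) by (auto intro!: mult_right_mono)
      then show ?thesis by (simp add: distrib_right)
    qed
    also have "\<dots> \<le> (k + K) * \<xi>" using \<xi> k K(1) power_decreasing[of 1 2 \<xi>] by (intro mult_left_mono) auto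
    finally have "\<bar>y\<bar> ^ 3 \<le> ((k + K) * \<xi>) ^ 3" by (intro power_mono) auto
    then have "\<bar>sin y - y\<bar> \<le> (k + K) ^ 3 * \<xi> ^ 3"
      using abs_sin_minus_le[of y] zero_le_power[OF abs_ge_zero, of y 3]
      unfolding power_mult_distrib by linarith
    moreover have "K / 2 * \<xi> ^ 3 \<le> K * \<xi> ^ 3" using K(1) \<xi> by (intro mult_right_mono) auto
    ultimately have "\<bar>sin y - k / 4 * \<xi>\<^sup>2\<bar> \<le> M * \<xi> ^ 3"
      using y unfolding M_def distrib_right by linarith
    then show "\<bar>cos (a (s, Y0) / 2) - pd1 (pd1 a) (X0, Y0) / 4 * (s - X0)\<^sup>2\<bar> \<le> M * \<bar>s - X0\<bar> ^ 3"
      unfolding cosy k_def[symmetric] \<xi>_def by simp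
  qed
qed

text \<open>The function \<open>f\<close> will be \<open>t\<close> or \<open>x\<close>. The equation for \<open>f\<^sub>X\<close> holds on the closure of \<open>U\<close> only, so the path of integration has to stay
  there. To the left of \<open>X0\<close> the row through the singular point does; to the right of it, the row through \<open>(X, Y)\<close> does.\<close>

lemma cubic_expansion:
  assumes a: "a (X0, Y0) = - pi" and G': "open G'" "(X0, Y0) \<in> G'" "Ck_on 3 G' a"
    and C2_f: "Ck_on (Suc (Suc 0)) G f" and C1_m: "Ck_on (Suc 0) G m"
    and f1: "\<And>z. z \<in> G \<Longrightarrow> z \<in> closure U \<Longrightarrow> pd1 f z = m z * cos (a z / 2)"
  obtains r C where "r > 0" "C \<ge> 0"
    "\<And>X Y. (X, Y) \<in> box_at (X0, Y0) r \<Longrightarrow> (X, Y) \<in> closure U \<Longrightarrow>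
      \<bar>f (X, Y) - f (X0, Y0) - pd2 f (X0, Y0) * (Y - Y0)
         - m (X0, Y0) * pd1 (pd1 a) (X0, Y0) / 12 * (X - X0) ^ 3\<bar>
       \<le> C * (\<bar>(X - X0) * (Y - Y0)\<bar> + (X - X0) ^ 4 + (Y - Y0)\<^sup>2)"
proof -
  define k where "k = pd1 (pd1 a) (X0, Y0) / 4"
  have k: "k \<ge> 0" using singular_type1(3)[OF a] by (simp add: k_def)
  define m0 where "m0 = m (X0, Y0)"
  obtain r1 C1 where C1: "r1 > 0" "C1 \<ge> 0"
    "\<And>s. \<bar>s - X0\<bar> \<le> r1 \<Longrightarrow> \<bar>cos (a (s, Y0) / 2) - k * (s - X0)\<^sup>2\<bar> \<le> C1 * \<bar>s - X0\<bar> ^ 3"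
    unfolding k_def by (rule expansion_a[OF a G']) blast
  have "eventually (\<lambda>z. fst z + snd z > 0) (nhds (X0, Y0))"
    using eventually_greater_nhds[of UNIV "\<lambda>z. fst z + snd z" "(X0, Y0)" 0] sum_pos
    by (simp add: continuous_on_add continuous_on_fst continuous_on_snd)
  then have "eventually (\<lambda>z. z \<in> G \<and> fst z + snd z > 0) (nhds (X0, Y0))"
    using eventually_nhds_in_open[OF open_G Z0_G] by (intro eventually_conj)
  then obtain r2 where r2: "r2 > 0" "\<And>z. z \<in> box_at (X0, Y0) r2 \<Longrightarrow> z \<in> G \<and> fst z + snd z > 0"
    by (rule eventually_box) blast
  define r where "r = min 1 (min r1 r2)"
  have r: "r > 0" "r \<le> 1" "r \<le> r1" "r \<le> r2" using C1(1) r2(1) by (auto simp: r_def)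
  let ?B = "box_at (X0, Y0) r"
  have B: "z \<in> G" "fst z + snd z > 0" if "z \<in> ?B" for z
    using r2(2) that box_at_mono[OF r(4)] by blast+
  have BG: "?B \<subseteq> G" using B by blast
  note C1_f1 = Ck_on_openD(2)[OF open_G C2_f] and C1_f2 = Ck_on_openD(3)[OF open_G C2_f]
  obtain K1 where K1: "K1 \<ge> 0" "\<And>x y x' y'. (x, y) \<in> ?B \<Longrightarrow> (x', y') \<in> ?B \<Longrightarrow>
        \<bar>pd1 f (x', y') - pd1 f (x, y)\<bar> \<le> K1 * (\<bar>x' - x\<bar> + \<bar>y' - y\<bar>)"
    by (rule C1_lipschitz_box[OF open_G C1_f1 BG]) blast
  obtain K2 where K2: "K2 \<ge> 0" "\<And>x y x' y'. (x, y) \<in> ?B \<Longrightarrow> (x', y') \<in> ?B \<Longrightarrow>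
        \<bar>pd2 f (x', y') - pd2 f (x, y)\<bar> \<le> K2 * (\<bar>x' - x\<bar> + \<bar>y' - y\<bar>)"
    by (rule C1_lipschitz_box[OF open_G C1_f2 BG]) blast
  obtain Km where Km: "Km \<ge> 0" "\<And>x y x' y'. (x, y) \<in> ?B \<Longrightarrow> (x', y') \<in> ?B \<Longrightarrow>
        \<bar>m (x', y') - m (x, y)\<bar> \<le> Km * (\<bar>x' - x\<bar> + \<bar>y' - y\<bar>)"
    by (rule C1_lipschitz_box[OF open_G C1_m BG]) blast
  obtain Ka where Ka: "Ka \<ge> 0" "\<And>x y x' y'. (x, y) \<in> ?B \<Longrightarrow> (x', y') \<in> ?B \<Longrightarrow>
        \<bar>a (x', y') - a (x, y)\<bar> \<le> Ka * (\<bar>x' - x\<bar> + \<bar>y' - y\<bar>)"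
    by (rule C1_lipschitz_box[OF open_G C2_a BG]) blast
  have Z0B: "(X0, Y0) \<in> ?B" using r(1) by (simp add: mem_box_at)
  define K where "K = Km * (2 * k + 2 * C1 + 2 * Ka) + \<bar>m0\<bar> * (C1 + Ka)"
  have K: "K \<ge> 0" using Km(1) k C1(2) Ka(1) by (simp add: K_def)
  have h: "\<bar>m (s, Y) * cos (a (s, Y) / 2) - m0 * k * (s - X0)\<^sup>2\<bar> \<le> K * (\<bar>Y - Y0\<bar> + \<bar>s - X0\<bar> ^ 3)"
    if sB: "(s, Y) \<in> ?B" for s Y
  proof -
    define \<xi> where "\<xi> = \<bar>s - X0\<bar>"
    define \<eta> where "\<eta> = \<bar>Y - Y0\<bar>"
    have \<xi>: "0 \<le> \<xi>" "\<xi> \<le> 1" "\<xi> \<le> r" and \<eta>: "0 \<le> \<eta>" "\<eta> \<le> 1"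
      using sB r by (auto simp: \<xi>_def \<eta>_def mem_box_at)
    have sB0: "(s, Y0) \<in> ?B" using sB r(1) by (simp add: mem_box_at)
    define c where "c = cos (a (s, Y) / 2)"
    have xi2: "(s - X0)\<^sup>2 = \<xi>\<^sup>2" by (simp add: \<xi>_def)
    have "\<bar>cos (a (s, Y) / 2) - cos (a (s, Y0) / 2)\<bar> \<le> \<bar>a (s, Y) - a (s, Y0)\<bar>"
    proof -
      have "\<bar>cos (a (s, Y) / 2) - cos (a (s, Y0) / 2)\<bar>
        = \<bar>2 * (sin ((a (s, Y) / 2 + a (s, Y0) / 2) / 2) * sin ((a (s, Y0) / 2 - a (s, Y) / 2) / 2))\<bar>"
        by (simp add: cos_diff_cos)
      also have "\<dots> = 2 * (\<bar>sin ((a (s, Y) / 2 + a (s, Y0) / 2) / 2)\<bar> * \<bar>sin ((a (s, Y0) / 2 - a (s, Y) / 2) / 2)\<bar>)"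
        by (simp add: abs_mult)
      also have "\<dots> \<le> 2 * (1 * \<bar>(a (s, Y0) / 2 - a (s, Y) / 2) / 2\<bar>)"
        by (intro mult_left_mono mult_mono abs_sin_le_one abs_sin_x_le_abs_x) auto
      also have "\<dots> \<le> \<bar>a (s, Y) - a (s, Y0)\<bar>" by (simp add: field_simps abs_minus_commute)
      finally show ?thesis .
    qed
    also have "\<dots> \<le> Ka * \<eta>" using Ka(2)[OF sB0 sB] by (simp add: \<eta>_def)
    finally have "\<bar>c - cos (a (s, Y0) / 2)\<bar> \<le> Ka * \<eta>" by (simp add: c_def)
    moreover have "\<bar>cos (a (s, Y0) / 2) - k * \<xi>\<^sup>2\<bar> \<le> C1 * \<xi> ^ 3"
      using C1(3)[of s] \<xi> r by (simp add: \<xi>_def)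
    ultimately have c1: "\<bar>c - k * \<xi>\<^sup>2\<bar> \<le> C1 * \<xi> ^ 3 + Ka * \<eta>" by linarith
    have xi32: "\<xi> ^ 3 \<le> \<xi>\<^sup>2" using \<xi> by (intro power_decreasing) auto
    have c2: "\<bar>c\<bar> \<le> (k + C1) * \<xi>\<^sup>2 + Ka * \<eta>"
      using c1 mult_left_mono[OF xi32 C1(2)] mult_nonneg_nonneg[OF k zero_le_power2[of \<xi>]]
      unfolding distrib_right by linarith
    have m1: "\<bar>m (s, Y) - m0\<bar> \<le> Km * (\<xi> + \<eta>)"
      using Km(2)[OF Z0B sB] by (simp add: \<xi>_def \<eta>_def m0_def)
    have "\<bar>(m (s, Y) - m0) * c\<bar> \<le> Km * (\<xi> + \<eta>) * ((k + C1) * \<xi>\<^sup>2 + Ka * \<eta>)"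
      unfolding abs_mult by (rule mult_mono[OF m1 c2]) (use Km(1) \<xi> \<eta> in auto)
    also have "\<dots> \<le> Km * ((2 * k + 2 * C1 + 2 * Ka) * (\<eta> + \<xi> ^ 3))"
    proof -
      have e1: "\<eta> * \<xi>\<^sup>2 \<le> \<eta>" using \<xi> \<eta> by (simp add: mult_left_le power_le_one)
      have e2: "\<xi> * \<eta> \<le> \<eta>" "\<eta> * \<eta> \<le> \<eta>" using \<xi> \<eta> by (auto simp: mult_left_le_one_le mult_left_le)
      have "(\<xi> + \<eta>) * ((k + C1) * \<xi>\<^sup>2 + Ka * \<eta>)
          = (k + C1) * (\<xi> ^ 3 + \<eta> * \<xi>\<^sup>2) + Ka * (\<xi> * \<eta> + \<eta> * \<eta>)"
        by (simp add: power2_eq_square power3_eq_cube algebra_simps)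
      also have "\<dots> \<le> (k + C1) * (2 * (\<eta> + \<xi> ^ 3)) + Ka * (2 * (\<eta> + \<xi> ^ 3))"
      proof (intro add_mono mult_left_mono)
        have "\<xi> ^ 3 \<ge> 0" using \<xi> by simp
        show "\<xi> ^ 3 + \<eta> * \<xi>\<^sup>2 \<le> 2 * (\<eta> + \<xi> ^ 3)" by (rule order_trans[OF add_left_mono[OF e1]]) (use \<open>\<xi> ^ 3 \<ge> 0\<close> \<eta> in simp)
        show "\<xi> * \<eta> + \<eta> * \<eta> \<le> 2 * (\<eta> + \<xi> ^ 3)" by (rule order_trans[OF add_mono[OF e2]]) (use \<open>\<xi> ^ 3 \<ge> 0\<close> \<eta> in simp)
      qed (use k C1(2) Ka(1) in auto)
      also have "\<dots> = (2 * k + 2 * C1 + 2 * Ka) * (\<eta> + \<xi> ^ 3)" by (simp add: algebra_simps)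
      finally show ?thesis unfolding mult.assoc by (rule mult_left_mono) (rule Km(1))
    qed
    finally have p1: "\<bar>(m (s, Y) - m0) * c\<bar> \<le> Km * (2 * k + 2 * C1 + 2 * Ka) * (\<eta> + \<xi> ^ 3)"
      by (simp only: mult.assoc)
    have "\<bar>m0 * (c - k * \<xi>\<^sup>2)\<bar> \<le> \<bar>m0\<bar> * (C1 * \<xi> ^ 3 + Ka * \<eta>)"
      unfolding abs_mult by (rule mult_left_mono[OF c1]) simp
    also have "\<dots> \<le> \<bar>m0\<bar> * ((C1 + Ka) * (\<eta> + \<xi> ^ 3))"
    proof (rule mult_left_mono)
      have "0 \<le> C1 * \<eta>" "0 \<le> Ka * \<xi> ^ 3" using C1(2) Ka(1) \<xi> \<eta> by auto
      then show "C1 * \<xi> ^ 3 + Ka * \<eta> \<le> (C1 + Ka) * (\<eta> + \<xi> ^ 3)" by (simp add: algebra_simps)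
    qed simp
    finally have p2: "\<bar>m0 * (c - k * \<xi>\<^sup>2)\<bar> \<le> \<bar>m0\<bar> * (C1 + Ka) * (\<eta> + \<xi> ^ 3)"
      by (simp only: mult.assoc)
    have "m (s, Y) * c - m0 * k * \<xi>\<^sup>2 = (m (s, Y) - m0) * c + m0 * (c - k * \<xi>\<^sup>2)"
      by (simp add: algebra_simps)
    then have "\<bar>m (s, Y) * c - m0 * k * \<xi>\<^sup>2\<bar> \<le> \<bar>(m (s, Y) - m0) * c\<bar> + \<bar>m0 * (c - k * \<xi>\<^sup>2)\<bar>"
      by (simp only: abs_triangle_ineq)
    also have "\<dots> \<le> K * (\<eta> + \<xi> ^ 3)"
      using add_mono[OF p1 p2] unfolding K_def by (simp only: distrib_right)
    finally show ?thesis unfolding xi2 c_def \<xi>_def \<eta>_def .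
  qed
  define L where "L = K + K1"
  have L: "L \<ge> 0" using K K1 by (simp add: L_def)
  show ?thesis
  proof (rule that[OF r(1), of "L + K2"])
    show "L + K2 \<ge> 0" using L K2 by simp
    fix X Y assume XB: "(X, Y) \<in> ?B" and XU: "(X, Y) \<in> closure U"
    define \<xi> where "\<xi> = \<bar>X - X0\<bar>"
    define \<eta> where "\<eta> = \<bar>Y - Y0\<bar>"
    have p0: "\<xi> \<ge> 0" "\<eta> \<ge> 0" by (auto simp: \<xi>_def \<eta>_def)
    have row: "\<bar>pd1 f (s, Y) - m0 * k * (s - X0)\<^sup>2\<bar> \<le> L * (\<eta> + \<xi> ^ 3)"
      if s: "s \<in> closed_segment X0 X" for s
    proof -
      have s_le: "\<bar>s - X0\<bar> \<le> \<xi>" using s by (auto simp: \<xi>_def closed_segment_eq_real_ivl split: if_splits)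
      have sB: "(s, Y) \<in> ?B" "(s, Y0) \<in> ?B" using s_le XB r(1) by (auto simp: mem_box_at \<xi>_def)
      have s3: "\<bar>s - X0\<bar> ^ 3 \<le> \<xi> ^ 3" by (rule power_mono[OF s_le]) simp
      have "\<bar>pd1 f (s, Y) - m0 * k * (s - X0)\<^sup>2\<bar> \<le> L * (\<eta> + \<bar>s - X0\<bar> ^ 3)"
      proof (cases "s \<le> X0")
        case True
        have "(s, Y0) \<in> closure U"
          by (rule closure_lower[OF Z0_closure]) (use True B(2)[OF sB(2)] in auto)
        then have "\<bar>pd1 f (s, Y0) - m0 * k * (s - X0)\<^sup>2\<bar> \<le> K * (\<bar>Y0 - Y0\<bar> + \<bar>s - X0\<bar> ^ 3)"
          using h[OF sB(2)] f1[OF B(1)[OF sB(2)]] by simp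
        moreover have "\<bar>pd1 f (s, Y) - pd1 f (s, Y0)\<bar> \<le> K1 * \<eta>" using K1(2)[OF sB(2,1)] by (simp add: \<eta>_def)
        moreover have "0 \<le> K * \<eta>" "0 \<le> K1 * \<bar>s - X0\<bar> ^ 3" using K K1(1) p0 by auto
        ultimately show ?thesis unfolding L_def by (simp add: algebra_simps)
      next
        case False
        then have "s \<le> X" using s by (auto simp: closed_segment_eq_real_ivl split: if_splits)
        then have "(s, Y) \<in> closure U"
          by (intro closure_lower[OF XU]) (use B(2)[OF sB(1)] in auto)
        then have "\<bar>pd1 f (s, Y) - m0 * k * (s - X0)\<^sup>2\<bar> \<le> K * (\<eta> + \<bar>s - X0\<bar> ^ 3)"
          using h[OF sB(1)] f1[OF B(1)[OF sB(1)]] by (simp add: \<eta>_def)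
        also have "\<dots> \<le> L * (\<eta> + \<bar>s - X0\<bar> ^ 3)"
          by (rule mult_right_mono) (use K1(1) p0 in \<open>auto simp: L_def\<close>)
        finally show ?thesis .
      qed
      also have "\<dots> \<le> L * (\<eta> + \<xi> ^ 3)" by (rule mult_left_mono) (use s3 L in auto)
      finally show ?thesis .
    qed
    have "\<bar>f (X, Y) - f (X0, Y) - m0 * k / real (Suc 2) * (X - X0) ^ Suc 2\<bar> \<le> L * (\<eta> + \<xi> ^ 3) * \<bar>X - X0\<bar>"
    proof (rule mvt_monomial[where g = "\<lambda>s. f (s, Y)" and g' = "\<lambda>s. pd1 f (s, Y)"])
      fix s assume s: "s \<in> closed_segment X0 X"
      then have "(s, Y) \<in> ?B" using XB by (auto simp: mem_box_at closed_segment_eq_real_ivl split: if_splits)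
      then show "((\<lambda>s. f (s, Y)) has_real_derivative pd1 f (s, Y)) (at s)"
        by (intro Ck_on_partials(1)[OF open_G C2_f B(1)])
      show "\<bar>pd1 f (s, Y) - m0 * k * (s - X0) ^ 2\<bar> \<le> L * (\<eta> + \<xi> ^ 3)" by (rule row[OF s])
    qed
    moreover have "m0 * k / real (Suc 2) * (X - X0) ^ Suc 2 = m0 * pd1 (pd1 a) (X0, Y0) / 12 * (X - X0) ^ 3"
      by (simp add: k_def numeral_3_eq_3)
    moreover have "L * (\<eta> + \<xi> ^ 3) * \<bar>X - X0\<bar> = L * (\<bar>(X - X0) * (Y - Y0)\<bar> + (X - X0) ^ 4)"
    proof -
      have "(X - X0) ^ 4 = \<xi> ^ 3 * \<xi>" unfolding \<xi>_def
        by (simp add: power4_eq_xxxx power3_eq_cube flip: abs_mult)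
      moreover have "\<bar>(X - X0) * (Y - Y0)\<bar> = \<xi> * \<eta>" by (simp only: \<xi>_def \<eta>_def abs_mult)
      ultimately show ?thesis unfolding \<xi>_def[symmetric] by (simp add: algebra_simps)
    qed
    ultimately have 1: "\<bar>f (X, Y) - f (X0, Y) - m0 * pd1 (pd1 a) (X0, Y0) / 12 * (X - X0) ^ 3\<bar>
        \<le> L * (\<bar>(X - X0) * (Y - Y0)\<bar> + (X - X0) ^ 4)" by metis
    have "\<bar>f (X0, Y) - f (X0, Y0) - pd2 f (X0, Y0) / real (Suc 0) * (Y - Y0) ^ Suc 0\<bar> \<le> K2 * \<eta> * \<bar>Y - Y0\<bar>"
    proof (rule mvt_monomial[where g = "\<lambda>s. f (X0, s)" and g' = "\<lambda>s. pd2 f (X0, s)"])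
      fix s assume s: "s \<in> closed_segment Y0 Y"
      then have s_le: "\<bar>s - Y0\<bar> \<le> \<eta>" by (auto simp: \<eta>_def closed_segment_eq_real_ivl split: if_splits)
      then have sB: "(X0, s) \<in> ?B" using XB by (auto simp: mem_box_at \<eta>_def)
      then show "((\<lambda>s. f (X0, s)) has_real_derivative pd2 f (X0, s)) (at s)"
        by (intro Ck_on_partials(2)[OF open_G C2_f B(1)])
      show "\<bar>pd2 f (X0, s) - pd2 f (X0, Y0) * (s - Y0) ^ 0\<bar> \<le> K2 * \<eta>"
        using K2(2)[OF Z0B sB] mult_left_mono[OF s_le K2(1)] by simp
    qed
    then have 2: "\<bar>f (X0, Y) - f (X0, Y0) - pd2 f (X0, Y0) * (Y - Y0)\<bar> \<le> K2 * (Y - Y0)\<^sup>2"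
      by (simp add: \<eta>_def power2_eq_square mult.assoc)
    have "0 \<le> K2 * (\<bar>(X - X0) * (Y - Y0)\<bar> + (X - X0) ^ 4)" "0 \<le> L * (Y - Y0)\<^sup>2" using K2(1) L by auto
    then show "\<bar>f (X, Y) - f (X0, Y0) - pd2 f (X0, Y0) * (Y - Y0)
         - m (X0, Y0) * pd1 (pd1 a) (X0, Y0) / 12 * (X - X0) ^ 3\<bar>
       \<le> (L + K2) * (\<bar>(X - X0) * (Y - Y0)\<bar> + (X - X0) ^ 4 + (Y - Y0)\<^sup>2)"
      using 1 2 unfolding m0_def by (simp only: distrib_left distrib_right)
  qed
qed

lemma linear_expansion:
  assumes C2_f: "Ck_on (Suc (Suc 0)) G f"
  obtains r C where "r > 0" "C \<ge> 0"
    "\<And>X Y. (X, Y) \<in> box_at (X0, Y0) r \<Longrightarrow>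
      \<bar>f (X, Y) - f (X0, Y0) - pd1 f (X0, Y0) * (X - X0)\<bar> \<le> C * ((X - X0)\<^sup>2 + \<bar>Y - Y0\<bar>)"
proof -
  obtain r where r: "r > 0" "box_at (X0, Y0) r \<subseteq> G" by (rule open_contains_box[OF open_G Z0_G])
  let ?B = "box_at (X0, Y0) r"
  obtain K1 where K1: "K1 \<ge> 0" "\<And>x y x' y'. (x, y) \<in> ?B \<Longrightarrow> (x', y') \<in> ?B \<Longrightarrow>
        \<bar>pd1 f (x', y') - pd1 f (x, y)\<bar> \<le> K1 * (\<bar>x' - x\<bar> + \<bar>y' - y\<bar>)"
    by (rule C1_lipschitz_box[OF open_G Ck_on_openD(2)[OF open_G C2_f] r(2)]) blast
  obtain K where K: "K \<ge> 0" "\<And>x y x' y'. (x, y) \<in> ?B \<Longrightarrow> (x', y') \<in> ?B \<Longrightarrow>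
        \<bar>f (x', y') - f (x, y)\<bar> \<le> K * (\<bar>x' - x\<bar> + \<bar>y' - y\<bar>)"
    by (rule C1_lipschitz_box[OF open_G C2_f r(2)]) blast
  have Z0B: "(X0, Y0) \<in> ?B" using r(1) by (simp add: mem_box_at)
  show ?thesis
  proof (rule that[OF r(1), of "K1 + K"])
    show "K1 + K \<ge> 0" using K K1 by simp
    fix X Y assume XB: "(X, Y) \<in> ?B"
    then have XB0: "(X, Y0) \<in> ?B" using r(1) by (simp add: mem_box_at)
    have "\<bar>f (X, Y0) - f (X0, Y0) - pd1 f (X0, Y0) / real (Suc 0) * (X - X0) ^ Suc 0\<bar> \<le> K1 * \<bar>X - X0\<bar> * \<bar>X - X0\<bar>"
    proof (rule mvt_monomial[where g = "\<lambda>s. f (s, Y0)" and g' = "\<lambda>s. pd1 f (s, Y0)"])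
      fix s assume s: "s \<in> closed_segment X0 X"
      then have s_le: "\<bar>s - X0\<bar> \<le> \<bar>X - X0\<bar>" by (auto simp: closed_segment_eq_real_ivl split: if_splits)
      then have sB: "(s, Y0) \<in> ?B" using XB0 by (auto simp: mem_box_at)
      then show "((\<lambda>s. f (s, Y0)) has_real_derivative pd1 f (s, Y0)) (at s)"
        using r(2) by (intro Ck_on_partials(1)[OF open_G C2_f]) auto
      show "\<bar>pd1 f (s, Y0) - pd1 f (X0, Y0) * (s - X0) ^ 0\<bar> \<le> K1 * \<bar>X - X0\<bar>"
        using K1(2)[OF Z0B sB] mult_left_mono[OF s_le K1(1)] by simp
    qed
    then have "\<bar>f (X, Y0) - f (X0, Y0) - pd1 f (X0, Y0) * (X - X0)\<bar> \<le> K1 * (X - X0)\<^sup>2"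
      by (simp add: power2_eq_square mult.assoc)
    moreover have "\<bar>f (X, Y) - f (X, Y0)\<bar> \<le> K * \<bar>Y - Y0\<bar>" using K(2)[OF XB0 XB] by simp
    moreover have "0 \<le> K1 * \<bar>Y - Y0\<bar>" "0 \<le> K * (X - X0)\<^sup>2" using K(1) K1(1) by auto
    ultimately show "\<bar>f (X, Y) - f (X0, Y0) - pd1 f (X0, Y0) * (X - X0)\<bar>
        \<le> (K1 + K) * ((X - X0)\<^sup>2 + \<bar>Y - Y0\<bar>)"
      by (simp only: distrib_left distrib_right)
  qed
qed

text \<open>As \<open>x\<^sub>Y = - c t\<^sub>Y\<close>, the combination \<open>c (t - T) + (x - x\<^sup>*)\<close> is free of \<open>Y - Y0\<close> to first order, and determines \<open>X - X0\<close> by a cube root.\<close>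

lemma singular_expansion:
  assumes a: "a (X0, Y0) = - pi" and G': "open G'" "(X0, Y0) \<in> G'" "Ck_on 3 G' a"
    and C2_f: "Ck_on (Suc (Suc 0)) G f"
  obtains r C where "r > 0" "C \<ge> 0"
    "\<And>z d. \<lbrakk>z \<in> box_at (X0, Y0) r; z \<in> closure U; d = \<bar>t z - T\<bar> + \<bar>x z - x (X0, Y0)\<bar>; d \<le> 1\<rbrakk> \<Longrightarrow>
      \<bar>f z - f (X0, Y0) - pd1 f (X0, Y0) * root 3
        ((1 / (2 * w (X0, Y0)) * (t z - T) + (x z - x (X0, Y0))) / (p (X0, Y0) * pd1 (pd1 a) (X0, Y0) / 12))\<bar>
       \<le> C * d powr (4 / 9)"
proof -
  define p0 where "p0 = p (X0, Y0)"
  define w0 where "w0 = w (X0, Y0)"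
  define k where "k = pd1 (pd1 a) (X0, Y0)"
  define c0 where "c0 = 1 / (2 * w0)"
  define \<kappa> where "\<kappa> = pd2 t (X0, Y0)"
  define A where "A = p0 * k / 12"
  have pos: "p0 > 0" "w0 > 0" "k > 0" "q (X0, Y0) > 0"
    using p_pos[OF a] w_pos[OF Z0_G] singular_type1(3)[OF a] q_pos[OF a] by (auto simp: p0_def w0_def k_def)
  have A: "A > 0" using pos by (simp add: A_def)
  have c0: "c0 > 0" using pos by (simp add: c0_def)
  have b: "cos (b (X0, Y0) / 2) > 0"
    by (rule cos_gt_zero_pi)
      (use closure_system(7)[OF Z0_G Z0_closure] singular_type1(2)[OF a] b_Z0 in linarith)+
  have \<kappa>: "\<kappa> > 0" "pd2 x (X0, Y0) = - c0 * \<kappa>"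
    using closure_system(2)[OF Z0_G Z0_closure] closure_system_x(2)[OF Z0_G Z0_closure] pos b
    by (auto simp: \<kappa>_def c0_def w0_def)
  obtain r1 C1 where C1: "r1 > 0" "C1 \<ge> 0"
    "\<And>X Y. (X, Y) \<in> box_at (X0, Y0) r1 \<Longrightarrow> (X, Y) \<in> closure U \<Longrightarrow>
      \<bar>t (X, Y) - t (X0, Y0) - pd2 t (X0, Y0) * (Y - Y0)
         - w (X0, Y0) * p (X0, Y0) * pd1 (pd1 a) (X0, Y0) / 12 * (X - X0) ^ 3\<bar>
       \<le> C1 * (\<bar>(X - X0) * (Y - Y0)\<bar> + (X - X0) ^ 4 + (Y - Y0)\<^sup>2)"
    by (rule cubic_expansion[OF a G' C2_t Ck_on_mult[OF C1_w C1_p]]) (use closure_system(1) in auto)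
  obtain r2 C2 where C2: "r2 > 0" "C2 \<ge> 0"
    "\<And>X Y. (X, Y) \<in> box_at (X0, Y0) r2 \<Longrightarrow> (X, Y) \<in> closure U \<Longrightarrow>
      \<bar>x (X, Y) - x (X0, Y0) - pd2 x (X0, Y0) * (Y - Y0)
         - (1 / 2) * p (X0, Y0) * pd1 (pd1 a) (X0, Y0) / 12 * (X - X0) ^ 3\<bar>
       \<le> C2 * (\<bar>(X - X0) * (Y - Y0)\<bar> + (X - X0) ^ 4 + (Y - Y0)\<^sup>2)"
    by (rule cubic_expansion[OF a G' C2_x Ck_on_mult[OF Ck_on_const[of _ _ "1 / 2"] C1_p]]) (use closure_system_x(1) in auto)
  obtain r3 C3 where C3: "r3 > 0" "C3 \<ge> 0"
    "\<And>X Y. (X, Y) \<in> box_at (X0, Y0) r3 \<Longrightarrow>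
      \<bar>f (X, Y) - f (X0, Y0) - pd1 f (X0, Y0) * (X - X0)\<bar> \<le> C3 * ((X - X0)\<^sup>2 + \<bar>Y - Y0\<bar>)"
    by (rule linear_expansion[OF C2_f]) blast
  define C where "C = (c0 + 1) * (C1 + C2)"
  have C: "C \<ge> 0" "C1 \<le> C" "c0 * C1 + C2 \<le> C"
    using c0 C1(2) C2(2) by (auto simp: C_def algebra_simps)
  obtain \<rho> M where \<rho>: "\<rho> > 0" and M: "M \<ge> 0" and est:
    "\<And>\<xi> \<eta> dt dx d. \<lbrakk>\<bar>\<xi>\<bar> \<le> \<rho>; \<bar>\<eta>\<bar> \<le> \<rho>; d = \<bar>dt\<bar> + \<bar>dx\<bar>; d \<le> 1;
       \<bar>dt - \<kappa> * \<eta> - w0 * p0 * k / 12 * \<xi> ^ 3\<bar> \<le> C * (\<bar>\<xi> * \<eta>\<bar> + \<xi> ^ 4 + \<eta>\<^sup>2);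
       \<bar>c0 * dt + dx - A * \<xi> ^ 3\<bar> \<le> C * (\<bar>\<xi> * \<eta>\<bar> + \<xi> ^ 4 + \<eta>\<^sup>2)\<rbrakk> \<Longrightarrow>
       \<bar>\<xi> - root 3 ((c0 * dt + dx) / A)\<bar> \<le> M * d powr (4 / 9) \<and> \<xi>\<^sup>2 + \<bar>\<eta>\<bar> \<le> M * d powr (4 / 9)"
    by (rule cube_root_estimate[OF \<kappa>(1) A C(1)]) blast
  define r where "r = min (min r1 r2) (min r3 \<rho>)"
  have r: "r > 0" "r \<le> r1" "r \<le> r2" "r \<le> r3" "r \<le> \<rho>" using C1(1) C2(1) C3(1) \<rho> by (auto simp: r_def)
  define \<sigma> where "\<sigma> = pd1 f (X0, Y0)"
  show ?thesis
  proof (rule that[OF r(1), of "C3 * M + \<bar>\<sigma>\<bar> * M"])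
    show "0 \<le> C3 * M + \<bar>\<sigma>\<bar> * M" using C3(2) M by simp
    fix z d assume z: "z \<in> box_at (X0, Y0) r" "z \<in> closure U" "d = \<bar>t z - T\<bar> + \<bar>x z - x (X0, Y0)\<bar>" "d \<le> 1"
    obtain X Y where zXY: "z = (X, Y)" by (cases z)
    define \<xi> where "\<xi> = X - X0"
    define \<eta> where "\<eta> = Y - Y0"
    define dt where "dt = t (X, Y) - T"
    define dx where "dx = x (X, Y) - x (X0, Y0)"
    define R where "R = \<bar>\<xi> * \<eta>\<bar> + \<xi> ^ 4 + \<eta>\<^sup>2"
    have R: "R \<ge> 0" by (simp add: R_def)
    have small: "\<bar>\<xi>\<bar> \<le> \<rho>" "\<bar>\<eta>\<bar> \<le> \<rho>" using z(1) r(5) by (auto simp: zXY mem_box_at \<xi>_def \<eta>_def)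
    have t_est: "\<bar>dt - \<kappa> * \<eta> - w0 * p0 * k / 12 * \<xi> ^ 3\<bar> \<le> C1 * R"
      using C1(3)[of X Y] z(1,2) box_at_mono[OF r(2)] t_Z0
      by (auto simp: zXY R_def dt_def \<kappa>_def \<eta>_def \<xi>_def w0_def p0_def k_def)
    have x_est: "\<bar>dx + c0 * \<kappa> * \<eta> - A / 2 * \<xi> ^ 3\<bar> \<le> C2 * R"
      using C2(3)[of X Y] z(1,2) box_at_mono[OF r(3)] \<kappa>(2)
      by (auto simp: zXY R_def dx_def \<eta>_def \<xi>_def p0_def k_def A_def)
    have f_est: "\<bar>f (X, Y) - f (X0, Y0) - \<sigma> * \<xi>\<bar> \<le> C3 * (\<xi>\<^sup>2 + \<bar>\<eta>\<bar>)"
      using C3(3)[of X Y] z(1) box_at_mono[OF r(4)] by (auto simp: zXY \<sigma>_def \<eta>_def \<xi>_def)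
    have "c0 * (w0 * p0 * k / 12) = A / 2" using pos by (simp add: c0_def A_def field_simps)
    then have "c0 * (w0 * p0 * k / 12 * \<xi> ^ 3) = A / 2 * \<xi> ^ 3"
      by (simp only: mult.assoc[of c0, symmetric])
    then have "c0 * dt + dx - A * \<xi> ^ 3 = c0 * (dt - \<kappa> * \<eta> - w0 * p0 * k / 12 * \<xi> ^ 3) + (dx + c0 * \<kappa> * \<eta> - A / 2 * \<xi> ^ 3)"
      unfolding right_diff_distrib mult.assoc[of c0 \<kappa> \<eta>] by linarith
    then have "\<bar>c0 * dt + dx - A * \<xi> ^ 3\<bar> \<le> \<bar>c0 * (dt - \<kappa> * \<eta> - w0 * p0 * k / 12 * \<xi> ^ 3)\<bar> + \<bar>dx + c0 * \<kappa> * \<eta> - A / 2 * \<xi> ^ 3\<bar>"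
      by (simp only: abs_triangle_ineq)
    also have "\<dots> \<le> c0 * (C1 * R) + C2 * R"
      using mult_left_mono[OF t_est less_imp_le[OF c0]] x_est
      unfolding abs_mult[of c0] abs_of_pos[OF c0] by linarith
    also have "\<dots> \<le> C * R" using mult_right_mono[OF C(3) R] by (simp add: algebra_simps)
    finally have q_est: "\<bar>c0 * dt + dx - A * \<xi> ^ 3\<bar> \<le> C * (\<bar>\<xi> * \<eta>\<bar> + \<xi> ^ 4 + \<eta>\<^sup>2)" by (simp only: R_def)
    have t_est': "\<bar>dt - \<kappa> * \<eta> - w0 * p0 * k / 12 * \<xi> ^ 3\<bar> \<le> C * (\<bar>\<xi> * \<eta>\<bar> + \<xi> ^ 4 + \<eta>\<^sup>2)"
      using t_est mult_right_mono[OF C(2) R] unfolding R_def by linarith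
    have d: "d = \<bar>dt\<bar> + \<bar>dx\<bar>" using z(3) by (simp add: zXY dt_def dx_def)
    define \<theta> where "\<theta> = root 3 ((c0 * dt + dx) / A)"
    have e: "\<bar>\<xi> - \<theta>\<bar> \<le> M * d powr (4 / 9)" "\<xi>\<^sup>2 + \<bar>\<eta>\<bar> \<le> M * d powr (4 / 9)"
      using est[OF small d z(4) t_est' q_est] by (auto simp: \<theta>_def)
    have "\<bar>f (X, Y) - f (X0, Y0) - \<sigma> * \<theta>\<bar> \<le> \<bar>f (X, Y) - f (X0, Y0) - \<sigma> * \<xi>\<bar> + \<bar>\<sigma> * (\<xi> - \<theta>)\<bar>"
      unfolding right_diff_distrib by linarith
    also have "\<dots> \<le> C3 * (M * d powr (4 / 9)) + \<bar>\<sigma>\<bar> * (M * d powr (4 / 9))"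
      using f_est mult_left_mono[OF e(2) C3(2)] mult_left_mono[OF e(1), of "\<bar>\<sigma>\<bar>"] by (simp add: abs_mult)
    finally show "\<bar>f z - f (X0, Y0) - pd1 f (X0, Y0) * root 3
        ((1 / (2 * w (X0, Y0)) * (t z - T) + (x z - x (X0, Y0))) / (p (X0, Y0) * pd1 (pd1 a) (X0, Y0) / 12))\<bar>
       \<le> (C3 * M + \<bar>\<sigma>\<bar> * M) * d powr (4 / 9)"
      by (simp add: zXY \<theta>_def \<sigma>_def c0_def w0_def dt_def dx_def A_def p0_def k_def algebra_simps)
  qed
qed

end

section \<open>Riemann invariants and wave speed before the blow-up\<close>

text \<open>The classical solution up to time \<open>T\<close>, with initial data \<open>\<bar>u\<bar> \<le> B\<close> and \<open>\<tau> \<ge> m0\<close>. The value \<open>H \<sigma> z\<close> is the foot, at time zero, of some characteristic of speed \<open>\<sigma> c\<close> through \<open>z\<close>. Before \<open>T\<close> it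
  turns out to be unique.\<close>

locale euler_flow =
  fixes \<gamma> T B m0 :: real and \<tau> u :: "real \<times> real \<Rightarrow> real" and H :: "real \<Rightarrow> real \<times> real \<Rightarrow> real"
  assumes \<gamma>: "\<gamma> > 1" and T_pos: "T > 0"
    and tau_pos: "\<And>z. z \<in> UNIV \<times> {0..T} \<Longrightarrow> \<tau> z > 0"
    and cont_tau: "continuous_on (UNIV \<times> {0..T}) \<tau>" and cont_u: "continuous_on (UNIV \<times> {0..T}) u"
    and C1_tau: "Ck_on (Suc 0) (UNIV \<times> {0..<T}) \<tau>" and C1_u: "Ck_on (Suc 0) (UNIV \<times> {0..<T}) u"
    and pde: "\<And>z. z \<in> UNIV \<times> {0<..<T} \<Longrightarrow>
       pd2 \<tau> z - pd1 u z = 0 \<and> pd2 u z + pd1 (\<lambda>w. 1 / \<gamma> * \<tau> w powr (- \<gamma>)) z = 0"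
    and grad_bdd: "\<And>T'. 0 \<le> T' \<Longrightarrow> T' < T \<Longrightarrow>
        bounded (grad_R \<gamma> \<tau> u ` (UNIV \<times> {0..T'})) \<and> bounded (grad_S \<gamma> \<tau> u ` (UNIV \<times> {0..T'}))"
    and u0_bdd: "\<And>x. \<bar>u (x, 0)\<bar> \<le> B" and m0: "m0 > 0" and tau0: "\<And>x. m0 \<le> \<tau> (x, 0)"
    and feet: "\<And>\<sigma> z. \<sigma> = 1 \<or> \<sigma> = - 1 \<Longrightarrow> z \<in> UNIV \<times> {0..T} \<Longrightarrow>
        \<exists>\<xi>. is_characteristic \<gamma> \<tau> \<sigma> z \<xi> \<and> H \<sigma> z = \<xi> 0"
begin

abbreviation c :: "real \<times> real \<Rightarrow> real" where "c z \<equiv> sound_speed \<gamma> (\<tau> z)"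

lemma c_pos: "z \<in> UNIV \<times> {0..T} \<Longrightarrow> c z > 0"
  using tau_pos[of z] by (simp add: sound_speed_def)

lemma cont_c: "continuous_on (UNIV \<times> {0..T}) c"
  unfolding sound_speed_def
  by (rule continuous_on_powr[OF cont_tau continuous_on_const]) (use tau_pos in \<open>metis less_irrefl\<close>)

text \<open>The \<open>\<sigma>\<close>-characteristics carry the invariant \<open>inv \<sigma>\<close>; \<open>\<sigma> = 1\<close> gives \<open>riemann_plus\<close>.\<close>

definition inv :: "real \<Rightarrow> real \<times> real \<Rightarrow> real" where
  "inv \<sigma> z = u z + \<sigma> * (2 / (\<gamma> - 1) * \<tau> z powr (- (\<gamma> - 1) / 2))"

lemma cont_inv: "continuous_on (UNIV \<times> {0..T}) (inv \<sigma>)"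
proof -
  have "continuous_on (UNIV \<times> {0..T}) (\<lambda>z. \<tau> z powr (- (\<gamma> - 1) / 2))"
    by (rule continuous_on_powr[OF cont_tau continuous_on_const]) (use tau_pos in \<open>metis less_irrefl\<close>)
  then show ?thesis unfolding inv_def
    by (intro continuous_on_add continuous_on_mult continuous_on_const cont_u)
qed

lemma interior_has_derivative:
  assumes "Ck_on (Suc 0) (UNIV \<times> {0..<T}) f" "z \<in> UNIV \<times> {0<..<T}"
  shows "(f has_derivative (\<lambda>v. pd1 f z * fst v + pd2 f z * snd v)) (at z)"
proof -
  have "Ck_on (Suc 0) (UNIV \<times> {0<..<T}) f"
    by (rule Ck_on_subset[OF assms(1)]) auto
  then show ?thesis
    by (intro Ck_on_openD(1)[OF _ _ assms(2)]) (auto intro: open_Times)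
qed

lemma slice_derivative:
  assumes "Ck_on (Suc 0) (UNIV \<times> {0..<T}) f" "0 \<le> t" "t < T"
  shows "((\<lambda>s. f (s, t)) has_real_derivative pd1 f (x, t)) (at x)"
proof -
  obtain g h where gh: "\<And>z. z \<in> UNIV \<times> {0..<T} \<Longrightarrow>
      (f has_derivative (\<lambda>v. g z * fst v + h z * snd v)) (at z within UNIV \<times> {0..<T})"
    using Ck_on_SucE[OF assms(1)] by metis
  have "((\<lambda>s. f (s, snd (x, t))) has_real_derivative g (x, t)) (at (fst (x, t)))"
    by (rule has_pd1[OF gh open_UNIV]) (use assms in auto)
  then have "((\<lambda>s. f (s, t)) has_real_derivative g (x, t)) (at x)" by simp
  moreover from this have "pd1 f (x, t) = g (x, t)" by (simp add: pd1_def DERIV_imp_deriv)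
  ultimately show ?thesis by simp
qed

lemma inv_derivative:
  assumes z: "z \<in> UNIV \<times> {0<..<T}" and \<sigma>: "\<sigma> = 1 \<or> \<sigma> = - 1"
  shows "(inv \<sigma> has_derivative (\<lambda>v. (pd1 u z - \<sigma> * c z * pd1 \<tau> z) * (fst v - \<sigma> * c z * snd v))) (at z)"
proof -
  have pos: "\<tau> z > 0" using tau_pos z by auto
  note dtau = interior_has_derivative[OF C1_tau z] and du = interior_has_derivative[OF C1_u z]
  have powr_deriv: "((\<lambda>w. \<tau> w powr e) has_derivative
      (\<lambda>v. e * \<tau> z powr (e - 1) * (pd1 \<tau> z * fst v + pd2 \<tau> z * snd v))) (at z)" for e
  proof -
    have "((\<lambda>y. y powr e) has_real_derivative e * \<tau> z powr (e - 1)) (at (\<tau> z))"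
      by (rule has_real_derivative_powr[OF pos])
    from has_derivative_compose[OF dtau this[unfolded has_field_derivative_def]]
    show ?thesis by simp
  qed
  have "((\<lambda>w. 1 / \<gamma> * \<tau> w powr (- \<gamma>)) has_derivative (\<lambda>v. 1 / \<gamma> * (- \<gamma> * \<tau> z powr (- \<gamma> - 1) * (pd1 \<tau> z * fst v + pd2 \<tau> z * snd v)))) (at z)"
    by (rule has_derivative_mult_right[OF powr_deriv])
  then have "((\<lambda>w. 1 / \<gamma> * \<tau> w powr (- \<gamma>)) has_derivative
      (\<lambda>v. (- (\<tau> z powr (- \<gamma> - 1)) * pd1 \<tau> z) * fst v + (- (\<tau> z powr (- \<gamma> - 1)) * pd2 \<tau> z) * snd v)) (at z)"
    by (rule has_derivative_eq_rhs) (use \<gamma> in \<open>simp add: fun_eq_iff algebra_simps\<close>)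
  from pd_of_has_derivative(3)[OF this]
  have "pd1 (\<lambda>w. 1 / \<gamma> * \<tau> w powr (- \<gamma>)) z = - (\<tau> z powr (- \<gamma> - 1)) * pd1 \<tau> z" .
  moreover have "\<tau> z powr (- \<gamma> - 1) = c z * c z"
  proof -
    have "- \<gamma> - 1 = - (\<gamma> + 1) / 2 + - (\<gamma> + 1) / 2" by (simp add: field_simps)
    then show ?thesis unfolding sound_speed_def by (simp only: powr_add)
  qed
  ultimately have ut: "pd2 u z = c z * c z * pd1 \<tau> z" and tt: "pd2 \<tau> z = pd1 u z"
    using pde[OF z] by auto
  have "(inv \<sigma> has_derivative (\<lambda>v. (pd1 u z * fst v + pd2 u z * snd v) + \<sigma> * (2 / (\<gamma> - 1) *
      ((- (\<gamma> - 1) / 2) * \<tau> z powr ((- (\<gamma> - 1) / 2) - 1) * (pd1 \<tau> z * fst v + pd2 \<tau> z * snd v))))) (at z)"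
    unfolding inv_def
    by (intro has_derivative_add du has_derivative_mult_right powr_deriv)
  then show ?thesis
  proof (rule has_derivative_eq_rhs, intro ext)
    fix v :: "real \<times> real"
    have e: "\<tau> z powr ((- (\<gamma> - 1) / 2) - 1) = c z"
      unfolding sound_speed_def by (rule arg_cong[where f = "\<lambda>e. \<tau> z powr e"]) (simp add: field_simps)
    have e2: "2 / (\<gamma> - 1) * ((- (\<gamma> - 1) / 2) * C * D) = - C * D" for C D :: real
      using \<gamma> by (simp add: field_simps)
    have ss: "\<sigma> * \<sigma> = 1" using \<sigma> by auto
    show "(pd1 u z * fst v + pd2 u z * snd v) + \<sigma> * (2 / (\<gamma> - 1) *
      ((- (\<gamma> - 1) / 2) * \<tau> z powr ((- (\<gamma> - 1) / 2) - 1) * (pd1 \<tau> z * fst v + pd2 \<tau> z * snd v)))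
      = (pd1 u z - \<sigma> * c z * pd1 \<tau> z) * (fst v - \<sigma> * c z * snd v)"
      unfolding e e2 ut tt using \<sigma> by (elim disjE) (simp_all add: algebra_simps)
  qed
qed

lemma char_continuous:
  assumes "is_characteristic \<gamma> \<tau> \<sigma> z \<xi>"
  shows "continuous_on {0..snd z} \<xi>"
  using assms unfolding is_characteristic_def continuous_on_eq_continuous_within
  by (meson DERIV_continuous)

lemma char_derivative:
  assumes "is_characteristic \<gamma> \<tau> \<sigma> z \<xi>" "0 < s" "s < snd z"
  shows "(\<xi> has_real_derivative \<sigma> * c (\<xi> s, s)) (at s)"
proof -
  have "(\<xi> has_real_derivative \<sigma> * c (\<xi> s, s)) (at s within {0..snd z})"
    using assms unfolding is_characteristic_def by auto
  moreover have "at s within {0..snd z} = at s"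
    by (rule at_within_interior) (use assms in simp)
  ultimately show ?thesis by simp
qed

lemma char_restrict:
  assumes "is_characteristic \<gamma> \<tau> \<sigma> z \<xi>" "0 \<le> s" "s \<le> snd z"
  shows "is_characteristic \<gamma> \<tau> \<sigma> (\<xi> s, s) \<xi>"
  unfolding is_characteristic_def
proof (intro conjI ballI)
  fix r assume r: "r \<in> {0..snd (\<xi> s, s)}"
  then have "(\<xi> has_real_derivative \<sigma> * c (\<xi> r, r)) (at r within {0..snd z})"
    using assms unfolding is_characteristic_def by auto
  then show "(\<xi> has_real_derivative \<sigma> * c (\<xi> r, r)) (at r within {0..snd (\<xi> s, s)})"
    by (rule has_field_derivative_subset) (use assms in auto)
qed simp

lemma inv_constant:
  assumes \<xi>: "is_characteristic \<gamma> \<tau> \<sigma> z \<xi>" and z: "z \<in> UNIV \<times> {0..<T}" and \<sigma>: "\<sigma> = 1 \<or> \<sigma> = - 1"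
  shows "inv \<sigma> z = inv \<sigma> (\<xi> 0, 0)"
proof (cases "snd z = 0")
  case True
  then show ?thesis using \<xi> by (cases z) (simp add: is_characteristic_def)
next
  case False
  then have t: "0 < snd z" "snd z < T" using z by auto
  have "(\<lambda>s. inv \<sigma> (\<xi> s, s)) (snd z) = (\<lambda>s. inv \<sigma> (\<xi> s, s)) 0"
  proof (rule DERIV_isconst_end[OF t(1)])
    show "continuous_on {0..snd z} (\<lambda>s. inv \<sigma> (\<xi> s, s))"
      by (rule continuous_on_compose2[OF cont_inv continuous_on_Pair[OF char_continuous[OF \<xi>] continuous_on_id]])
        (use t in auto)
    fix s assume s: "0 < s" "s < snd z"
    then have zs: "(\<xi> s, s) \<in> UNIV \<times> {0<..<T}" using t by auto
    have "((\<lambda>s. (\<xi> s, s)) has_derivative (\<lambda>v. (\<sigma> * c (\<xi> s, s) * v, v))) (at s)"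
      by (rule has_derivative_Pair[OF char_derivative[OF \<xi> s, unfolded has_field_derivative_def] has_derivative_ident])
    from has_derivative_compose[OF this inv_derivative[OF zs \<sigma>]]
    have "((\<lambda>s. inv \<sigma> (\<xi> s, s)) has_derivative (\<lambda>v. 0 * v)) (at s)" by simp
    then show "((\<lambda>s. inv \<sigma> (\<xi> s, s)) has_real_derivative 0) (at s)"
      by (simp only: has_field_derivative_def)
  qed
  moreover have "\<xi> (snd z) = fst z" using \<xi> by (simp add: is_characteristic_def)
  ultimately show ?thesis by simp
qed

text \<open>The difference of the two Riemann invariants is a negative power of \<open>\<tau>\<close>, and the invariants are bounded by their
  initial values. So \<open>\<tau>\<close> stays away from zero.\<close>

lemma powr_bound: "\<exists>K. \<forall>z \<in> UNIV \<times> {0..<T}. \<tau> z powr (- (\<gamma> - 1) / 2) \<le> K"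
proof -
  let ?v = "\<lambda>z. 2 / (\<gamma> - 1) * \<tau> z powr (- (\<gamma> - 1) / 2)"
  define K0 where "K0 = B + 2 / (\<gamma> - 1) * m0 powr (- (\<gamma> - 1) / 2)"
  have init: "\<bar>inv \<sigma> (x, 0)\<bar> \<le> K0" if "\<sigma> = 1 \<or> \<sigma> = - 1" for \<sigma> x
  proof -
    have "\<tau> (x, 0) powr (- (\<gamma> - 1) / 2) \<le> m0 powr (- (\<gamma> - 1) / 2)"
      by (rule powr_mono2') (use \<gamma> m0 tau0 in auto)
    then have "?v (x, 0) \<le> 2 / (\<gamma> - 1) * m0 powr (- (\<gamma> - 1) / 2)"
      by (rule mult_left_mono) (use \<gamma> in simp)
    moreover have "?v (x, 0) \<ge> 0" using \<gamma> by simp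
    ultimately show ?thesis using u0_bdd[of x] that unfolding K0_def inv_def by (elim disjE) auto
  qed
  have "\<tau> z powr (- (\<gamma> - 1) / 2) \<le> K0 * (\<gamma> - 1) / 2" if z: "z \<in> UNIV \<times> {0..<T}" for z
  proof -
    have zz: "z \<in> UNIV \<times> {0..T}" using z by auto
    obtain \<xi> \<eta> where ch: "is_characteristic \<gamma> \<tau> 1 z \<xi>" "is_characteristic \<gamma> \<tau> (- 1) z \<eta>"
      using feet[of 1 z] feet[of "- 1" z] zz by auto
    have "\<bar>inv 1 z\<bar> \<le> K0" "\<bar>inv (- 1) z\<bar> \<le> K0"
      using inv_constant[OF ch(1) z] inv_constant[OF ch(2) z] init by auto
    moreover have "inv 1 z - inv (- 1) z = 2 * ?v z" by (simp add: inv_def)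
    ultimately have "?v z \<le> K0" by linarith
    then show ?thesis using \<gamma> by (simp add: field_simps)
  qed
  then show ?thesis by blast
qed

lemma c_bounded: "\<exists>M>0. \<forall>z \<in> UNIV \<times> {0..<T}. c z \<le> M"
proof -
  obtain K where K: "\<And>z. z \<in> UNIV \<times> {0..<T} \<Longrightarrow> \<tau> z powr (- (\<gamma> - 1) / 2) \<le> K" using powr_bound by blast
  have "c z \<le> K powr ((\<gamma> + 1) / (\<gamma> - 1))" if z: "z \<in> UNIV \<times> {0..<T}" for z
  proof -
    have "c z = (\<tau> z powr (- (\<gamma> - 1) / 2)) powr ((\<gamma> + 1) / (\<gamma> - 1))"
      unfolding sound_speed_def powr_powr
      by (rule arg_cong[where f = "\<lambda>e. \<tau> z powr e"]) (use \<gamma> in \<open>simp add: field_simps\<close>)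
    also have "\<dots> \<le> K powr ((\<gamma> + 1) / (\<gamma> - 1))"
      by (rule powr_mono2) (use \<gamma> K[OF z] in auto)
    finally show ?thesis .
  qed
  moreover have "K powr ((\<gamma> + 1) / (\<gamma> - 1)) + 1 > 0" by (simp add: add_nonneg_pos)
  ultimately show ?thesis
    by (intro exI[of _ "K powr ((\<gamma> + 1) / (\<gamma> - 1)) + 1"]) (smt (verit))
qed

text \<open>The derivative \<open>c\<^sub>x\<close> is a multiple of \<open>(R - S) / \<tau>\<close>, and \<open>R\<close> and \<open>S\<close> are bounded on earlier strips.\<close>

lemma c_lipschitz:
  assumes "0 \<le> T'" "T' < T"
  shows "\<exists>L\<ge>0. \<forall>t\<in>{0..T'}. \<forall>x y. \<bar>c (x, t) - c (y, t)\<bar> \<le> L * \<bar>x - y\<bar>"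
proof -
  obtain K where K: "\<And>z. z \<in> UNIV \<times> {0..<T} \<Longrightarrow> \<tau> z powr (- (\<gamma> - 1) / 2) \<le> K" using powr_bound by blast
  obtain KR where KR: "\<And>z. z \<in> UNIV \<times> {0..T'} \<Longrightarrow> \<bar>grad_R \<gamma> \<tau> u z\<bar> \<le> KR"
    using grad_bdd[OF assms] unfolding bounded_iff by (metis image_eqI real_norm_def)
  obtain KS where KS: "\<And>z. z \<in> UNIV \<times> {0..T'} \<Longrightarrow> \<bar>grad_S \<gamma> \<tau> u z\<bar> \<le> KS"
    using grad_bdd[OF assms] unfolding bounded_iff by (metis image_eqI real_norm_def)
  define N where "N = K powr (2 / (\<gamma> - 1))"
  define L where "L = (\<gamma> + 1) / 4 * (N * (KR + KS))"
  have dc: "((\<lambda>s. c (s, t)) has_real_derivative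
      - ((\<gamma> + 1) / 4) * (inverse (\<tau> (x, t)) * (grad_R \<gamma> \<tau> u (x, t) - grad_S \<gamma> \<tau> u (x, t)))) (at x)"
    and bd: "\<bar>- ((\<gamma> + 1) / 4) * (inverse (\<tau> (x, t)) * (grad_R \<gamma> \<tau> u (x, t) - grad_S \<gamma> \<tau> u (x, t)))\<bar> \<le> L"
    if t: "t \<in> {0..T'}" for x t
  proof -
    have z: "(x, t) \<in> UNIV \<times> {0..<T}" "(x, t) \<in> UNIV \<times> {0..T}" "(x, t) \<in> UNIV \<times> {0..T'}" "0 \<le> t" "t < T"
      using t assms by auto
    have pos: "\<tau> (x, t) > 0" using tau_pos z by blast
    have d: "((\<lambda>s. c (s, t)) has_real_derivative
        (- (\<gamma> + 1) / 2) * \<tau> (x, t) powr ((- (\<gamma> + 1) / 2) - 1) * pd1 \<tau> (x, t)) (at x)"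
      unfolding sound_speed_def
      by (rule DERIV_chain2[OF has_real_derivative_powr[OF pos] slice_derivative[OF C1_tau z(4,5)]])
    have e1: "\<tau> (x, t) powr ((- (\<gamma> + 1) / 2) - 1) = c (x, t) * inverse (\<tau> (x, t))"
    proof -
      have "\<tau> (x, t) powr (e - 1) = \<tau> (x, t) powr e * inverse (\<tau> (x, t))" for e
        using pos by (simp add: powr_diff divide_inverse)
      then show ?thesis unfolding sound_speed_def .
    qed
    have e2: "grad_R \<gamma> \<tau> u (x, t) - grad_S \<gamma> \<tau> u (x, t) = 2 * (c (x, t) * pd1 \<tau> (x, t))"
      by (simp add: grad_R_def grad_S_def)
    have e3: "(- (g + 1) / 2) * (C * I) * P = - ((g + 1) / 4) * (I * (2 * (C * P)))" for g C I P :: real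
      by (simp add: field_simps)
    show "((\<lambda>s. c (s, t)) has_real_derivative
      - ((\<gamma> + 1) / 4) * (inverse (\<tau> (x, t)) * (grad_R \<gamma> \<tau> u (x, t) - grad_S \<gamma> \<tau> u (x, t)))) (at x)"
      by (rule DERIV_cong[OF d]) (unfold e1 e2, rule e3)
    have "inverse (\<tau> (x, t)) = (\<tau> (x, t) powr (- (\<gamma> - 1) / 2)) powr (2 / (\<gamma> - 1))"
    proof -
      have "(- (\<gamma> - 1) / 2) * (2 / (\<gamma> - 1)) = - 1" using \<gamma> by (simp add: field_simps)
      then show ?thesis unfolding powr_powr using pos by (simp add: powr_minus)
    qed
    also have "\<dots> \<le> N" unfolding N_def by (rule powr_mono2) (use \<gamma> K[OF z(1)] in auto)
    finally have inv_le: "inverse (\<tau> (x, t)) \<le> N" .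
    have "\<bar>inverse (\<tau> (x, t)) * (grad_R \<gamma> \<tau> u (x, t) - grad_S \<gamma> \<tau> u (x, t))\<bar> \<le> N * (KR + KS)"
      unfolding abs_mult
    proof (rule mult_mono)
      show "\<bar>inverse (\<tau> (x, t))\<bar> \<le> N" using inv_le pos by simp
      show "\<bar>grad_R \<gamma> \<tau> u (x, t) - grad_S \<gamma> \<tau> u (x, t)\<bar> \<le> KR + KS"
        using KR[OF z(3)] KS[OF z(3)] by linarith
    qed (auto simp: N_def)
    then have "(\<gamma> + 1) / 4 * \<bar>inverse (\<tau> (x, t)) * (grad_R \<gamma> \<tau> u (x, t) - grad_S \<gamma> \<tau> u (x, t))\<bar> \<le> L"
      unfolding L_def by (rule mult_left_mono) (use \<gamma> in simp)
    then show "\<bar>- ((\<gamma> + 1) / 4) * (inverse (\<tau> (x, t)) * (grad_R \<gamma> \<tau> u (x, t) - grad_S \<gamma> \<tau> u (x, t)))\<bar> \<le> L"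
    proof -
      have "\<bar>- ((\<gamma> + 1) / 4)\<bar> = (\<gamma> + 1) / 4" using \<gamma> by simp
      then show ?thesis
        using \<open>(\<gamma> + 1) / 4 * \<bar>inverse (\<tau> (x, t)) * (grad_R \<gamma> \<tau> u (x, t) - grad_S \<gamma> \<tau> u (x, t))\<bar> \<le> L\<close>
        by (simp only: abs_mult[of "- ((\<gamma> + 1) / 4)"])
    qed
  qed
  have "\<bar>c (x, t) - c (y, t)\<bar> \<le> L * \<bar>x - y\<bar>" if t: "t \<in> {0..T'}" for x y t
  proof -
    define D where "D x = - ((\<gamma> + 1) / 4) * (inverse (\<tau> (x, t)) * (grad_R \<gamma> \<tau> u (x, t) - grad_S \<gamma> \<tau> u (x, t)))" for x
    have "\<bar>c (x, t) - c (y, t) - 0 / real (Suc 0) * (x - y) ^ Suc 0\<bar> \<le> L * \<bar>x - y\<bar>"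
    proof (rule mvt_monomial[where g = "\<lambda>s. c (s, t)" and g' = D])
      fix s
      show "((\<lambda>s. c (s, t)) has_real_derivative D s) (at s)" unfolding D_def by (rule dc[OF t])
      show "\<bar>D s - 0 * (s - y) ^ 0\<bar> \<le> L" using bd[OF t, of s] unfolding D_def[symmetric] by simp
    qed
    then show ?thesis by simp
  qed
  moreover have "L \<ge> 0"
  proof -
    have "0 \<in> {0..T'}" using assms(1) by simp
    show ?thesis by (rule order_trans[OF abs_ge_zero bd[OF \<open>0 \<in> {0..T'}\<close>, of 0]])
  qed
  ultimately show ?thesis by (intro exI[of _ L] conjI ballI allI)
qed

end

section \<open>The feet of the characteristics\<close>

lemma positive_before_end:
  fixes g :: "real \<Rightarrow> real"
  assumes "continuous_on {0..T} g" "g T > 0" "T > 0"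
  obtains s where "0 \<le> s" "s < T" "g s > 0"
proof -
  have "T \<in> {0..T}" using assms(3) by simp
  then obtain d where d: "d > 0" "\<And>s. s \<in> {0..T} \<Longrightarrow> dist s T < d \<Longrightarrow> dist (g s) (g T) < g T"
    using assms(1,2) unfolding continuous_on_iff by meson
  have m: "0 < min d T" "min d T \<le> d" "min d T \<le> T" using d(1) assms(3) by auto
  define r where "r = T - min d T / 2"
  have r: "0 \<le> r" "r < T" "T - r < d" unfolding r_def using m by linarith+
  then have "dist (g r) (g T) < g T" by (intro d(2)) (simp_all add: dist_real_def)
  then have "g r > 0" unfolding dist_real_def by linarith
  then show ?thesis using that[of r] r by simp
qed

context euler_flow
begin

text \<open>Gronwall's estimate for two characteristics of one family: their distances at any two times up to \<open>T'\<close> are comparable.\<close>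

definition growth_bound :: "real \<Rightarrow> real \<Rightarrow> bool" where
  "growth_bound T' E \<longleftrightarrow> E \<ge> 0 \<and> (\<forall>\<sigma> z z' \<xi> \<eta> r t. (\<sigma> = 1 \<or> \<sigma> = - 1) \<longrightarrow>
     is_characteristic \<gamma> \<tau> \<sigma> z \<xi> \<longrightarrow> is_characteristic \<gamma> \<tau> \<sigma> z' \<eta> \<longrightarrow>
     0 \<le> r \<longrightarrow> r \<le> t \<longrightarrow> t \<le> T' \<longrightarrow> t \<le> snd z \<longrightarrow> t \<le> snd z' \<longrightarrow>
     \<bar>\<xi> t - \<eta> t\<bar> \<le> E * \<bar>\<xi> r - \<eta> r\<bar> \<and> \<bar>\<xi> r - \<eta> r\<bar> \<le> E * \<bar>\<xi> t - \<eta> t\<bar>)"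

lemma growth_boundD:
  assumes "growth_bound T' E" "\<sigma> = 1 \<or> \<sigma> = - 1" "is_characteristic \<gamma> \<tau> \<sigma> z \<xi>"
    "is_characteristic \<gamma> \<tau> \<sigma> z' \<eta>" "0 \<le> r" "r \<le> t" "t \<le> T'" "t \<le> snd z" "t \<le> snd z'"
  shows "\<bar>\<xi> t - \<eta> t\<bar> \<le> E * \<bar>\<xi> r - \<eta> r\<bar>" "\<bar>\<xi> r - \<eta> r\<bar> \<le> E * \<bar>\<xi> t - \<eta> t\<bar>"
  using conjunct2[OF assms(1)[unfolded growth_bound_def], rule_format, OF assms(2-)] by auto

lemma char_growth:
  assumes "0 \<le> T'" "T' < T"
  obtains E where "growth_bound T' E"
proof -
  obtain L where L: "L \<ge> 0" "\<And>t x y. t \<in> {0..T'} \<Longrightarrow> \<bar>c (x, t) - c (y, t)\<bar> \<le> L * \<bar>x - y\<bar>"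
    using c_lipschitz[OF assms] by metis
  show ?thesis
  proof (rule that[of "exp (L * T')"], unfold growth_bound_def, rule conjI, simp, intro allI impI)
    fix \<sigma> z z' \<xi> \<eta> r t
    assume \<sigma>: "\<sigma> = 1 \<or> \<sigma> = - 1" and ch: "is_characteristic \<gamma> \<tau> \<sigma> z \<xi>" "is_characteristic \<gamma> \<tau> \<sigma> z' \<eta>"
      and r: "0 \<le> r" "r \<le> t" "t \<le> T'" "t \<le> snd z" "t \<le> snd z'"
    have cont: "continuous_on {r..t} (\<lambda>s. \<xi> s - \<eta> s)"
      by (intro continuous_on_diff continuous_on_subset[OF char_continuous[OF ch(1)]]
          continuous_on_subset[OF char_continuous[OF ch(2)]]) (use r in auto)
    have der: "((\<lambda>s. \<xi> s - \<eta> s) has_real_derivative \<sigma> * c (\<xi> s, s) - \<sigma> * c (\<eta> s, s)) (at s)"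
      if "r < s" "s < t" for s
      by (rule DERIV_diff[OF char_derivative[OF ch(1)] char_derivative[OF ch(2)]]) (use that r in auto)
    have bd: "\<bar>\<sigma> * c (\<xi> s, s) - \<sigma> * c (\<eta> s, s)\<bar> \<le> L * \<bar>\<xi> s - \<eta> s\<bar>" if "r < s" "s < t" for s
    proof -
      have "\<bar>\<sigma> * c (\<xi> s, s) - \<sigma> * c (\<eta> s, s)\<bar> = \<bar>c (\<xi> s, s) - c (\<eta> s, s)\<bar>" using \<sigma> by auto
      also have "\<dots> \<le> L * \<bar>\<xi> s - \<eta> s\<bar>" by (rule L(2)) (use that r in auto)
      finally show ?thesis .
    qed
    note g = gronwall_abs[OF r(2) cont der bd]
    have "exp (L * (t - r)) \<le> exp (L * T')" using L(1) r by (simp add: mult_left_mono)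
    then have E: "exp (L * (t - r)) * y \<le> exp (L * T') * y" if "y \<ge> 0" for y using that by (rule mult_right_mono)
    have "\<bar>\<xi> t - \<eta> t\<bar> \<le> exp (L * T') * \<bar>\<xi> r - \<eta> r\<bar>"
      by (rule order_trans[OF g(1) E]) simp_all
    moreover have "\<bar>\<xi> r - \<eta> r\<bar> \<le> exp (L * T') * \<bar>\<xi> t - \<eta> t\<bar>"
      by (rule order_trans[OF g(2) E]) simp_all
    ultimately show "\<bar>\<xi> t - \<eta> t\<bar> \<le> exp (L * T') * \<bar>\<xi> r - \<eta> r\<bar> \<and>
        \<bar>\<xi> r - \<eta> r\<bar> \<le> exp (L * T') * \<bar>\<xi> t - \<eta> t\<bar>" ..
  qed
qed

lemma foot_unique:
  assumes \<sigma>: "\<sigma> = 1 \<or> \<sigma> = - 1" and ch: "is_characteristic \<gamma> \<tau> \<sigma> z \<xi>" and z: "0 \<le> snd z" "snd z < T"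
  shows "H \<sigma> z = \<xi> 0"
proof -
  have "z \<in> UNIV \<times> {0..T}" using z by (simp add: mem_Times_iff)
  then obtain \<eta> where \<eta>: "is_characteristic \<gamma> \<tau> \<sigma> z \<eta>" "H \<sigma> z = \<eta> 0" using feet[OF \<sigma>] by blast
  obtain E where E: "growth_bound (snd z) E"
    by (rule char_growth[OF z])
  have "\<bar>\<xi> 0 - \<eta> 0\<bar> \<le> E * \<bar>\<xi> (snd z) - \<eta> (snd z)\<bar>"
    by (rule growth_boundD(2)[OF E \<sigma> ch \<eta>(1) order_refl z(1) order_refl order_refl order_refl])
  moreover have "\<xi> (snd z) = \<eta> (snd z)" using ch \<eta>(1) by (simp add: is_characteristic_def)
  ultimately show ?thesis using \<eta>(2) by simp
qed

lemma foot_along: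
  assumes "\<sigma> = 1 \<or> \<sigma> = - 1" "is_characteristic \<gamma> \<tau> \<sigma> z \<xi>" "0 \<le> s" "s \<le> snd z" "s < T"
  shows "H \<sigma> (\<xi> s, s) = \<xi> 0"
  by (rule foot_unique[OF assms(1) char_restrict[OF assms(2-4)]]) (use assms in auto)

lemma foot_initial: "\<sigma> = 1 \<or> \<sigma> = - 1 \<Longrightarrow> H \<sigma> (x, 0) = x"
proof -
  assume \<sigma>: "\<sigma> = 1 \<or> \<sigma> = - 1"
  have "(x, 0) \<in> UNIV \<times> {0..T}" using T_pos by simp
  then obtain \<xi> where "is_characteristic \<gamma> \<tau> \<sigma> (x, 0) \<xi>" "H \<sigma> (x, 0) = \<xi> 0" using feet[OF \<sigma>] by blast
  then show ?thesis by (simp add: is_characteristic_def)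
qed

lemma foot_lipschitz:
  assumes T': "0 \<le> T'" "T' < T" and \<sigma>: "\<sigma> = 1 \<or> \<sigma> = - 1"
  shows "\<exists>K\<ge>0. \<forall>z\<in>UNIV \<times> {0..T'}. \<forall>z'\<in>UNIV \<times> {0..T'}.
    \<bar>H \<sigma> z' - H \<sigma> z\<bar> \<le> K * (\<bar>fst z' - fst z\<bar> + \<bar>snd z' - snd z\<bar>)"
proof -
  obtain E where E: "growth_bound T' E"
    by (rule char_growth[OF T'])
  have E0: "E \<ge> 0" using E by (simp add: growth_bound_def)
  obtain M where M: "M > 0" "\<And>z. z \<in> UNIV \<times> {0..<T} \<Longrightarrow> c z \<le> M" using c_bounded by blast
  have wlog: "\<bar>H \<sigma> z' - H \<sigma> z\<bar> \<le> E * (1 + M) * (\<bar>fst z' - fst z\<bar> + \<bar>snd z' - snd z\<bar>)"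
    if z: "z \<in> UNIV \<times> {0..T'}" "z' \<in> UNIV \<times> {0..T'}" "snd z \<le> snd z'" for z z'
  proof -
    have t: "0 \<le> snd z" "snd z \<le> T'" "0 \<le> snd z'" "snd z' \<le> T'" using z by (auto simp: mem_Times_iff)
    have strip: "z \<in> UNIV \<times> {0..T}" "z' \<in> UNIV \<times> {0..T}" using t T' by (auto simp: mem_Times_iff)
    obtain \<xi> where \<xi>: "is_characteristic \<gamma> \<tau> \<sigma> z \<xi>" "H \<sigma> z = \<xi> 0" using feet[OF \<sigma> strip(1)] by blast
    obtain \<eta> where \<eta>: "is_characteristic \<gamma> \<tau> \<sigma> z' \<eta>" "H \<sigma> z' = \<eta> 0" using feet[OF \<sigma> strip(2)] by blast
    have ends: "\<xi> (snd z) = fst z" "\<eta> (snd z') = fst z'" using \<xi>(1) \<eta>(1) by (auto simp: is_characteristic_def)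
    have "\<bar>\<eta> 0 - \<xi> 0\<bar> \<le> E * \<bar>\<eta> (snd z) - \<xi> (snd z)\<bar>"
      by (rule growth_boundD(2)[OF E \<sigma> \<eta>(1) \<xi>(1) order_refl t(1,2) z(3) order_refl])
    moreover have "\<bar>\<eta> (snd z') - \<eta> (snd z)\<bar> \<le> M * (snd z' - snd z)"
    proof (cases "snd z = snd z'")
      case False
      then have lt: "snd z < snd z'" using z(3) by simp
      have der: "(\<eta> has_derivative (\<lambda>v. \<sigma> * c (\<eta> s, s) * v)) (at s)" if "snd z < s" "s < snd z'" for s
        using char_derivative[OF \<eta>(1), of s] that t by (simp add: has_field_derivative_def)
      have "continuous_on {snd z..snd z'} \<eta>"
        by (rule continuous_on_subset[OF char_continuous[OF \<eta>(1)]]) (use t in auto)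
      then obtain s where s: "snd z < s" "s < snd z'" "\<eta> (snd z') - \<eta> (snd z) = \<sigma> * c (\<eta> s, s) * (snd z' - snd z)"
        using mvt[OF lt _ der] by blast
      have c1: "c (\<eta> s, s) \<le> M" "c (\<eta> s, s) > 0" using s t T' by (auto intro!: M(2) c_pos)
      have "\<bar>\<sigma> * c (\<eta> s, s) * (snd z' - snd z)\<bar> = c (\<eta> s, s) * (snd z' - snd z)"
        using \<sigma> c1 lt by (auto simp: abs_mult)
      also have "\<dots> \<le> M * (snd z' - snd z)" by (rule mult_right_mono[OF c1(1)]) (use lt in simp)
      finally show ?thesis using s(3) by simp
    qed simp
    ultimately have 1: "\<bar>H \<sigma> z' - H \<sigma> z\<bar> \<le> E * \<bar>\<eta> (snd z) - fst z\<bar>"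
      and 2: "\<bar>fst z' - \<eta> (snd z)\<bar> \<le> M * \<bar>snd z' - snd z\<bar>"
      using \<xi>(2) \<eta>(2) ends z(3) by auto
    have "\<bar>\<eta> (snd z) - fst z\<bar> \<le> \<bar>fst z' - fst z\<bar> + M * \<bar>snd z' - snd z\<bar>" using 2 by linarith
    also have "\<dots> \<le> (1 + M) * (\<bar>fst z' - fst z\<bar> + \<bar>snd z' - snd z\<bar>)"
    proof -
      have "0 \<le> M * \<bar>fst z' - fst z\<bar>" "0 \<le> \<bar>snd z' - snd z\<bar>" using M(1) by auto
      then show ?thesis unfolding distrib_left distrib_right mult_1 by linarith
    qed
    finally have "E * \<bar>\<eta> (snd z) - fst z\<bar> \<le> E * ((1 + M) * (\<bar>fst z' - fst z\<bar> + \<bar>snd z' - snd z\<bar>))"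
      by (rule mult_left_mono[OF _ E0])
    then show ?thesis using 1 by (simp only: mult.assoc)
  qed
  show ?thesis
  proof (intro exI[of _ "E * (1 + M)"] conjI ballI)
    show "0 \<le> E * (1 + M)" using E0 M(1) by simp
    fix z z' :: "real \<times> real" assume z: "z \<in> UNIV \<times> {0..T'}" "z' \<in> UNIV \<times> {0..T'}"
    show "\<bar>H \<sigma> z' - H \<sigma> z\<bar> \<le> E * (1 + M) * (\<bar>fst z' - fst z\<bar> + \<bar>snd z' - snd z\<bar>)"
    proof (cases "snd z \<le> snd z'")
      case True
      then show ?thesis by (rule wlog[OF z])
    next
      case False
      then show ?thesis using wlog[OF z(2,1)]
        by (simp only: abs_minus_commute[of "H \<sigma> z'"] abs_minus_commute[of "fst z'"] abs_minus_commute[of "snd z'"] linorder_not_le less_imp_le)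
    qed
  qed
qed

lemma cont_H:
  assumes \<sigma>: "\<sigma> = 1 \<or> \<sigma> = - 1"
  shows "continuous_on (UNIV \<times> {0..<T}) (H \<sigma>)"
  unfolding continuous_on_def
proof (intro ballI)
  fix z :: "real \<times> real" assume z: "z \<in> UNIV \<times> {0..<T}"
  let ?F = "at z within UNIV \<times> {0..<T}"
  define T' where "T' = (snd z + T) / 2"
  have t: "0 \<le> snd z" "snd z < T'" "T' < T" "0 \<le> T'" using z by (auto simp: T'_def mem_Times_iff)
  obtain K where K: "K \<ge> 0" "\<And>z z'. z \<in> UNIV \<times> {0..T'} \<Longrightarrow> z' \<in> UNIV \<times> {0..T'} \<Longrightarrow>
    \<bar>H \<sigma> z' - H \<sigma> z\<bar> \<le> K * (\<bar>fst z' - fst z\<bar> + \<bar>snd z' - snd z\<bar>)"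
    using foot_lipschitz[OF t(4,3) \<sigma>] by blast
  have fst_lim: "(fst \<longlongrightarrow> fst z) ?F" and snd_lim: "(snd \<longlongrightarrow> snd z) ?F"
    by (rule tendsto_fst[OF tendsto_ident_at], rule tendsto_snd[OF tendsto_ident_at])
  have "((\<lambda>z'. K * (\<bar>fst z' - fst z\<bar> + \<bar>snd z' - snd z\<bar>)) \<longlongrightarrow> K * (\<bar>fst z - fst z\<bar> + \<bar>snd z - snd z\<bar>)) ?F"
    by (intro tendsto_mult tendsto_add tendsto_rabs tendsto_diff tendsto_const fst_lim snd_lim)
  then have lim0: "((\<lambda>z'. K * (\<bar>fst z' - fst z\<bar> + \<bar>snd z' - snd z\<bar>)) \<longlongrightarrow> 0) ?F" by simp
  have "eventually (\<lambda>z'. snd z' < T') ?F" using order_tendstoD(2)[OF snd_lim t(2)] .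
  moreover have "eventually (\<lambda>z'. z' \<in> UNIV \<times> {0..<T}) ?F" by (simp add: eventually_at_filter)
  ultimately have "eventually (\<lambda>z'. norm (H \<sigma> z' - H \<sigma> z) \<le> K * (\<bar>fst z' - fst z\<bar> + \<bar>snd z' - snd z\<bar>)) ?F"
  proof eventually_elim
    case (elim z')
    then show ?case unfolding real_norm_def
      by (intro K(2)) (use t in \<open>auto simp: mem_Times_iff\<close>)
  qed
  from Lim_null_comparison[OF this lim0]
  show "(H \<sigma> \<longlongrightarrow> H \<sigma> z) ?F" by (rule LIM_zero_cancel)
qed

text \<open>Two characteristics of one family that are distinct at one time before \<open>T\<close> never meet, hence keep their order.\<close>

lemma foot_less:
  assumes \<sigma>: "\<sigma> = 1 \<or> \<sigma> = - 1" and t: "0 \<le> t" "t < T" and xy: "x < y"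
  shows "H \<sigma> (x, t) < H \<sigma> (y, t)"
proof -
  have strip: "(x, t) \<in> UNIV \<times> {0..T}" "(y, t) \<in> UNIV \<times> {0..T}" using t by auto
  obtain \<xi> where \<xi>: "is_characteristic \<gamma> \<tau> \<sigma> (x, t) \<xi>" "H \<sigma> (x, t) = \<xi> 0" using feet[OF \<sigma> strip(1)] by blast
  obtain \<eta> where \<eta>: "is_characteristic \<gamma> \<tau> \<sigma> (y, t) \<eta>" "H \<sigma> (y, t) = \<eta> 0" using feet[OF \<sigma> strip(2)] by blast
  have ends: "\<xi> t = x" "\<eta> t = y" using \<xi>(1) \<eta>(1) by (auto simp: is_characteristic_def)
  have no_meet: "\<eta> s - \<xi> s \<noteq> 0" if s: "0 \<le> s" "s \<le> t" for s
  proof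
    assume "\<eta> s - \<xi> s = 0"
    moreover obtain E where E: "growth_bound t E"
      by (rule char_growth[OF t])
    then have "\<bar>\<xi> t - \<eta> t\<bar> \<le> E * \<bar>\<xi> s - \<eta> s\<bar>"
      by (rule growth_boundD(1)[OF _ \<sigma> \<xi>(1) \<eta>(1) s]) simp_all
    ultimately show False using ends xy by simp
  qed
  have cont: "continuous_on {0..t} (\<lambda>s. \<eta> s - \<xi> s)"
    using char_continuous[OF \<xi>(1)] char_continuous[OF \<eta>(1)] by (auto intro: continuous_on_diff)
  have "\<not> \<eta> 0 - \<xi> 0 \<le> 0"
  proof
    assume "\<eta> 0 - \<xi> 0 \<le> 0"
    then obtain s where "0 \<le> s" "s \<le> t" "\<eta> s - \<xi> s = 0"
      using IVT'[of "\<lambda>s. \<eta> s - \<xi> s" 0 0 t] ends xy t cont by auto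
    then show False using no_meet by blast
  qed
  then show ?thesis using \<xi>(2) \<eta>(2) by simp
qed

lemma char_monotone:
  assumes ch: "is_characteristic \<gamma> \<tau> \<sigma> z \<xi>" and "snd z \<le> T" and s: "0 \<le> s" "s < r" "r \<le> snd z"
  shows "\<sigma> = 1 \<Longrightarrow> \<xi> s < \<xi> r" and "\<sigma> = - 1 \<Longrightarrow> \<xi> r < \<xi> s"
proof -
  have cont: "continuous_on {s..r} \<xi>"
    by (rule continuous_on_subset[OF char_continuous[OF ch]]) (use s in auto)
  have pos: "c (\<xi> v, v) > 0" if "s < v" "v < r" for v
    by (rule c_pos) (use that assms in auto)
  have der: "(\<xi> has_real_derivative \<sigma> * c (\<xi> v, v)) (at v)" if "s < v" "v < r" for v
    by (rule char_derivative[OF ch]) (use that s in auto)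
  show "\<xi> s < \<xi> r" if "\<sigma> = 1"
    by (rule DERIV_pos_imp_increasing_open[OF s(2) _ cont]) (use der pos that in fastforce)
  show "\<xi> r < \<xi> s" if "\<sigma> = - 1"
    by (rule DERIV_neg_imp_decreasing_open[OF s(2) _ cont]) (use der pos that in fastforce)
qed

lemma feet_sum:
  assumes z: "z \<in> UNIV \<times> {0..T}"
  shows "H (- 1) z - H 1 z \<ge> 0" and "snd z > 0 \<Longrightarrow> H (- 1) z - H 1 z > 0"
proof -
  obtain \<xi> where \<xi>: "is_characteristic \<gamma> \<tau> 1 z \<xi>" "H 1 z = \<xi> 0" using feet[of 1, OF _ z] by auto
  obtain \<eta> where \<eta>: "is_characteristic \<gamma> \<tau> (- 1) z \<eta>" "H (- 1) z = \<eta> 0" using feet[of "- 1", OF _ z] by auto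
  have ends: "\<xi> (snd z) = fst z" "\<eta> (snd z) = fst z" using \<xi>(1) \<eta>(1) by (auto simp: is_characteristic_def)
  have t: "0 \<le> snd z" "snd z \<le> T" using z by (auto simp: mem_Times_iff)
  show pos: "H (- 1) z - H 1 z > 0" if "snd z > 0"
    using char_monotone(1)[OF \<xi>(1) t(2) order_refl that order_refl]
      char_monotone(2)[OF \<eta>(1) t(2) order_refl that order_refl] ends \<xi>(2) \<eta>(2) by simp
  show "H (- 1) z - H 1 z \<ge> 0"
  proof (cases "snd z = 0")
    case True
    then show ?thesis using ends \<xi>(2) \<eta>(2) by simp
  next
    case False
    then show ?thesis using pos t by simp
  qed
qed

text \<open>The map to characteristic coordinates \<open>(X, Y)\<close>, and the image of the times before the blow-up.\<close>

definition Zm :: "real \<times> real \<Rightarrow> real \<times> real" where "Zm z = (H (- 1) z, - H 1 z)"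

definition U :: "(real \<times> real) set" where "U = Zm ` (UNIV \<times> {0..<T})"

lemma cont_Zm: "continuous_on (UNIV \<times> {0..<T}) Zm"
  unfolding Zm_def by (intro continuous_on_Pair continuous_on_minus cont_H) auto

lemma U_diag: "(x, - x) \<in> U"
proof -
  have "Zm (x, 0) = (x, - x)" by (simp add: Zm_def foot_initial)
  moreover have "(x, 0) \<in> UNIV \<times> {0..<T}" using T_pos by simp
  ultimately show ?thesis unfolding U_def by (metis image_eqI)
qed

text \<open>Moving back along the characteristic of the other family changes only one of the two coordinates, continuously, down
  to its value on the line \<open>X + Y = 0\<close>. The intermediate value theorem finds the point in between.\<close>

lemma U_lower_X:
  assumes "(X, Y) \<in> U" "X' \<le> X" "X' + Y \<ge> 0"
  shows "(X', Y) \<in> U"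
proof -
  obtain z where z: "z \<in> UNIV \<times> {0..<T}" "(X, Y) = Zm z" using assms(1) unfolding U_def by blast
  then have t: "0 \<le> snd z" "snd z < T" "z \<in> UNIV \<times> {0..T}" by (auto simp: mem_Times_iff)
  obtain \<xi> where \<xi>: "is_characteristic \<gamma> \<tau> 1 z \<xi>" "H 1 z = \<xi> 0" using feet[of 1, OF _ t(3)] by auto
  have fin: "\<xi> (snd z) = fst z" using \<xi>(1) by (auto simp: is_characteristic_def)
  let ?g = "\<lambda>s. H (- 1) (\<xi> s, s)"
  have "continuous_on {0..snd z} ?g"
    by (rule continuous_on_compose2[OF cont_H continuous_on_Pair[OF char_continuous[OF \<xi>(1)] continuous_on_id]])
      (use t in auto)
  moreover have "?g 0 \<le> X'" using foot_initial[of "- 1" "\<xi> 0"] \<xi>(2) z(2) assms(3) by (simp add: Zm_def)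
  moreover have "X' \<le> ?g (snd z)" using fin assms(2) z(2) by (simp add: Zm_def)
  ultimately obtain s where s: "0 \<le> s" "s \<le> snd z" "?g s = X'" using IVT'[of ?g 0 X' "snd z"] t(1) by blast
  have "Zm (\<xi> s, s) = (X', Y)"
    using foot_along[of 1, OF _ \<xi>(1) s(1,2)] s t \<xi>(2) z(2) by (simp add: Zm_def)
  moreover have "(\<xi> s, s) \<in> UNIV \<times> {0..<T}" using s t by simp
  ultimately show ?thesis unfolding U_def by (metis image_eqI)
qed

lemma U_lower_Y:
  assumes "(X, Y) \<in> U" "Y' \<le> Y" "X + Y' \<ge> 0"
  shows "(X, Y') \<in> U"
proof -
  obtain z where z: "z \<in> UNIV \<times> {0..<T}" "(X, Y) = Zm z" using assms(1) unfolding U_def by blast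
  then have t: "0 \<le> snd z" "snd z < T" "z \<in> UNIV \<times> {0..T}" by (auto simp: mem_Times_iff)
  obtain \<xi> where \<xi>: "is_characteristic \<gamma> \<tau> (- 1) z \<xi>" "H (- 1) z = \<xi> 0" using feet[of "- 1", OF _ t(3)] by auto
  have fin: "\<xi> (snd z) = fst z" using \<xi>(1) by (auto simp: is_characteristic_def)
  let ?g = "\<lambda>s. - H 1 (\<xi> s, s)"
  have "continuous_on {0..snd z} ?g"
    by (intro continuous_on_minus continuous_on_compose2[OF cont_H continuous_on_Pair[OF char_continuous[OF \<xi>(1)] continuous_on_id]])
      (use t in auto)
  moreover have "?g 0 \<le> Y'" using foot_initial[of 1 "\<xi> 0"] \<xi>(2) z(2) assms(3) by (simp add: Zm_def)
  moreover have "Y' \<le> ?g (snd z)" using fin assms(2) z(2) by (simp add: Zm_def)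
  ultimately obtain s where s: "0 \<le> s" "s \<le> snd z" "?g s = Y'" using IVT'[of ?g 0 Y' "snd z"] t(1) by blast
  have "Zm (\<xi> s, s) = (X, Y')"
    using foot_along[of "- 1", OF _ \<xi>(1) s(1,2)] s t \<xi>(2) z(2) by (simp add: Zm_def)
  moreover have "(\<xi> s, s) \<in> UNIV \<times> {0..<T}" using s t by simp
  ultimately show ?thesis unfolding U_def by (metis image_eqI)
qed

lemma U_lower:
  assumes "(X, Y) \<in> U" "X' \<le> X" "Y' \<le> Y" "X' + Y' \<ge> 0"
  shows "(X', Y') \<in> U"
  by (rule U_lower_Y[OF U_lower_X[OF assms(1,2)] assms(3,4)]) (use assms in linarith)

end

text \<open>Continuous functions \<open>x\<close> and \<open>t\<close> that invert the characteristic coordinates.\<close>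

locale euler_char = euler_flow +
  fixes G :: "(real \<times> real) set" and x t :: "real \<times> real \<Rightarrow> real"
  assumes open_G: "open G" and cont_x: "continuous_on G x" and cont_t: "continuous_on G t"
    and ZG: "\<And>z. z \<in> UNIV \<times> {0..T} \<Longrightarrow> Zm z \<in> G \<and> x (Zm z) = fst z \<and> t (Zm z) = snd z"
begin

lemma Zm_inj: "inj_on Zm (UNIV \<times> {0..T})"
proof (rule inj_onI)
  fix z z' assume "z \<in> UNIV \<times> {0..T}" "z' \<in> UNIV \<times> {0..T}" "Zm z = Zm z'"
  then have "fst z = fst z'" "snd z = snd z'" using ZG by metis+
  then show "z = z'" by (simp add: prod_eq_iff)
qed

lemma U_sub: "U \<subseteq> G"
  using ZG unfolding U_def by (fastforce simp: mem_Times_iff)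

lemma U_time: "Z \<in> U \<Longrightarrow> 0 \<le> t Z \<and> t Z < T \<and> Zm (x Z, t Z) = Z"
proof -
  assume "Z \<in> U"
  then obtain z where z: "z \<in> UNIV \<times> {0..<T}" "Z = Zm z" unfolding U_def by blast
  then have "z \<in> UNIV \<times> {0..T}" by (auto simp: mem_Times_iff)
  from ZG[OF this] show ?thesis using z by (simp add: mem_Times_iff)
qed

text \<open>Invariance of domain replaces the computation of the Jacobian of the characteristic coordinates.\<close>

lemma U_open: "open (U \<inter> {z. fst z + snd z > 0})"
proof -
  have "U \<inter> {z. fst z + snd z > 0} = Zm ` (UNIV \<times> {0<..<T})"
  proof (intro equalityI subsetI)
    fix Z assume Z: "Z \<in> U \<inter> {z. fst z + snd z > 0}"
    then obtain z where z: "z \<in> UNIV \<times> {0..<T}" "Z = Zm z" unfolding U_def by blast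
    have "snd z \<noteq> 0"
    proof
      assume "snd z = 0"
      then have "Zm z = (fst z, - fst z)" using foot_initial[of _ "fst z"] by (cases z) (simp add: Zm_def)
      then show False using Z z by simp
    qed
    then have "z \<in> UNIV \<times> {0<..<T}" using z(1) by (simp add: mem_Times_iff)
    then show "Z \<in> Zm ` (UNIV \<times> {0<..<T})" using z(2) by (rule rev_image_eqI)
  next
    fix Z assume "Z \<in> Zm ` (UNIV \<times> {0<..<T})"
    then obtain z where z: "z \<in> UNIV \<times> {0<..<T}" "Z = Zm z" by blast
    then have "z \<in> UNIV \<times> {0..T}" "snd z > 0" "z \<in> UNIV \<times> {0..<T}" by (auto simp: mem_Times_iff)
    then show "Z \<in> U \<inter> {z. fst z + snd z > 0}"
      using feet_sum(2) z(2) unfolding U_def by (simp add: Zm_def)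
  qed
  moreover have "open (Zm ` (UNIV \<times> {0<..<T}))"
  proof (rule invariance_of_domain)
    show "continuous_on (UNIV \<times> {0<..<T}) Zm" by (rule continuous_on_subset[OF cont_Zm]) auto
    show "inj_on Zm (UNIV \<times> {0<..<T})" by (rule inj_on_subset[OF Zm_inj]) auto
  qed (intro open_Times open_UNIV open_greaterThanLessThan)
  ultimately show ?thesis by simp
qed

lemma U_closed:
  assumes "Z \<in> closure U" "Z \<in> G" "t Z < T"
  shows "Z \<in> U"
proof -
  obtain s where s: "\<And>n. s n \<in> U" "s \<longlonglongrightarrow> Z"
    using assms(1) unfolding closure_sequential by blast
  have sG: "eventually (\<lambda>n. s n \<in> G) sequentially" using s(1) U_sub by (auto intro!: always_eventually)
  have lim: "(\<lambda>n. (x (s n), t (s n))) \<longlonglongrightarrow> (x Z, t Z)"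
    by (intro tendsto_Pair continuous_on_tendsto_compose[OF cont_x s(2) assms(2) sG]
        continuous_on_tendsto_compose[OF cont_t s(2) assms(2) sG])
  have t: "0 \<le> t Z"
    by (rule continuous_le_closure[OF continuous_on_const cont_t U_sub _ assms(2,1)]) (use U_time in blast)
  then have Z: "(x Z, t Z) \<in> UNIV \<times> {0..<T}" using assms(3) by simp
  have "(\<lambda>n. Zm (x (s n), t (s n))) \<longlonglongrightarrow> Zm (x Z, t Z)"
    by (rule continuous_on_tendsto_compose[OF cont_Zm lim Z]) (use U_time[OF s(1)] in simp)
  moreover have "(\<lambda>n. Zm (x (s n), t (s n))) = s" using U_time[OF s(1)] by auto
  ultimately have "Z = Zm (x Z, t Z)" using s(2) LIMSEQ_unique by auto
  then show ?thesis using Z unfolding U_def by (rule image_eqI)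
qed

text \<open>A point of the final boundary that is not a limit of points of earlier time is isolated: if another
  point of the final boundary were near it, two characteristics of opposite families through the
  two points would have crossed earlier, at a point of \<open>U\<close> that shares one coordinate with each of them.\<close>

lemma isolated_unless_limit:
  assumes "Zm (xs, T) \<notin> closure U"
  shows "\<exists>r>0. \<forall>z\<in>UNIV \<times> {0..T}. dist (Zm z) (Zm (xs, T)) < r \<longrightarrow> Zm z = Zm (xs, T)"
proof -
  obtain X0 Y0 where Z0: "Zm (xs, T) = (X0, Y0)" by (cases "Zm (xs, T)")
  have z0: "(xs, T) \<in> UNIV \<times> {0..T}" using T_pos by simp
  have sum: "X0 + Y0 > 0" using feet_sum(2)[OF z0] T_pos Z0 by (simp add: Zm_def)
  obtain e where e: "e > 0" "\<And>Z. Z \<in> U \<Longrightarrow> \<not> dist Z (X0, Y0) < e"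
    using assms unfolding Z0 closure_approachable by blast
  define r where "r = min e (X0 + Y0)"
  have r: "r > 0" "r \<le> e" "r \<le> X0 + Y0" using e sum by (auto simp: r_def)
  have "Zm z = (X0, Y0)" if z: "z \<in> UNIV \<times> {0..T}" "dist (Zm z) (X0, Y0) < r" for z
  proof (rule ccontr)
    assume ne: "Zm z \<noteq> (X0, Y0)"
    obtain X1 Y1 where Z1: "Zm z = (X1, Y1)" by (cases "Zm z")
    have d: "\<bar>X1 - X0\<bar> < r" "\<bar>Y1 - Y0\<bar> < r"
      using z(2) dist_fst_le[of "Zm z" "(X0, Y0)"] dist_snd_le[of "Zm z" "(X0, Y0)"]
      by (auto simp: dist_real_def Z1)
    have notU: "Zm z \<notin> U" using e(2)[of "Zm z"] z(2) r(2) by linarith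
    have t: "snd z = T"
    proof (rule ccontr)
      assume "snd z \<noteq> T"
      then have "z \<in> UNIV \<times> {0..<T}" using z(1) by (simp add: mem_Times_iff)
      then have "Zm z \<in> U" unfolding U_def by (rule imageI)
      then show False using notU by (rule rev_notE)
    qed
    define x1 where "x1 = fst z"
    have zz: "z = (x1, T)" using t by (simp add: x1_def prod_eq_iff)
    have "x1 \<noteq> xs" using ne Z0 unfolding zz by metis
    then consider "xs < x1" | "x1 < xs" by linarith
    then show False
    proof cases
      case 1
      obtain \<xi> where \<xi>: "is_characteristic \<gamma> \<tau> (- 1) (xs, T) \<xi>" "H (- 1) (xs, T) = \<xi> 0"
        using feet[of "- 1", OF _ z0] by auto
      obtain \<eta> where \<eta>: "is_characteristic \<gamma> \<tau> 1 z \<eta>" "H 1 z = \<eta> 0" using feet[of 1, OF _ z(1)] by auto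
      have ends: "\<xi> T = xs" "\<eta> T = x1" using \<xi>(1) \<eta>(1) zz by (auto simp: is_characteristic_def)
      have "continuous_on {0..T} (\<lambda>s. \<eta> s - \<xi> s)"
        using char_continuous[OF \<xi>(1)] char_continuous[OF \<eta>(1)] zz by (auto intro: continuous_on_diff)
      then obtain s where s: "0 \<le> s" "s < T" "\<eta> s - \<xi> s > 0"
        by (rule positive_before_end) (use ends 1 T_pos in auto)
      have h1: "H (- 1) (\<xi> s, s) = X0"
      proof -
        have "H (- 1) (\<xi> s, s) = \<xi> 0"
          by (rule foot_along[OF _ \<xi>(1) s(1)]) (use s(2) in simp_all)
        then show ?thesis using \<xi>(2) arg_cong[OF Z0, of fst] unfolding Zm_def by simp
      qed
      have h2: "H 1 (\<eta> s, s) = - Y1"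
      proof -
        have "H 1 (\<eta> s, s) = \<eta> 0"
          by (rule foot_along[OF _ \<eta>(1) s(1)]) (use s(2) t in simp_all)
        then show ?thesis using \<eta>(2) arg_cong[OF Z1, of snd] unfolding Zm_def by simp
      qed
      have lt: "\<xi> s < \<eta> s" using s(3) by linarith
      have h3: "H 1 (\<xi> s, s) < H 1 (\<eta> s, s)" by (rule foot_less[OF disjI1[OF refl] s(1,2) lt])
      have "Zm (\<xi> s, s) \<in> U" unfolding U_def by (rule imageI) (use s(1,2) in simp)
      then have inU: "(X0, - H 1 (\<xi> s, s)) \<in> U" unfolding Zm_def h1 .
      have "(X0, Y1) \<in> U"
        by (rule U_lower_Y[OF inU]) (use h2 h3 d r in linarith)+
      moreover have "dist (X0, Y1) (X0, Y0) < e" using d r by (simp add: dist_Pair_Pair dist_real_def)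
      ultimately show False using e(2) by blast
    next
      case 2
      obtain \<xi> where \<xi>: "is_characteristic \<gamma> \<tau> 1 (xs, T) \<xi>" "H 1 (xs, T) = \<xi> 0"
        using feet[of 1, OF _ z0] by auto
      obtain \<eta> where \<eta>: "is_characteristic \<gamma> \<tau> (- 1) z \<eta>" "H (- 1) z = \<eta> 0" using feet[of "- 1", OF _ z(1)] by auto
      have ends: "\<xi> T = xs" "\<eta> T = x1" using \<xi>(1) \<eta>(1) zz by (auto simp: is_characteristic_def)
      have "continuous_on {0..T} (\<lambda>s. \<xi> s - \<eta> s)"
        using char_continuous[OF \<xi>(1)] char_continuous[OF \<eta>(1)] zz by (auto intro: continuous_on_diff)
      then obtain s where s: "0 \<le> s" "s < T" "\<xi> s - \<eta> s > 0"
        by (rule positive_before_end) (use ends 2 T_pos in auto)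
      have h1: "H 1 (\<xi> s, s) = - Y0"
      proof -
        have "H 1 (\<xi> s, s) = \<xi> 0"
          by (rule foot_along[OF _ \<xi>(1) s(1)]) (use s(2) in simp_all)
        then show ?thesis using \<xi>(2) arg_cong[OF Z0, of snd] unfolding Zm_def by simp
      qed
      have h2: "H (- 1) (\<eta> s, s) = X1"
      proof -
        have "H (- 1) (\<eta> s, s) = \<eta> 0"
          by (rule foot_along[OF _ \<eta>(1) s(1)]) (use s(2) t in simp_all)
        then show ?thesis using \<eta>(2) arg_cong[OF Z1, of fst] unfolding Zm_def by simp
      qed
      have lt: "\<eta> s < \<xi> s" using s(3) by linarith
      have h3: "H (- 1) (\<eta> s, s) < H (- 1) (\<xi> s, s)" by (rule foot_less[OF disjI2[OF refl] s(1,2) lt])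
      have "Zm (\<xi> s, s) \<in> U" unfolding U_def by (rule imageI) (use s(1,2) in simp)
      then have inU: "(H (- 1) (\<xi> s, s), Y0) \<in> U" unfolding Zm_def h1 minus_minus .
      have "(X1, Y0) \<in> U"
        by (rule U_lower_X[OF inU]) (use h2 h3 d r in linarith)+
      moreover have "dist (X1, Y0) (X0, Y0) < e" using d r by (simp add: dist_Pair_Pair dist_real_def)
      ultimately show False using e(2) by blast
    qed
  qed
  then show ?thesis using r(1) Z0 by auto
qed

end

section \<open>Extension and modification of functions\<close>

lemma Ck_on_powr:
  assumes "open G" "\<And>z. z \<in> G \<Longrightarrow> f z > 0"
  shows "Ck_on k G f \<Longrightarrow> Ck_on k G (\<lambda>z. f z powr e)"
proof (induction k arbitrary: e)
  case 0
  have "continuous_on G (\<lambda>z. f z powr e)"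
    by (rule continuous_on_powr) (use 0 in \<open>simp, simp, metis assms(2) less_irrefl\<close>)
  then show ?case by simp
next
  case (Suc k)
  note f = Ck_on_openD[OF assms(1) Suc.prems]
  have ih: "Ck_on k G (\<lambda>z. e * f z powr (e - 1))"
    by (rule Ck_on_mult[OF Ck_on_const Suc.IH[OF Ck_on_SucD[OF Suc.prems]]])
  show ?case
  proof (rule Ck_on_openI[OF _ Ck_on_mult[OF ih f(2)] Ck_on_mult[OF ih f(3)]])
    fix z assume z: "z \<in> G"
    have "((\<lambda>y. y powr e) has_real_derivative e * f z powr (e - 1)) (at (f z))"
      by (rule has_real_derivative_powr[OF assms(2)[OF z]])
    from has_derivative_compose[OF f(1)[OF z] this[unfolded has_field_derivative_def]]
    show "((\<lambda>z. f z powr e) has_derivative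
        (\<lambda>v. e * f z powr (e - 1) * pd1 f z * fst v + e * f z powr (e - 1) * pd2 f z * snd v)) (at z)"
      by (rule has_derivative_eq_rhs) (simp add: fun_eq_iff algebra_simps)
  qed
qed

lemma closure_strip:
  fixes S :: "(real \<times> real) set"
  assumes "open S" "z \<in> S" "z \<in> UNIV \<times> {0..T}" "T > 0"
  shows "z \<in> closure (S \<inter> UNIV \<times> {0..<T})"
proof (cases "snd z < T")
  case True
  then have "z \<in> S \<inter> UNIV \<times> {0..<T}" using assms(2,3) by (simp add: mem_Times_iff)
  then show ?thesis by (rule subsetD[OF closure_subset])
next
  case False
  then have T: "snd z = T" using assms(3) by (simp add: mem_Times_iff)
  obtain e where e: "e > 0" "ball z e \<subseteq> S" by (rule openE[OF assms(1,2)])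
  have "(fst z, T) \<in> closure (S \<inter> UNIV \<times> {0..<T})"
  proof (rule closure_below)
    show "min e T > 0" using e(1) assms(4) by simp
    fix s assume s: "T - min e T < s" "s < T"
    have "dist z (fst z, s) = \<bar>T - s\<bar>"
      unfolding dist_prod_def fst_conv snd_conv T dist_real_def by simp
    also have "\<dots> < e" using s by linarith
    finally have "(fst z, s) \<in> ball z e" by (simp only: mem_ball)
    then have "(fst z, s) \<in> S" by (rule subsetD[OF e(2)])
    moreover have "0 \<le> s" using s by linarith
    ultimately show "(fst z, s) \<in> S \<inter> UNIV \<times> {0..<T}" using s(2) by simp
  qed
  moreover have "(fst z, T) = z" using T by (simp add: prod_eq_iff)
  ultimately show ?thesis by (simp only:)
qed

text \<open>A function on a strip that is differentiable before the final time is differentiable at the final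
  time, from the past, if its gradient extends continuously: apply the mean value theorem on segments that end at the final time.\<close>

lemma derivative_extends:
  fixes f g h :: "real \<times> real \<Rightarrow> real"
  assumes A: "A = ball z0 \<delta> \<inter> UNIV \<times> {0..T}" and T: "T > 0"
    and cont: "continuous_on A f" "continuous_on A g" "continuous_on A h"
    and der: "\<And>z. z \<in> A \<Longrightarrow> snd z < T \<Longrightarrow> (f has_derivative (\<lambda>v. g z * fst v + h z * snd v)) (at z)"
    and z: "z \<in> A"
  shows "(f has_derivative (\<lambda>v. g z * fst v + h z * snd v)) (at z within A)"
proof (cases "snd z < T")
  case True
  then show ?thesis using der[OF z] has_derivative_at_withinI by blast
next
  case False
  then have zT: "snd z = T" using z by (simp add: A mem_Times_iff)
  let ?D = "\<lambda>v :: real \<times> real. g z * fst v + h z * snd v"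
  have convA: "convex A" unfolding A by (intro convex_Int convex_ball convex_Times convex_UNIV convex_real_interval)
  show ?thesis
    unfolding has_derivative_within_alt
  proof (intro conjI allI impI)
    show "bounded_linear ?D"
      by (intro bounded_linear_add bounded_linear_const_mult bounded_linear_fst bounded_linear_snd)
    fix e :: real assume e: "e > 0"
    obtain d1 where d1: "d1 > 0" "\<And>w. w \<in> A \<Longrightarrow> dist w z < d1 \<Longrightarrow> dist (g w) (g z) < e / 2"
      using cont(2) z e unfolding continuous_on_iff by (meson half_gt_zero)
    obtain d2 where d2: "d2 > 0" "\<And>w. w \<in> A \<Longrightarrow> dist w z < d2 \<Longrightarrow> dist (h w) (h z) < e / 2"
      using cont(3) z e unfolding continuous_on_iff by (meson half_gt_zero)
    define d where "d = min d1 d2"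
    have d: "d > 0" "d \<le> d1" "d \<le> d2" using d1(1) d2(1) by (auto simp: d_def)
    have before: "norm (f y - f z - ?D (y - z)) \<le> e * norm (y - z)"
      if y: "y \<in> A" "norm (y - z) < d" "snd y < T" for y
    proof -
      define w where "w s = y + s *\<^sub>R (z - y)" for s
      have wA: "w s \<in> A" if "0 \<le> s" "s \<le> 1" for s
      proof -
        have "w s = (1 - s) *\<^sub>R y + s *\<^sub>R z" by (simp add: w_def algebra_simps)
        then show ?thesis using convexD[OF convA y(1) z, of "1 - s" s] that by simp
      qed
      have wT: "snd (w s) < T" if "s < 1" for s
      proof -
        have "snd (w s) = T - (1 - s) * (T - snd y)" by (simp add: w_def zT algebra_simps)
        moreover have "(1 - s) * (T - snd y) > 0" using that y(3) by simp
        ultimately show ?thesis by linarith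
      qed
      have w_der: "(w has_derivative (\<lambda>r. r *\<^sub>R (z - y))) (at s)" for s
      proof -
        have "((\<lambda>s. y + s *\<^sub>R (z - y)) has_derivative (\<lambda>r. 0 + r *\<^sub>R (z - y))) (at s)"
          by (intro has_derivative_add has_derivative_const has_derivative_scaleR_left has_derivative_ident)
        then show ?thesis unfolding w_def[abs_def] by simp
      qed
      have w_cont: "continuous_on {0..1} w"
        unfolding w_def[abs_def]
        by (intro continuous_on_add continuous_on_const continuous_on_scaleR continuous_on_id)
      have fw_cont: "continuous_on {0..1} (\<lambda>s. f (w s))"
        by (rule continuous_on_compose2[OF cont(1) w_cont]) (use wA in auto)
      have "((\<lambda>s. f (w s)) has_derivative (\<lambda>r. g (w s) * fst (r *\<^sub>R (z - y)) + h (w s) * snd (r *\<^sub>R (z - y)))) (at s)"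
        if "0 < s" "s < 1" for s
        by (rule has_derivative_compose[OF w_der der]) (use wA wT that in auto)
      from mvt[OF zero_less_one fw_cont this]
      obtain s where s: "0 < s" "s < 1"
        "f (w 1) - f (w 0) = g (w s) * fst ((1 - 0) *\<^sub>R (z - y)) + h (w s) * snd ((1 - 0) *\<^sub>R (z - y))"
        by blast
      have ws: "w s \<in> A" "dist (w s) z < d"
      proof -
        show "w s \<in> A" using wA s by simp
        have "w s - z = (1 - s) *\<^sub>R (y - z)" by (simp add: w_def algebra_simps)
        then have "dist (w s) z = (1 - s) * norm (y - z)" using s by (simp add: dist_norm)
        also have "\<dots> \<le> norm (y - z)" using s by (simp add: mult_left_le_one_le)
        finally show "dist (w s) z < d" using y(2) by linarith
      qed
      have bds: "\<bar>g (w s) - g z\<bar> \<le> e / 2" "\<bar>h (w s) - h z\<bar> \<le> e / 2"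
        using d1(2)[OF ws(1)] d2(2)[OF ws(1)] ws(2) d(2,3) by (auto simp: dist_real_def)
      have "w 1 = z" "w 0 = y" by (auto simp: w_def)
      then have "f z - f y = g (w s) * (fst z - fst y) + h (w s) * (snd z - snd y)" using s(3) by simp
      then have "f y - f z - ?D (y - z) = (g (w s) - g z) * (fst (y - z)) + (h (w s) - h z) * (snd (y - z))"
        by (simp add: algebra_simps)
      also have "\<bar>\<dots>\<bar> \<le> \<bar>g (w s) - g z\<bar> * \<bar>fst (y - z)\<bar> + \<bar>h (w s) - h z\<bar> * \<bar>snd (y - z)\<bar>"
        using abs_triangle_ineq[of "(g (w s) - g z) * (fst (y - z))" "(h (w s) - h z) * (snd (y - z))"]
        by (simp only: abs_mult)
      also have "\<dots> \<le> e / 2 * norm (y - z) + e / 2 * norm (y - z)"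
      proof -
        have "\<bar>fst (y - z)\<bar> \<le> norm (y - z)" "\<bar>snd (y - z)\<bar> \<le> norm (y - z)"
          using norm_fst_le[of "fst (y - z)" "snd (y - z)"] norm_snd_le[of "snd (y - z)" "fst (y - z)"]
          unfolding prod.collapse real_norm_def .
        then show ?thesis using bds e by (intro add_mono mult_mono) auto
      qed
      finally show ?thesis by simp
    qed
    show "\<exists>d>0. \<forall>y\<in>A. norm (y - z) < d \<longrightarrow> norm (f y - f z - ?D (y - z)) \<le> e * norm (y - z)"
    proof (intro exI[of _ d] conjI ballI impI)
      fix y assume y: "y \<in> A" "norm (y - z) < d"
      let ?S = "ball z0 \<delta> \<inter> ball z d"
      have yS: "y \<in> ?S" "y \<in> UNIV \<times> {0..T}" using y dist_commute[of z y] by (auto simp: A dist_norm)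
      have cl: "y \<in> closure (?S \<inter> UNIV \<times> {0..<T})"
        by (rule closure_strip[OF _ yS T]) auto
      have cA: "continuous_on A (\<lambda>y. f y - f z - ?D (y - z))"
        by (intro continuous_on_diff continuous_on_add continuous_on_mult continuous_on_const cont
            continuous_on_fst continuous_on_snd continuous_on_id)
      show "norm (f y - f z - ?D (y - z)) \<le> e * norm (y - z)"
      proof (rule continuous_le_closure[OF _ _ _ _ y(1) cl])
        show "continuous_on A (\<lambda>y. norm (f y - f z - ?D (y - z)))" by (rule continuous_on_norm[OF cA])
        show "continuous_on A (\<lambda>y. e * norm (y - z))"
          by (intro continuous_on_mult continuous_on_norm continuous_on_diff continuous_on_const continuous_on_id)
        show "?S \<inter> UNIV \<times> {0..<T} \<subseteq> A" by (auto simp: A)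
        fix v assume v: "v \<in> ?S \<inter> UNIV \<times> {0..<T}"
        show "norm (f v - f z - ?D (v - z)) \<le> e * norm (v - z)"
        proof (rule before)
          show "v \<in> A" using v by (simp add: A mem_Times_iff)
          have "dist v z < d" using v by (simp add: dist_commute)
          then show "norm (v - z) < d" by (simp only: dist_norm)
          show "snd v < T" using v by (simp add: mem_Times_iff)
        qed
      qed
    qed (rule d(1))
  qed
qed

text \<open>A \<open>C\<^sup>2\<close> function can be changed near one point so that its first two derivatives in the first variable vanish there, while its
  value and its other derivative stay: inside a ball, a quadratic polynomial in the first variable is added. The sphere, across which the new function
  may fail to be smooth, is taken out of the domain.\<close>

lemma eventually_slice1:
  fixes A :: "(real \<times> real) set"
  assumes "open A" "z \<in> A"
  shows "eventually (\<lambda>s. (s, snd z) \<in> A) (nhds (fst z))"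
  using eventually_nhds_in_open[OF open_slice1[OF assms(1), of "snd z"], of "fst z"] assms(2) by simp

lemma eventually_slice2:
  fixes A :: "(real \<times> real) set"
  assumes "open A" "z \<in> A"
  shows "eventually (\<lambda>s. (fst z, s) \<in> A) (nhds (snd z))"
  using eventually_nhds_in_open[OF open_slice2[OF assms(1), of "fst z"], of "snd z"] assms(2) by simp

definition flattens1 where
  "flattens1 G z0 r f f' \<longleftrightarrow> Ck_on (Suc (Suc 0)) ((G \<inter> ball z0 r) \<union> (G - cball z0 r)) f' \<and>
    f' z0 = f z0 \<and> pd1 f' z0 = 0 \<and> pd1 (pd1 f') z0 = 0 \<and> pd2 f' z0 = pd2 f z0 \<and>
    (\<forall>z. r < dist z0 z \<longrightarrow> f' z = f z \<and> pd1 f' z = pd1 f z \<and> pd2 f' z = pd2 f z)"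

definition flattens2 where
  "flattens2 G z0 r f f' \<longleftrightarrow> Ck_on (Suc (Suc 0)) ((G \<inter> ball z0 r) \<union> (G - cball z0 r)) f' \<and>
    f' z0 = f z0 \<and> pd2 f' z0 = 0 \<and> pd2 (pd2 f') z0 = 0 \<and> pd1 f' z0 = pd1 f z0 \<and>
    (\<forall>z. r < dist z0 z \<longrightarrow> f' z = f z \<and> pd1 f' z = pd1 f z \<and> pd2 f' z = pd2 f z)"

lemma flatten1:
  assumes "open G" "z0 \<in> G" "Ck_on (Suc (Suc 0)) G f" "r > 0"
  shows "\<exists>f'. flattens1 G z0 r f f'"
proof -
  define a1 where "a1 = - pd1 f z0"
  define a2 where "a2 = - pd1 (pd1 f) z0 / 2"
  let ?A = "G \<inter> ball z0 r" and ?B = "G - cball z0 r"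
  define X0 where "X0 = fst z0"
  define g where "g z = f z + (a1 * (fst z + - X0) + a2 * ((fst z + - X0) * (fst z + - X0)))" for z
  define f' where "f' z = (if z \<in> ball z0 r then g z else f z)" for z
  have A: "open ?A" "z0 \<in> ?A" and B: "open ?B" using assms by auto
  have C2g: "Ck_on (Suc (Suc 0)) ?A g"
    unfolding g_def
    by (intro Ck_on_add Ck_on_mult Ck_on_const Ck_on_fst Ck_on_subset[OF assms(3)]) auto
  have C2f: "Ck_on (Suc (Suc 0)) ?B f" by (rule Ck_on_subset[OF assms(3)]) auto
  have "Ck_on (Suc (Suc 0)) (?A \<union> ?B) (\<lambda>z. if z \<in> ?A then g z else f z)"
    by (rule Ck_on_glue[OF A(1) B _ C2g C2f]) auto
  then have 1: "Ck_on (Suc (Suc 0)) (?A \<union> ?B) f'"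
    by (rule Ck_on_cong[rotated]) (auto simp: f'_def)
  have near: "f' z = g z" if "z \<in> ?A" for z using that by (simp add: f'_def)
  have f'_A: "Ck_on (Suc (Suc 0)) ?A f'" by (rule Ck_on_subset[OF 1]) auto
  note df' = Ck_on_openD[OF A(1) f'_A]
  note df = Ck_on_openD[OF assms(1,3)]
  have poly1: "((\<lambda>s. a1 * (s + - X0) + a2 * ((s + - X0) * (s + - X0))) has_real_derivative a1 + 2 * a2 * (s - X0)) (at s)" for s
    by (auto intro!: derivative_eq_intros simp: algebra_simps)
  have p1: "pd1 f' z = pd1 f z + (a1 + 2 * a2 * (fst z - X0))" if z: "z \<in> ?A" for z
  proof -
    have zz: "(fst z, snd z) \<in> G" using z by simp
    have "((\<lambda>s. g (s, snd z)) has_real_derivative pd1 f (fst z, snd z) + (a1 + 2 * a2 * (fst z - X0))) (at (fst z))"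
      unfolding g_def fst_conv by (rule DERIV_add[OF Ck_on_partials(1)[OF assms(1,3) zz] poly1])
    moreover have "eventually (\<lambda>s. g (s, snd z) = f' (s, snd z)) (nhds (fst z))"
      by (rule eventually_mono[OF eventually_slice1[OF A(1) z]]) (erule near[symmetric])
    ultimately have "((\<lambda>s. f' (s, snd z)) has_real_derivative pd1 f (fst z, snd z) + (a1 + 2 * a2 * (fst z - X0))) (at (fst z))"
      by (rule iffD1[OF DERIV_cong_ev[OF refl _ refl], rotated])
    then have "((\<lambda>s. f' (s, snd z)) has_real_derivative pd1 f z + (a1 + 2 * a2 * (fst z - X0))) (at (fst z))"
      by (simp only: prod.collapse)
    then show ?thesis unfolding pd1_def[of f'] by (rule DERIV_imp_deriv)
  qed
  have z0: "(fst z0, snd z0) \<in> G" using assms(2) by simp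
  show ?thesis
    unfolding flattens1_def
  proof (intro exI[of _ f'] conjI allI impI)
    show "Ck_on (Suc (Suc 0)) (?A \<union> ?B) f'" by (rule 1)
    show "f' z0 = f z0" using near[OF A(2)] by (simp add: g_def X0_def)
    show "pd1 f' z0 = 0" using p1[OF A(2)] by (simp add: X0_def a1_def)
    have "((\<lambda>s. pd1 f (s, snd z0) + (a1 + 2 * a2 * (s - X0))) has_real_derivative pd1 (pd1 f) (fst z0, snd z0) + 2 * a2) (at (fst z0))"
      by (rule DERIV_add[OF Ck_on_partials(1)[OF assms(1) df(2) z0]]) (auto intro!: derivative_eq_intros)
    moreover have "eventually (\<lambda>s. pd1 f (s, snd z0) + (a1 + 2 * a2 * (s - X0)) = pd1 f' (s, snd z0)) (nhds (fst z0))"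
    proof (rule eventually_mono[OF eventually_slice1[OF A(1,2)]])
      fix s assume "(s, snd z0) \<in> ?A"
      from p1[OF this] show "pd1 f (s, snd z0) + (a1 + 2 * a2 * (s - X0)) = pd1 f' (s, snd z0)" by simp
    qed
    ultimately have "((\<lambda>s. pd1 f' (s, snd z0)) has_real_derivative pd1 (pd1 f) (fst z0, snd z0) + 2 * a2) (at (fst z0))"
      by (rule iffD1[OF DERIV_cong_ev[OF refl _ refl], rotated])
    then have "pd1 (pd1 f') z0 = pd1 (pd1 f) (fst z0, snd z0) + 2 * a2"
      unfolding pd1_def[of "pd1 f'"] by (rule DERIV_imp_deriv)
    then show "pd1 (pd1 f') z0 = 0" by (simp add: a2_def)
    have "f' (fst z0, s) = f (fst z0, s)" for s by (simp add: f'_def g_def X0_def)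
    then show "pd2 f' z0 = pd2 f z0" unfolding pd2_def by simp
    fix z assume far: "r < dist z0 z"
    have opn: "open (- cball z0 r)" by (rule open_Compl[OF closed_cball])
    have zin: "z \<in> - cball z0 r" unfolding Compl_iff mem_cball using far by linarith
    have eq: "f' w = f w" if "w \<in> - cball z0 r" for w
    proof -
      have "w \<notin> ball z0 r" using that unfolding Compl_iff mem_cball mem_ball by linarith
      then show ?thesis by (simp only: f'_def if_False)
    qed
    have ev1: "eventually (\<lambda>s. f' (s, snd z) = f (s, snd z)) (nhds (fst z))"
      using eventually_slice1[OF opn zin] by (rule eventually_mono) (rule eq)
    have ev2: "eventually (\<lambda>s. f' (fst z, s) = f (fst z, s)) (nhds (snd z))"
      using eventually_slice2[OF opn zin] by (rule eventually_mono) (rule eq)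
    have "deriv (\<lambda>s. f' (s, snd z)) (fst z) = deriv (\<lambda>s. f (s, snd z)) (fst z)"
      by (rule deriv_cong_ev[OF ev1 refl])
    then have e1: "pd1 f' z = pd1 f z" by (simp only: pd1_def)
    have "deriv (\<lambda>s. f' (fst z, s)) (snd z) = deriv (\<lambda>s. f (fst z, s)) (snd z)"
      by (rule deriv_cong_ev[OF ev2 refl])
    then have e2: "pd2 f' z = pd2 f z" by (simp only: pd2_def)
    show "f' z = f z" "pd1 f' z = pd1 f z" "pd2 f' z = pd2 f z" by (rule eq[OF zin], rule e1, rule e2)
  qed
qed

lemma dist_swap: "dist (prod.swap z) (prod.swap w) = dist z w"
  by (simp add: dist_prod_def add.commute)

lemma flatten2:
  assumes "open G" "z0 \<in> G" "Ck_on (Suc (Suc 0)) G f" "r > 0"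
  shows "\<exists>f'. flattens2 G z0 r f f'"
proof -
  have z0: "prod.swap z0 \<in> prod.swap -` G" using assms(2) by simp
  obtain h where "flattens1 (prod.swap -` G) (prod.swap z0) r (f \<circ> prod.swap) h"
    using flatten1[OF open_swap[OF assms(1)] z0 Ck_on_swap[OF assms(1,3)] assms(4)] by (rule exE)
  note h = this[unfolded flattens1_def, THEN conjunct1]
    this[unfolded flattens1_def, THEN conjunct2, THEN conjunct1]
    this[unfolded flattens1_def, THEN conjunct2, THEN conjunct2, THEN conjunct1]
    this[unfolded flattens1_def, THEN conjunct2, THEN conjunct2, THEN conjunct2, THEN conjunct1]
    this[unfolded flattens1_def, THEN conjunct2, THEN conjunct2, THEN conjunct2, THEN conjunct2, THEN conjunct1]
    this[unfolded flattens1_def, THEN conjunct2, THEN conjunct2, THEN conjunct2, THEN conjunct2, THEN conjunct2, rule_format]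
  let ?S = "(prod.swap -` G \<inter> ball (prod.swap z0) r) \<union> (prod.swap -` G - cball (prod.swap z0) r)"
  have opS: "open ?S"
    by (rule open_Un[OF open_Int[OF open_swap[OF assms(1)] open_ball] open_Diff[OF open_swap[OF assms(1)] closed_cball]])
  have S: "prod.swap -` ?S = (G \<inter> ball z0 r) \<union> (G - cball z0 r)"
  proof (rule set_eqI)
    fix z :: "real \<times> real"
    have ss: "prod.swap (prod.swap z) = z" by simp
    show "z \<in> prod.swap -` ?S \<longleftrightarrow> z \<in> (G \<inter> ball z0 r) \<union> (G - cball z0 r)"
      unfolding vimage_eq Un_iff Int_iff Diff_iff mem_ball mem_cball dist_swap ss ..
  qed
  show ?thesis
    unfolding flattens2_def
  proof (intro exI[of _ "h \<circ> prod.swap"] conjI allI impI)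
    show "Ck_on (Suc (Suc 0)) ((G \<inter> ball z0 r) \<union> (G - cball z0 r)) (h \<circ> prod.swap)"
      using Ck_on_swap[OF opS h(1)] unfolding S .
    show "(h \<circ> prod.swap) z0 = f z0" using h(2) by simp
    show "pd2 (h \<circ> prod.swap) z0 = 0" using h(3) by (simp add: pd_swap)
    show "pd2 (pd2 (h \<circ> prod.swap)) z0 = 0" using h(4) by (simp add: pd_swap)
    show "pd1 (h \<circ> prod.swap) z0 = pd1 f z0" using h(5) by (simp add: pd_swap)
    fix z assume "r < dist z0 z"
    then have "r < dist (prod.swap z0) (prod.swap z)" by (simp only: dist_swap)
    note hz = h(6)[OF this]
    show "(h \<circ> prod.swap) z = f z" "pd1 (h \<circ> prod.swap) z = pd1 f z" "pd2 (h \<circ> prod.swap) z = pd2 f z"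
      using hz by (simp_all add: pd_swap)
  qed
qed

section \<open>The solution in characteristic coordinates\<close>

text \<open>Besides being \<open>C\<^sup>2\<close> near \<open>\<Omega>\<close>, the angles enter the notion of a solution only through their values and one first derivative each on \<open>\<Omega>\<close>.\<close>

lemma char_solution_update:
  assumes cs: "char_solution \<gamma> \<tau>0 u0 T \<tau> u X Y F"
    and G: "open G'" "Omega T X Y \<subseteq> G'" "G' \<subseteq> G0" "fields_Ck_on 2 G0 F"
    and C2: "Ck_on 2 G' a'" "Ck_on 2 G' b'"
    and eq: "\<And>Z. Z \<in> Omega T X Y \<Longrightarrow> a' Z = al F Z" "\<And>Z. Z \<in> Omega T X Y \<Longrightarrow> b' Z = be F Z"
      "\<And>Z. Z \<in> Omega T X Y \<Longrightarrow> pd2 a' Z = pd2 (al F) Z" "\<And>Z. Z \<in> Omega T X Y \<Longrightarrow> pd1 b' Z = pd1 (be F) Z"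
    and diag: "\<And>x. (x, - x) \<in> Omega T X Y"
  shows "char_solution \<gamma> \<tau>0 u0 T \<tau> u X Y (F\<lparr>al := a', be := b'\<rparr>)"
proof -
  let ?F = "F\<lparr>al := a', be := b'\<rparr>"
  have pt: "(X z, Y z) \<in> Omega T X Y" if "z \<in> UNIV \<times> {0..T}" for z
    unfolding Omega_def using that by (rule imageI)
  have pt': "(X z, Y z) \<in> Omega T X Y" if "z \<in> UNIV \<times> {0..<T}" for z
    by (rule pt) (use that in \<open>simp add: mem_Times_iff\<close>)
  note c = cs[unfolded char_solution_def Let_def]
  have sys: "semilinear_system_at \<gamma> ?F Z" if Z: "Z \<in> Omega T X Y" for Z
  proof -
    have "semilinear_system_at \<gamma> F Z" using c Z by simp
    then show ?thesis using eq[OF Z] unfolding semilinear_system_at_def Let_def by simp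
  qed
  have fld: "fields_Ck_on 2 G' ?F"
    using C2 G(4) Ck_on_subset[OF _ G(3)] unfolding fields_Ck_on_def by simp
  show ?thesis
    unfolding char_solution_def Let_def
  proof (intro conjI)
    show "\<exists>G. open G \<and> Omega T X Y \<subseteq> G \<and> fields_Ck_on 2 G ?F" using G(1,2) fld by (intro exI[of _ G'] conjI)
    show "\<forall>z\<in>UNIV \<times> {0..T}. xx ?F (X z, Y z) = fst z \<and> tt ?F (X z, Y z) = snd z \<and> ta ?F (X z, Y z) = \<tau> z \<and> uu ?F (X z, Y z) = u z"
      using c by simp
    show "\<forall>z\<in>UNIV \<times> {0..<T}. al ?F (X z, Y z) = 2 * arctan (grad_R \<gamma> \<tau> u z) \<and>
        be ?F (X z, Y z) = 2 * arctan (grad_S \<gamma> \<tau> u z) \<and>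
        pp ?F (X z, Y z) = sqrt (1 + (grad_R \<gamma> \<tau> u z)\<^sup>2) / pd1 X z \<and>
        qq ?F (X z, Y z) = sqrt (1 + (grad_S \<gamma> \<tau> u z)\<^sup>2) / (- pd1 Y z)"
    proof (rule ballI)
      fix z :: "real \<times> real" assume z: "z \<in> UNIV \<times> {0..<T}"
      have "\<forall>z\<in>UNIV \<times> {0..<T}. al F (X z, Y z) = 2 * arctan (grad_R \<gamma> \<tau> u z) \<and>
        be F (X z, Y z) = 2 * arctan (grad_S \<gamma> \<tau> u z) \<and>
        pp F (X z, Y z) = sqrt (1 + (grad_R \<gamma> \<tau> u z)\<^sup>2) / pd1 X z \<and>
        qq F (X z, Y z) = sqrt (1 + (grad_S \<gamma> \<tau> u z)\<^sup>2) / (- pd1 Y z)"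
        using c by (elim conjE)
      from bspec[OF this z] show "al ?F (X z, Y z) = 2 * arctan (grad_R \<gamma> \<tau> u z) \<and>
        be ?F (X z, Y z) = 2 * arctan (grad_S \<gamma> \<tau> u z) \<and>
        pp ?F (X z, Y z) = sqrt (1 + (grad_R \<gamma> \<tau> u z)\<^sup>2) / pd1 X z \<and>
        qq ?F (X z, Y z) = sqrt (1 + (grad_S \<gamma> \<tau> u z)\<^sup>2) / (- pd1 Y z)"
        using eq(1,2)[OF pt'[OF z]] by simp
    qed
    show "\<forall>Z\<in>Omega T X Y. al ?F Z \<in> {- pi..<pi} \<and> be ?F Z \<in> {- pi..<pi}" using c eq(1,2) by simp
    show "\<forall>Z\<in>Omega T X Y. semilinear_system_at \<gamma> ?F Z" using sys by (rule ballI)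
    show "\<forall>x. ta ?F (x, - x) = \<tau>0 x \<and> uu ?F (x, - x) = u0 x \<and>
          al ?F (x, - x) = 2 * arctan (R0 \<gamma> \<tau>0 u0 x) \<and>
          be ?F (x, - x) = 2 * arctan (S0 \<gamma> \<tau>0 u0 x) \<and>
          pp ?F (x, - x) = sqrt (1 + (R0 \<gamma> \<tau>0 u0 x)\<^sup>2) \<and>
          qq ?F (x, - x) = sqrt (1 + (S0 \<gamma> \<tau>0 u0 x)\<^sup>2) \<and>
          tt ?F (x, - x) = 0 \<and> xx ?F (x, - x) = x"
    proof (rule allI)
      fix x
      show "ta ?F (x, - x) = \<tau>0 x \<and> uu ?F (x, - x) = u0 x \<and>
          al ?F (x, - x) = 2 * arctan (R0 \<gamma> \<tau>0 u0 x) \<and>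
          be ?F (x, - x) = 2 * arctan (S0 \<gamma> \<tau>0 u0 x) \<and>
          pp ?F (x, - x) = sqrt (1 + (R0 \<gamma> \<tau>0 u0 x)\<^sup>2) \<and>
          qq ?F (x, - x) = sqrt (1 + (S0 \<gamma> \<tau>0 u0 x)\<^sup>2) \<and>
          tt ?F (x, - x) = 0 \<and> xx ?F (x, - x) = x"
        using c eq(1,2)[OF diag[of x]] by simp
    qed
  qed
qed

text \<open>The hypotheses of the theorem, fixed once so that the physical and the characteristic plane can be treated side by side.\<close>

locale singular_setting =
  fixes \<gamma> taubar cbar T :: real
    and \<tau>0 u0 :: "real \<Rightarrow> real"
    and \<tau> u X Y :: "real \<times> real \<Rightarrow> real"
    and F :: char_fields
    and D :: "((real \<Rightarrow> real) \<times> (real \<Rightarrow> real)) set"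
  assumes gamma: "\<gamma> > 1"
    and generic: "generic_data \<gamma> taubar D"
    and inD: "((\<lambda>x. \<tau>0 x - taubar), u0) \<in> D"
    and cbar: "cbar > 0" and data: "data_conditions \<gamma> cbar \<tau>0 u0"
    and sol: "solution_until_blowup \<gamma> \<tau>0 u0 T \<tau> u"
    and coords: "char_coordinates \<gamma> T \<tau> X Y"
    and chsol: "char_solution \<gamma> \<tau>0 u0 T \<tau> u X Y F"
begin

definition foot :: "real \<Rightarrow> real \<times> real \<Rightarrow> real" where
  "foot \<sigma> = (if \<sigma> = 1 then (\<lambda>z. - Y z) else X)"

text \<open>Members of \<open>C3W11\<close> are bounded, which makes the Riemann invariants bounded initially.\<close>

definition u_bound :: real where "u_bound = (SOME B. \<forall>x. \<bar>u0 x\<bar> \<le> B)"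

lemma u_bound: "\<bar>u0 x\<bar> \<le> u_bound"
proof -
  have "D \<subseteq> C3W11 \<times> C3W11" using generic by (simp add: generic_data_def open_dense_data_def)
  then have "u0 \<in> C3W11" using inD by blast
  then have "\<forall>k\<le>3. bounded (range ((deriv ^^ k) u0))" by (simp add: C3W11_def)
  then have "bounded (range ((deriv ^^ 0) u0))" by (rule allE[of _ 0]) simp
  then have "bounded (range u0)" by simp
  then have "\<exists>B. \<forall>x. \<bar>u0 x\<bar> \<le> B" unfolding bounded_iff by auto
  then show ?thesis unfolding u_bound_def by (rule someI2_ex) simp
qed

lemma tau0_lower: "1 / cbar \<le> \<tau>0 x"
  using data by (simp add: data_conditions_def)

lemmas sol' = sol[unfolded solution_until_blowup_def]

sublocale euler_flow \<gamma> T u_bound "1 / cbar" \<tau> u foot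
proof
  show "\<gamma> > 1" by (rule gamma)
  show "T > 0" using sol' by blast
  show "\<tau> z > 0" if "z \<in> UNIV \<times> {0..T}" for z using sol' that by blast
  show "continuous_on (UNIV \<times> {0..T}) \<tau>" "continuous_on (UNIV \<times> {0..T}) u" using sol' by blast+
  show "Ck_on (Suc 0) (UNIV \<times> {0..<T}) \<tau>" "Ck_on (Suc 0) (UNIV \<times> {0..<T}) u" using sol' by simp_all
  show "pd2 \<tau> z - pd1 u z = 0 \<and> pd2 u z + pd1 (\<lambda>w. 1 / \<gamma> * \<tau> w powr (- \<gamma>)) z = 0"
    if "z \<in> UNIV \<times> {0<..<T}" for z using sol' that by blast
  show "bounded (grad_R \<gamma> \<tau> u ` (UNIV \<times> {0..T'})) \<and> bounded (grad_S \<gamma> \<tau> u ` (UNIV \<times> {0..T'}))"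
    if "0 \<le> T'" "T' < T" for T' using sol' that by blast
  have init: "\<tau> (x, 0) = \<tau>0 x" "u (x, 0) = u0 x" for x using sol' by blast+
  show "\<bar>u (x, 0)\<bar> \<le> u_bound" for x unfolding init by (rule u_bound)
  show "1 / cbar > 0" using cbar by simp
  show "1 / cbar \<le> \<tau> (x, 0)" for x unfolding init by (rule tau0_lower)
  fix \<sigma> :: real and z :: "real \<times> real" assume \<sigma>: "\<sigma> = 1 \<or> \<sigma> = - 1" and z: "z \<in> UNIV \<times> {0..T}"
  have c: "\<exists>\<xi>. is_characteristic \<gamma> \<tau> (- 1) z \<xi> \<and> X z = \<xi> 0" "\<exists>\<xi>. is_characteristic \<gamma> \<tau> 1 z \<xi> \<and> Y z = - \<xi> 0"
    using coords z unfolding char_coordinates_def by blast+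
  from \<sigma> show "\<exists>\<xi>. is_characteristic \<gamma> \<tau> \<sigma> z \<xi> \<and> foot \<sigma> z = \<xi> 0"
  proof
    assume s: "\<sigma> = 1"
    obtain \<xi> where "is_characteristic \<gamma> \<tau> 1 z \<xi>" "Y z = - \<xi> 0" using c(2) by blast
    then show ?thesis unfolding s foot_def by (intro exI[of _ \<xi>]) simp
  next
    assume s: "\<sigma> = - 1"
    obtain \<xi> where "is_characteristic \<gamma> \<tau> (- 1) z \<xi>" "X z = \<xi> 0" using c(1) by blast
    then show ?thesis unfolding s foot_def by (intro exI[of _ \<xi>]) simp
  qed
qed

lemma Zm_XY: "Zm z = (X z, Y z)"
  by (simp add: Zm_def foot_def)

lemma Omega_Zm: "Omega T X Y = Zm ` (UNIV \<times> {0..T})"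
  unfolding Omega_def by (rule image_cong[OF refl]) (simp only: Zm_XY)

lemmas chsol' = chsol[unfolded char_solution_def Let_def]

definition G0 :: "(real \<times> real) set" where
  "G0 = (SOME G. open G \<and> Omega T X Y \<subseteq> G \<and> fields_Ck_on 2 G F)"

lemma G0: "open G0" "Omega T X Y \<subseteq> G0" "fields_Ck_on 2 G0 F"
proof -
  have "\<exists>G. open G \<and> Omega T X Y \<subseteq> G \<and> fields_Ck_on 2 G F" using chsol' by (rule conjunct1)
  then have "open G0 \<and> Omega T X Y \<subseteq> G0 \<and> fields_Ck_on 2 G0 F" unfolding G0_def by (rule someI_ex)
  then show "open G0" "Omega T X Y \<subseteq> G0" "fields_Ck_on 2 G0 F" by auto
qed

lemma C2_G0: "f \<in> {al F, be F, pp F, qq F, ta F, uu F, xx F, tt F} \<Longrightarrow> Ck_on (Suc (Suc 0)) G0 f"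
  using G0(3) unfolding fields_Ck_on_def numeral_2_eq_2 by (rule bspec)

lemma point_values:
  assumes "z \<in> UNIV \<times> {0..T}"
  shows "xx F (Zm z) = fst z" "tt F (Zm z) = snd z" "ta F (Zm z) = \<tau> z" "uu F (Zm z) = u z"
proof -
  have "\<forall>z\<in>UNIV \<times> {0..T}. xx F (X z, Y z) = fst z \<and> tt F (X z, Y z) = snd z \<and> ta F (X z, Y z) = \<tau> z \<and> uu F (X z, Y z) = u z"
    using chsol' by (elim conjE)
  from bspec[OF this assms] show "xx F (Zm z) = fst z" "tt F (Zm z) = snd z" "ta F (Zm z) = \<tau> z" "uu F (Zm z) = u z"
    unfolding Zm_XY by auto
qed

lemma angle_values:
  assumes "z \<in> UNIV \<times> {0..<T}"
  shows "al F (Zm z) = 2 * arctan (grad_R \<gamma> \<tau> u z)" "be F (Zm z) = 2 * arctan (grad_S \<gamma> \<tau> u z)"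
proof -
  have "\<forall>z\<in>UNIV \<times> {0..<T}. al F (X z, Y z) = 2 * arctan (grad_R \<gamma> \<tau> u z) \<and>
        be F (X z, Y z) = 2 * arctan (grad_S \<gamma> \<tau> u z) \<and>
        pp F (X z, Y z) = sqrt (1 + (grad_R \<gamma> \<tau> u z)\<^sup>2) / pd1 X z \<and>
        qq F (X z, Y z) = sqrt (1 + (grad_S \<gamma> \<tau> u z)\<^sup>2) / (- pd1 Y z)"
    using chsol' by (elim conjE)
  from bspec[OF this assms] show "al F (Zm z) = 2 * arctan (grad_R \<gamma> \<tau> u z)" "be F (Zm z) = 2 * arctan (grad_S \<gamma> \<tau> u z)"
    unfolding Zm_XY by auto
qed

lemma Omega_facts:
  assumes "Z \<in> Omega T X Y"
  shows "- pi \<le> al F Z" "al F Z < pi" "- pi \<le> be F Z" "be F Z < pi" "semilinear_system_at \<gamma> F Z"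
proof -
  have "\<forall>Z \<in> Omega T X Y. al F Z \<in> {- pi..<pi} \<and> be F Z \<in> {- pi..<pi}" using chsol' by (elim conjE)
  from bspec[OF this assms] show "- pi \<le> al F Z" "al F Z < pi" "- pi \<le> be F Z" "be F Z < pi" by auto
  have "\<forall>Z \<in> Omega T X Y. semilinear_system_at \<gamma> F Z" using chsol' by (elim conjE)
  from bspec[OF this assms] show "semilinear_system_at \<gamma> F Z" .
qed

lemma diag_pos: "pp F (x, - x) > 0" "qq F (x, - x) > 0"
proof -
  have "pp F (x, - x) = sqrt (1 + (R0 \<gamma> \<tau>0 u0 x)\<^sup>2)" "qq F (x, - x) = sqrt (1 + (S0 \<gamma> \<tau>0 u0 x)\<^sup>2)"
    using chsol' by blast+
  then show "pp F (x, - x) > 0" "qq F (x, - x) > 0" by (simp_all add: add_pos_nonneg)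
qed

text \<open>The neighbourhood is shrunk to where \<open>\<tau> > 0\<close>, so that the wave speed is smooth on it.\<close>

definition G :: "(real \<times> real) set" where "G = G0 \<inter> ta F -` {0<..}"

lemma open_G': "open G"
  unfolding G_def
  by (rule continuous_open_preimage[OF Ck_on_continuous[OF C2_G0] G0(1)]) auto

lemma Omega_G: "Omega T X Y \<subseteq> G"
proof
  fix Z assume Z: "Z \<in> Omega T X Y"
  then obtain z where z: "z \<in> UNIV \<times> {0..T}" "Z = Zm z" unfolding Omega_Zm by blast
  have "ta F Z > 0" unfolding z(2) point_values(3)[OF z(1)] by (rule tau_pos[OF z(1)])
  then show "Z \<in> G" using Z G0(2) unfolding G_def by auto
qed

lemma C2_G: "f \<in> {al F, be F, pp F, qq F, ta F, uu F, xx F, tt F} \<Longrightarrow> Ck_on (Suc (Suc 0)) G f"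
  by (rule Ck_on_subset[OF C2_G0]) (auto simp: G_def)

lemma ta_pos: "z \<in> G \<Longrightarrow> ta F z > 0" by (simp add: G_def)

sublocale euler_char \<gamma> T u_bound "1 / cbar" \<tau> u foot G "xx F" "tt F"
proof
  show "open G" by (rule open_G')
  show "continuous_on G (xx F)" "continuous_on G (tt F)" by (rule Ck_on_continuous[OF C2_G], simp)+
  fix z :: "real \<times> real" assume z: "z \<in> UNIV \<times> {0..T}"
  have "Zm z \<in> Omega T X Y" unfolding Omega_Zm using z by (rule imageI)
  then show "Zm z \<in> G \<and> xx F (Zm z) = fst z \<and> tt F (Zm z) = snd z"
    using Omega_G point_values(1,2)[OF z] by blast
qed

lemma U_Omega: "U \<subseteq> Omega T X Y"
  unfolding U_def Omega_Zm by (rule image_mono) auto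

lemma generic_excludes:
  assumes "char_solution \<gamma> \<tau>0 u0 T \<tau> u X Y F'" "Z \<in> final_boundary T X Y F'"
  shows "\<not> (al F' Z = - pi \<and> pd1 (al F') Z = 0 \<and> pd1 (pd1 (al F')) Z = 0)"
    "\<not> (be F' Z = - pi \<and> pd2 (be F') Z = 0 \<and> pd2 (pd2 (be F')) Z = 0)"
    "\<not> (al F' Z = - pi \<and> be F' Z = - pi \<and> pd1 (al F') Z = 0)"
    "\<not> (al F' Z = - pi \<and> be F' Z = - pi \<and> pd2 (be F') Z = 0)"
proof -
  have "\<forall>Z \<in> final_boundary T X Y F'.
             \<not> (al F' Z = - pi \<and> pd1 (al F') Z = 0 \<and> pd1 (pd1 (al F')) Z = 0) \<and>
             \<not> (be F' Z = - pi \<and> pd2 (be F') Z = 0 \<and> pd2 (pd2 (be F')) Z = 0) \<and>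
             \<not> (al F' Z = - pi \<and> be F' Z = - pi \<and> pd1 (al F') Z = 0) \<and>
             \<not> (al F' Z = - pi \<and> be F' Z = - pi \<and> pd2 (be F') Z = 0)"
    by (rule conjunct2[OF conjunct2[OF generic[unfolded generic_data_def], rule_format,
          OF conjI[OF inD conjI[OF cbar conjI[OF data conjI[OF sol conjI[OF coords assms(1)]]]]]]])
  from bspec[OF this assms(2)]
  show "\<not> (al F' Z = - pi \<and> pd1 (al F') Z = 0 \<and> pd1 (pd1 (al F')) Z = 0)"
    "\<not> (be F' Z = - pi \<and> pd2 (be F') Z = 0 \<and> pd2 (pd2 (be F')) Z = 0)"
    "\<not> (al F' Z = - pi \<and> be F' Z = - pi \<and> pd1 (al F') Z = 0)"
    "\<not> (al F' Z = - pi \<and> be F' Z = - pi \<and> pd2 (be F') Z = 0)" by simp_all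
qed

text \<open>If the singular point were isolated in \<open>\<Omega>\<close>, the angle could be flattened near it. The modified fields would still form a solution in
  characteristic coordinates, on a neighbourhood of \<open>\<Omega>\<close> without a small sphere around the point. They would attain one of the values \<open>(- \<pi>, 0, 0)\<close>
  that are excluded for all such solutions.\<close>

lemma singular_is_limit:
  assumes Z0: "Z0 \<in> final_boundary T X Y F" and sing: "al F Z0 = - pi \<or> be F Z0 = - pi"
  shows "Z0 \<in> closure U"
proof (rule ccontr)
  assume notcl: "Z0 \<notin> closure U"
  have Z0O: "Z0 \<in> Omega T X Y" and tZ0: "tt F Z0 = T" using Z0 unfolding final_boundary_def by simp_all
  obtain z0 where z0: "Z0 = Zm z0" "z0 \<in> UNIV \<times> {0..T}" using Z0O unfolding Omega_Zm by (rule imageE)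
  note z0 = z0(2,1)
  define xs where "xs = fst z0"
  have "snd z0 = T" using tZ0[unfolded z0(2) point_values(2)[OF z0(1)]] .
  then have z0': "z0 = (xs, T)" unfolding xs_def by (intro prod_eqI) simp_all
  have "\<exists>r>0. \<forall>z\<in>UNIV \<times> {0..T}. dist (Zm z) (Zm (xs, T)) < r \<longrightarrow> Zm z = Zm (xs, T)"
    by (rule isolated_unless_limit) (rule notcl[unfolded z0(2) z0'])
  then obtain r where r0: "r > 0 \<and> (\<forall>z\<in>UNIV \<times> {0..T}. dist (Zm z) (Zm (xs, T)) < r \<longrightarrow> Zm z = Zm (xs, T))"
    by (rule exE)
  have r: "r > 0" "\<And>z. z \<in> UNIV \<times> {0..T} \<Longrightarrow> dist (Zm z) Z0 < r \<Longrightarrow> Zm z = Z0"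
    unfolding z0(2) z0' by (rule conjunct1[OF r0], rule conjunct2[OF r0, rule_format])
  have iso: "Z = Z0 \<or> r / 2 < dist Z0 Z" if ZO: "Z \<in> Omega T X Y" for Z
  proof -
    obtain z where z: "Z = Zm z" "z \<in> UNIV \<times> {0..T}" using ZO unfolding Omega_Zm by (rule imageE)
    note z = z(2,1)
    show ?thesis
    proof (cases "dist Z Z0 < r")
      case True
      then have "Z = Z0" unfolding z(2) by (rule r(2)[OF z(1)])
      then show ?thesis by (rule disjI1)
    next
      case False
      then have "r / 2 < dist Z Z0" using r(1) by linarith
      then show ?thesis unfolding dist_commute[of Z Z0] by (rule disjI2)
    qed
  qed
  define G' where "G' = (G0 \<inter> ball Z0 (r / 2)) \<union> (G0 - cball Z0 (r / 2))"
  have Z0G0: "Z0 \<in> G0" by (rule subsetD[OF G0(2) Z0O])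
  have r2: "r / 2 > 0" using r(1) by simp
  have G': "open G'" "G' \<subseteq> G0"
    unfolding G'_def
    by (rule open_Un[OF open_Int[OF G0(1) open_ball] open_Diff[OF G0(1) closed_cball]])
      (intro Un_least Int_lower1 Diff_subset)
  have OG': "Omega T X Y \<subseteq> G'"
  proof
    fix Z assume Z: "Z \<in> Omega T X Y"
    then have "Z \<in> G0" by (rule subsetD[OF G0(2)])
    show "Z \<in> G'"
    proof (rule disjE[OF iso[OF Z]])
      assume "Z = Z0"
      then have "Z \<in> ball Z0 (r / 2)" using r2 by simp
      then show ?thesis unfolding G'_def using \<open>Z \<in> G0\<close> by (intro UnI1 IntI)
    next
      assume "r / 2 < dist Z0 Z"
      then have "Z \<notin> cball Z0 (r / 2)" by simp
      then show ?thesis unfolding G'_def using \<open>Z \<in> G0\<close> by (intro UnI2 DiffI)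
    qed
  qed
  have diagO: "(x, - x) \<in> Omega T X Y" for x by (rule subsetD[OF U_Omega U_diag])
  have sub2: "Ck_on 2 G' f" if "f \<in> {al F, be F, pp F, qq F, ta F, uu F, xx F, tt F}" for f
    using Ck_on_subset[OF C2_G0[OF that] G'(2)] by (simp only: numeral_2_eq_2)
  from sing show False
  proof
    assume a: "al F Z0 = - pi"
    have "Ck_on (Suc (Suc 0)) G0 (al F)" by (rule C2_G0) simp
    from flatten1[OF G0(1) Z0G0 this r2] obtain f where f: "flattens1 G0 Z0 (r / 2) (al F) f" by (rule exE)
    have fpt: "f Z0 = al F Z0" "pd1 f Z0 = 0" "pd1 (pd1 f) Z0 = 0" "pd2 f Z0 = pd2 (al F) Z0"
      and C2f: "Ck_on (Suc (Suc 0)) G' f"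
      by (rule f[unfolded flattens1_def, folded G'_def, THEN conjunct2, THEN conjunct1],
          rule f[unfolded flattens1_def, folded G'_def, THEN conjunct2, THEN conjunct2, THEN conjunct1],
          rule f[unfolded flattens1_def, folded G'_def, THEN conjunct2, THEN conjunct2, THEN conjunct2, THEN conjunct1],
          rule f[unfolded flattens1_def, folded G'_def, THEN conjunct2, THEN conjunct2, THEN conjunct2, THEN conjunct2, THEN conjunct1],
          rule f[unfolded flattens1_def, folded G'_def, THEN conjunct1])
    have far: "f z = al F z \<and> pd1 f z = pd1 (al F) z \<and> pd2 f z = pd2 (al F) z" if "r / 2 < dist Z0 z" for z
      by (rule f[unfolded flattens1_def, THEN conjunct2, THEN conjunct2, THEN conjunct2, THEN conjunct2,
            THEN conjunct2, rule_format, OF that])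
    have f_eq: "f Z = al F Z" "pd2 f Z = pd2 (al F) Z" if Z: "Z \<in> Omega T X Y" for Z
    proof -
      have "f Z = al F Z \<and> pd2 f Z = pd2 (al F) Z"
      proof (rule disjE[OF iso[OF Z]])
        assume "Z = Z0"
        show ?thesis unfolding \<open>Z = Z0\<close> by (rule conjI[OF fpt(1,4)])
      next
        assume "r / 2 < dist Z0 Z"
        from far[OF this] show ?thesis by (elim conjE) (intro conjI)
      qed
      then show "f Z = al F Z" "pd2 f Z = pd2 (al F) Z" by (rule conjunct1, rule conjunct2)
    qed
    have C2f': "Ck_on 2 G' f" using C2f by (simp only: numeral_2_eq_2)
    have C2o: "Ck_on 2 G' (be F)" by (rule sub2) simp
    have cs: "char_solution \<gamma> \<tau>0 u0 T \<tau> u X Y (F\<lparr>al := f, be := be F\<rparr>)"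
      by (rule char_solution_update[OF chsol G'(1) OG' G'(2) G0(3) C2f' C2o _ _ _ _ diagO])
        (erule f_eq(1), rule refl, erule f_eq(2), rule refl)
    have "Z0 \<in> final_boundary T X Y (F\<lparr>al := f, be := be F\<rparr>)"
      using Z0O tZ0 by (simp add: final_boundary_def)
    from generic_excludes(1)[OF cs this] show False by (rule notE) (intro conjI, simp_all add: fpt a)
  next
    assume b: "be F Z0 = - pi"
    have "Ck_on (Suc (Suc 0)) G0 (be F)" by (rule C2_G0) simp
    from flatten2[OF G0(1) Z0G0 this r2] obtain f where f: "flattens2 G0 Z0 (r / 2) (be F) f" by (rule exE)
    have fpt: "f Z0 = be F Z0" "pd2 f Z0 = 0" "pd2 (pd2 f) Z0 = 0" "pd1 f Z0 = pd1 (be F) Z0"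
      and C2f: "Ck_on (Suc (Suc 0)) G' f"
      by (rule f[unfolded flattens2_def, folded G'_def, THEN conjunct2, THEN conjunct1],
          rule f[unfolded flattens2_def, folded G'_def, THEN conjunct2, THEN conjunct2, THEN conjunct1],
          rule f[unfolded flattens2_def, folded G'_def, THEN conjunct2, THEN conjunct2, THEN conjunct2, THEN conjunct1],
          rule f[unfolded flattens2_def, folded G'_def, THEN conjunct2, THEN conjunct2, THEN conjunct2, THEN conjunct2, THEN conjunct1],
          rule f[unfolded flattens2_def, folded G'_def, THEN conjunct1])
    have far: "f z = be F z \<and> pd1 f z = pd1 (be F) z \<and> pd2 f z = pd2 (be F) z" if "r / 2 < dist Z0 z" for z
      by (rule f[unfolded flattens2_def, THEN conjunct2, THEN conjunct2, THEN conjunct2, THEN conjunct2,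
            THEN conjunct2, rule_format, OF that])
    have f_eq: "f Z = be F Z" "pd1 f Z = pd1 (be F) Z" if Z: "Z \<in> Omega T X Y" for Z
    proof -
      have "f Z = be F Z \<and> pd1 f Z = pd1 (be F) Z"
      proof (rule disjE[OF iso[OF Z]])
        assume "Z = Z0"
        show ?thesis unfolding \<open>Z = Z0\<close> by (rule conjI[OF fpt(1,4)])
      next
        assume "r / 2 < dist Z0 Z"
        from far[OF this] show ?thesis by (elim conjE) (intro conjI)
      qed
      then show "f Z = be F Z" "pd1 f Z = pd1 (be F) Z" by (rule conjunct1, rule conjunct2)
    qed
    have C2f': "Ck_on 2 G' f" using C2f by (simp only: numeral_2_eq_2)
    have C2o: "Ck_on 2 G' (al F)" by (rule sub2) simp
    have cs: "char_solution \<gamma> \<tau>0 u0 T \<tau> u X Y (F\<lparr>al := al F, be := f\<rparr>)"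
      by (rule char_solution_update[OF chsol G'(1) OG' G'(2) G0(3) C2o C2f' _ _ _ _ diagO])
        (rule refl, erule f_eq(1), rule refl, erule f_eq(2))
    have "Z0 \<in> final_boundary T X Y (F\<lparr>al := al F, be := f\<rparr>)"
      using Z0O tZ0 by (simp add: final_boundary_def)
    from generic_excludes(2)[OF cs this] show False by (rule notE) (intro conjI, simp_all add: fpt b)
  qed
qed

end

section \<open>The semilinear system at a singular point\<close>

context singular_setting
begin

lemma speed_reciprocal: "s > 0 \<Longrightarrow> 1 / (2 * sound_speed \<gamma> s) = 1 / 2 * s powr ((\<gamma> + 1) / 2)"
proof -
  have "sound_speed \<gamma> s = inverse (s powr ((\<gamma> + 1) / 2))"
    unfolding sound_speed_def minus_divide_left[symmetric] by (rule powr_minus)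
  then show ?thesis by (simp only: divide_inverse inverse_mult_distrib inverse_inverse_eq mult_1_left)
qed

text \<open>The factor \<open>c' / (4 c\<^sup>2)\<close> of the equations for \<open>p\<close> and \<open>q\<close>.\<close>

definition speed_coeff :: "real \<Rightarrow> real" where
  "speed_coeff s = deriv (sound_speed \<gamma>) s / (4 * (sound_speed \<gamma> s)\<^sup>2)"

lemma cont_speed_coeff: "continuous_on G (\<lambda>z. speed_coeff (ta F z))"
proof -
  define e where "e = - (\<gamma> + 1) / 2"
  have ss: "sound_speed \<gamma> = (\<lambda>s. s powr e)" unfolding sound_speed_def e_def by (rule refl)
  have eq: "speed_coeff (ta F z) = e * ta F z powr (e - 1) / (4 * (ta F z powr e)\<^sup>2)" if "z \<in> G" for z
    unfolding speed_coeff_def ss DERIV_imp_deriv[OF has_real_derivative_powr[OF ta_pos[OF that]]] by (rule refl)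
  have ct: "continuous_on G (ta F)" by (rule Ck_on_continuous[OF C2_G]) simp
  have nz: "\<forall>z\<in>G. ta F z \<noteq> 0" using ta_pos by (intro ballI) (metis less_irrefl)
  have pw: "continuous_on G (\<lambda>z. ta F z powr r)" for r
    by (rule continuous_on_powr[OF ct continuous_on_const nz])
  have "continuous_on G (\<lambda>z. e * ta F z powr (e - 1) / (4 * (ta F z powr e)\<^sup>2))"
  proof (rule continuous_on_divide)
    show "continuous_on G (\<lambda>z. e * ta F z powr (e - 1))" by (rule continuous_on_mult[OF continuous_on_const pw])
    show "continuous_on G (\<lambda>z. 4 * (ta F z powr e)\<^sup>2)"
      by (rule continuous_on_mult[OF continuous_on_const continuous_on_power[OF pw]])
    show "\<forall>z\<in>G. 4 * (ta F z powr e)\<^sup>2 \<noteq> 0" using nz by simp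
  qed
  then show ?thesis by (rule iffD2[OF continuous_on_cong[OF refl eq], rotated])
qed

definition half_slowness :: "real \<times> real \<Rightarrow> real" where
  "half_slowness Z = 1 / 2 * ta F Z powr ((\<gamma> + 1) / 2)"

definition p_rate :: "real \<times> real \<Rightarrow> real" where
  "p_rate Z = speed_coeff (ta F Z) * qq F Z * cos (al F Z / 2) * sin ((be F Z - al F Z) / 2)"

definition q_rate :: "real \<times> real \<Rightarrow> real" where
  "q_rate Z = speed_coeff (ta F Z) * pp F Z * cos (be F Z / 2) * sin ((al F Z - be F Z) / 2)"

lemma Omega_system:
  assumes "Z \<in> Omega T X Y"
  shows "al F Z = be F Z \<Longrightarrow> pd2 (al F) Z = 0" "al F Z = be F Z \<Longrightarrow> pd1 (be F) Z = 0"
    "pd2 (pp F) Z = p_rate Z * pp F Z" "pd1 (qq F) Z = q_rate Z * qq F Z"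
    "pd1 (ta F) Z = half_slowness Z * pp F Z * sin (al F Z / 2)"
    "pd1 (uu F) Z = 1 / 2 * pp F Z * sin (al F Z / 2)"
    "pd1 (tt F) Z = half_slowness Z * pp F Z * cos (al F Z / 2)"
    "pd2 (tt F) Z = half_slowness Z * qq F Z * cos (be F Z / 2)"
    "pd1 (xx F) Z = 1 / 2 * pp F Z * cos (al F Z / 2)"
    "pd2 (xx F) Z = - (1 / 2) * qq F Z * cos (be F Z / 2)"
proof -
  have tp: "ta F Z > 0" by (rule ta_pos[OF subsetD[OF Omega_G assms]])
  note s = Omega_facts(5)[OF assms, unfolded semilinear_system_at_def Let_def speed_reciprocal[OF tp],
      folded half_slowness_def speed_coeff_def]
  show "pd2 (al F) Z = 0" if "al F Z = be F Z" using s that by simp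
  show "pd1 (be F) Z = 0" if "al F Z = be F Z" using s that by simp
  show "pd2 (pp F) Z = p_rate Z * pp F Z"
    using s unfolding p_rate_def by (elim conjE) (simp only: mult_ac)
  show "pd1 (qq F) Z = q_rate Z * qq F Z"
    using s unfolding q_rate_def by (elim conjE) (simp only: mult_ac)
  show "pd1 (ta F) Z = half_slowness Z * pp F Z * sin (al F Z / 2)" using s by (elim conjE)
  show "pd1 (uu F) Z = 1 / 2 * pp F Z * sin (al F Z / 2)" using s by (elim conjE)
  show "pd1 (tt F) Z = half_slowness Z * pp F Z * cos (al F Z / 2)" using s by (elim conjE)
  show "pd2 (tt F) Z = half_slowness Z * qq F Z * cos (be F Z / 2)" using s by (elim conjE)
  show "pd1 (xx F) Z = 1 / 2 * pp F Z * cos (al F Z / 2)" using s by (elim conjE)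
  show "pd2 (xx F) Z = - (1 / 2) * qq F Z * cos (be F Z / 2)" using s by (elim conjE)
qed

lemma Zm_strip: "z \<in> UNIV \<times> {0..<T} \<Longrightarrow> z \<in> UNIV \<times> {0..T}"
  by (simp add: mem_Times_iff)

lemma angles_U:
  assumes "Z \<in> U"
  shows "- pi < al F Z \<and> al F Z < pi" "- pi < be F Z \<and> be F Z < pi"
proof -
  obtain z where z: "Z = Zm z" "z \<in> UNIV \<times> {0..<T}" using assms unfolding U_def by (rule imageE)
  have "- pi < 2 * arctan y \<and> 2 * arctan y < pi" for y
    using arctan_lbound[of y] arctan_ubound[of y] by linarith
  then show "- pi < al F Z \<and> al F Z < pi" "- pi < be F Z \<and> be F Z < pi"
    unfolding z(1) angle_values[OF z(2)] by blast+
qed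

lemma final_point:
  assumes "Z \<in> final_boundary T X Y F"
  shows "(xx F Z, T) \<in> UNIV \<times> {0..T}" "Zm (xx F Z, T) = Z"
proof -
  have Z: "Z \<in> Omega T X Y" "tt F Z = T" using assms unfolding final_boundary_def by simp_all
  obtain z where z: "Z = Zm z" "z \<in> UNIV \<times> {0..T}" using Z(1) unfolding Omega_Zm by (rule imageE)
  have "z = (xx F Z, T)"
    by (rule prod_eqI) (simp_all add: z(1) point_values(1)[OF z(2)] Z(2)[unfolded z(1) point_values(2)[OF z(2)]])
  then show "(xx F Z, T) \<in> UNIV \<times> {0..T}" "Zm (xx F Z, T) = Z" using z by simp_all
qed

text \<open>This transfers the analysis in the plane of \<open>(X, Y)\<close> to the solution at hand. In particular \<open>ab_eq\<close> holds because \<open>\<alpha>\<^sub>Y\<close> and \<open>\<beta>\<^sub>X\<close>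
  contain the factor \<open>sin ((\<alpha> - \<beta>) / 2)\<close> up to sign.\<close>

lemma char_plane_flow_singular:
  assumes Z0: "(X0, Y0) \<in> final_boundary T X Y F" and sing: "al F (X0, Y0) = - pi \<or> be F (X0, Y0) = - pi"
  shows "char_plane_flow U G T (al F) (be F) (pp F) (qq F) half_slowness (tt F) p_rate q_rate X0 Y0 (xx F) Zm"
proof -
  have O: "(X0, Y0) \<in> Omega T X Y" and tZ: "tt F (X0, Y0) = T" using Z0 unfolding final_boundary_def by simp_all
  note sysU = Omega_system[OF subsetD[OF U_Omega]]
  have cf: "continuous_on G f" if "f \<in> {al F, be F, pp F, qq F, ta F, uu F, xx F, tt F}" for f
    by (rule Ck_on_continuous[OF C2_G[OF that]])
  have C1w: "Ck_on (Suc 0) G half_slowness"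
    unfolding half_slowness_def
    by (rule Ck_on_mult[OF Ck_on_const Ck_on_powr[OF open_G' ta_pos Ck_on_SucD[OF C2_G]]]) simp_all
  have ck: "continuous_on G p_rate"
    unfolding p_rate_def
    by (intro continuous_on_mult continuous_on_cos continuous_on_sin continuous_on_divide continuous_on_diff
        continuous_on_const cont_speed_coeff cf) simp_all
  have cl: "continuous_on G q_rate"
    unfolding q_rate_def
    by (intro continuous_on_mult continuous_on_cos continuous_on_sin continuous_on_divide continuous_on_diff
        continuous_on_const cont_speed_coeff cf) simp_all
  have hp: "half_slowness z > 0" if "z \<in> G" for z
    using ta_pos[OF that] unfolding half_slowness_def by simp
  have fp: "(xx F (X0, Y0), T) \<in> UNIV \<times> {0..T}" "Zm (xx F (X0, Y0), T) = (X0, Y0)" by (rule final_point[OF Z0])+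
  have sum: "X0 + Y0 > 0"
    using feet_sum(2)[OF fp(1)] T_pos fp(2) unfolding Zm_def by simp
  have ZmU: "Zm z \<in> U" if "z \<in> UNIV \<times> {0..<T}" for z unfolding U_def using that by (rule imageI)
  have C2: "Ck_on (Suc (Suc 0)) G (al F)" "Ck_on (Suc (Suc 0)) G (be F)" "Ck_on (Suc (Suc 0)) G (tt F)"
    "Ck_on (Suc (Suc 0)) G (pp F)" "Ck_on (Suc (Suc 0)) G (qq F)" "Ck_on (Suc (Suc 0)) G (xx F)"
    by (rule C2_G, simp)+
  show ?thesis
    apply (rule char_plane_flow.intro)
    subgoal
      apply (rule char_plane.intro)
      subgoal by (rule open_G')
      subgoal by (rule U_sub)
      subgoal by (rule subsetD[OF Omega_G O])
      subgoal by (rule C2)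
      subgoal by (rule C2)
      subgoal by (rule C2)
      subgoal by (rule Ck_on_SucD[OF C2(4)])
      subgoal by (rule Ck_on_SucD[OF C2(5)])
      subgoal by (rule C1w)
      subgoal by (rule ck)
      subgoal by (rule cl)
      subgoal by (erule hp)
      subgoal by (rule U_diag)
      subgoal by (erule (3) U_lower)
      subgoal by (rule U_open)
      subgoal by (erule (2) U_closed)
      subgoal by (drule U_time) (elim conjE)
      subgoal by (rule tZ)
      subgoal by (rule singular_is_limit[OF Z0 sing])
      subgoal by (rule sum)
      subgoal by (rule diag_pos)
      subgoal by (rule diag_pos)
      subgoal by (erule angles_U)
      subgoal by (erule angles_U)
      subgoal by (rule Omega_facts(2)[OF O])
      subgoal by (rule Omega_facts(4)[OF O])
      subgoal by (erule sysU)
      subgoal by (erule sysU)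
      subgoal by (erule sysU)
      subgoal by (erule sysU)
      subgoal by (rule conjI) (erule Omega_system(1)[OF O], erule Omega_system(2)[OF O])
      subgoal by (rule generic_excludes(1)[OF chsol Z0])
      subgoal by (rule generic_excludes(2)[OF chsol Z0])
      subgoal by (rule generic_excludes(3)[OF chsol Z0])
      subgoal by (rule generic_excludes(4)[OF chsol Z0])
      done
    subgoal
      apply (rule char_plane_flow_axioms.intro)
      subgoal by (rule C2)
      subgoal by (erule sysU)
      subgoal by (erule sysU)
      subgoal by (rule T_pos)
      subgoal by (rule cont_Zm)
      subgoal premises z for z
        by (intro conjI ZmU[OF z] point_values(1)[OF Zm_strip[OF z]] point_values(2)[OF Zm_strip[OF z]])
      subgoal by (drule U_time) (elim conjE, rule conjI)
      done
    done
qed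

lemma singular_points_type1:
  assumes "singular_point T X Y F Z"
  shows "type1 F Z \<and> \<not> type2 F Z \<and> \<not> type3 F Z"
proof -
  obtain X0 Y0 where Z: "Z = (X0, Y0)" by (cases Z)
  have Z0: "(X0, Y0) \<in> final_boundary T X Y F" and sing: "al F (X0, Y0) = - pi \<or> be F (X0, Y0) = - pi"
    using assms unfolding singular_point_def Z by simp_all
  interpret P: char_plane_flow U G T "al F" "be F" "pp F" "qq F" half_slowness "tt F" p_rate q_rate X0 Y0 "xx F" Zm
    by (rule char_plane_flow_singular[OF Z0 sing])
  from sing show ?thesis
  proof
    assume a: "al F (X0, Y0) = - pi"
    show ?thesis using P.singular_type1[OF a] a unfolding type1_def type2_def type3_def Z by simp
  next
    assume b: "be F (X0, Y0) = - pi"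
    have "(be F \<circ> prod.swap) (Y0, X0) = - pi" using b by simp
    from char_plane.singular_type1[OF P.mirror this]
    have "pd2 (be F) (X0, Y0) = 0" "al F (X0, Y0) \<noteq> - pi" "pd2 (pd2 (be F)) (X0, Y0) > 0"
      unfolding pd_swap by simp_all
    then show ?thesis using b unfolding type1_def type2_def type3_def Z by simp
  qed
qed

end

section \<open>Back to the physical plane\<close>

context singular_setting
begin

text \<open>Up to the final time, a function on the strip can be recovered from its counterpart in characteristic coordinates through any
  continuous extension \<open>Zt\<close> of the coordinate map.\<close>

lemma pulled_back:
  fixes f g :: "real \<times> real \<Rightarrow> real"
  assumes V: "V = ball (xs, T) \<delta> \<inter> UNIV \<times> {0..T}"
    and Zt: "continuous_on V Zt" "\<And>z. z \<in> V \<Longrightarrow> Zt z \<in> G" "\<And>z. z \<in> V \<Longrightarrow> snd z < T \<Longrightarrow> Zt z = Zm z"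
    and g: "continuous_on (UNIV \<times> {0..T}) g" and f: "continuous_on G f"
    and fg: "\<And>z. z \<in> UNIV \<times> {0..T} \<Longrightarrow> f (Zm z) = g z" and z: "z \<in> V"
  shows "f (Zt z) = g z"
proof (rule continuous_agree_closure[of V "\<lambda>z. f (Zt z)" g "ball (xs, T) \<delta> \<inter> UNIV \<times> {0..<T}"])
  show "continuous_on V (\<lambda>z. f (Zt z))"
    by (rule continuous_on_compose2[OF f Zt(1)]) (use Zt(2) in \<open>rule image_subsetI\<close>)
  show "continuous_on V g" by (rule continuous_on_subset[OF g]) (simp add: V)
  show sub: "ball (xs, T) \<delta> \<inter> UNIV \<times> {0..<T} \<subseteq> V"
    unfolding V by (intro Int_mono order_refl Sigma_mono) auto
  show "f (Zt y) = g y" if y: "y \<in> ball (xs, T) \<delta> \<inter> UNIV \<times> {0..<T}" for y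
  proof -
    have "y \<in> UNIV \<times> {0..<T}" using y by (rule IntD2)
    then have t: "snd y < T" "y \<in> UNIV \<times> {0..T}" by (simp_all add: mem_Times_iff)
    show ?thesis unfolding Zt(3)[OF subsetD[OF sub y] t(1)] by (rule fg[OF t(2)])
  qed
  show "z \<in> V" by (rule z)
  show "z \<in> closure (ball (xs, T) \<delta> \<inter> UNIV \<times> {0..<T})"
    by (rule closure_strip[OF open_ball _ _ T_pos]) (use z V in auto)
qed

lemma cube_root_bigo:
  assumes V: "V = ball (xs, T) \<delta> \<inter> UNIV \<times> {0..T}" "\<delta> > 0"
    and Zt: "continuous_on V Zt" "Zt (xs, T) = Z0" and r: "r > 0"
    and est: "\<And>z. z \<in> V \<Longrightarrow> Zt z \<in> box_at Z0 r \<Longrightarrow> \<bar>snd z - T\<bar> + \<bar>fst z - xs\<bar> \<le> 1 \<Longrightarrow>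
       \<bar>h z\<bar> \<le> C * (\<bar>snd z - T\<bar> + \<bar>fst z - xs\<bar>) powr (4 / 9)"
  shows "h \<in> O[at (xs, T) within (UNIV \<times> {0..T})](\<lambda>(x, t). (\<bar>t - T\<bar> + \<bar>x - xs\<bar>) powr (4 / 9))"
proof (rule bigoI[where c = C])
  have z0: "(xs, T) \<in> V" using V T_pos by simp
  obtain d where d: "d > 0" "\<And>z. z \<in> V \<Longrightarrow> dist z (xs, T) < d \<Longrightarrow> dist (Zt z) Z0 < r"
    using Zt(1)[unfolded continuous_on_iff, rule_format, OF z0 r] unfolding Zt(2) by blast
  define e where "e = min (min d \<delta>) (1 / 2)"
  have e: "e > 0" "e \<le> d" "e \<le> \<delta>" "e \<le> 1 / 2" using d(1) V(2) by (simp_all add: e_def)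
  have "\<bar>h z\<bar> \<le> C * (\<bar>snd z - T\<bar> + \<bar>fst z - xs\<bar>) powr (4 / 9)"
    if z: "z \<in> UNIV \<times> {0..T}" "dist z (xs, T) < e" for z
  proof (rule est)
    have "dist (xs, T) z < \<delta>" using z(2) e(3) unfolding dist_commute[of "(xs, T)"] by linarith
    then show zV: "z \<in> V" unfolding V by (intro IntI z(1)) (simp add: mem_ball)
    have "dist (Zt z) Z0 < r" by (rule d(2)[OF zV]) (use z(2) e(2) in linarith)
    then have "\<bar>fst (Zt z) - fst Z0\<bar> \<le> r" "\<bar>snd (Zt z) - snd Z0\<bar> \<le> r"
      using dist_fst_le[of "Zt z" Z0] dist_snd_le[of "Zt z" Z0] unfolding dist_real_def by linarith+
    then have "(fst (Zt z), snd (Zt z)) \<in> box_at Z0 r" unfolding mem_box_at by (rule conjI)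
    then show "Zt z \<in> box_at Z0 r" by simp
    show "\<bar>snd z - T\<bar> + \<bar>fst z - xs\<bar> \<le> 1"
      using dist_fst_le[of z "(xs, T)"] dist_snd_le[of z "(xs, T)"] z(2) e(4)
      unfolding dist_real_def fst_conv snd_conv by linarith
  qed
  then have ev: "\<forall>\<^sub>F z in at (xs, T) within (UNIV \<times> {0..T}).
      \<bar>h z\<bar> \<le> C * (\<bar>snd z - T\<bar> + \<bar>fst z - xs\<bar>) powr (4 / 9)"
    unfolding eventually_at using e(1) by (intro exI[of _ e] conjI ballI impI) auto
  show "\<forall>\<^sub>F z in at (xs, T) within (UNIV \<times> {0..T}).
      norm (h z) \<le> C * norm (case z of (x, t) \<Rightarrow> (\<bar>t - T\<bar> + \<bar>x - xs\<bar>) powr (4 / 9))"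
    by (rule eventually_mono[OF ev]) (simp add: case_prod_beta)
qed

text \<open>The constant \<open>\<zeta>\<close> is \<open>\<tau>\<^sub>X / root 3 A\<close>, nonzero since \<open>sin (\<alpha> / 2) = - 1\<close>; and \<open>u\<^sub>X = c \<tau>\<^sub>X\<close> gives the factor \<open>c\<close> in the expansion of \<open>u\<close>.\<close>

lemma singular_cube_root:
  assumes Z0: "(X0, Y0) \<in> final_boundary T X Y F" and a: "al F (X0, Y0) = - pi"
    and G': "open G'" "(X0, Y0) \<in> G'" "Ck_on 3 G' (al F)"
  shows "\<exists>\<zeta>. \<zeta> \<noteq> 0 \<and> cube_root_expansions \<gamma> T \<tau> u (xx F (X0, Y0)) \<zeta>"
proof -
  interpret P: char_plane_flow U G T "al F" "be F" "pp F" "qq F" half_slowness "tt F" p_rate q_rate X0 Y0 "xx F" Zm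
    by (rule char_plane_flow_singular[OF Z0 disjI1[OF a]])
  define xs where "xs = xx F (X0, Y0)"
  have O: "(X0, Y0) \<in> Omega T X Y" using Z0 unfolding final_boundary_def by simp
  note fp = final_point[OF Z0, folded xs_def]
  obtain \<delta> Zt where \<delta>: "\<delta> > 0" and cZt: "continuous_on (ball (xs, T) \<delta> \<inter> UNIV \<times> {0..T}) Zt"
    and Zt0: "Zt (xs, T) = (X0, Y0)"
    and Zt: "\<And>z. z \<in> ball (xs, T) \<delta> \<inter> UNIV \<times> {0..T} \<Longrightarrow>
        Zt z \<in> G \<and> Zt z \<in> closure U \<and> xx F (Zt z) = fst z \<and> tt F (Zt z) = snd z \<and> cos (be F (Zt z) / 2) > 0"
    and Zt_Zm: "\<And>z. z \<in> ball (xs, T) \<delta> \<inter> UNIV \<times> {0..T} \<Longrightarrow> snd z < T \<Longrightarrow> Zt z = Zm z"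
    apply (rule P.local_inverse[OF a, folded xs_def])
    subgoal premises h by (rule h(1)[OF h(2-)])
    done
  define V where "V = ball (xs, T) \<delta> \<inter> UNIV \<times> {0..T}"
  note Zt' = cZt[folded V_def] Zt[folded V_def] Zt_Zm[folded V_def]
  define A where "A = pp F (X0, Y0) * pd1 (pd1 (al F)) (X0, Y0) / 12"
  have ppos: "pp F (X0, Y0) > 0" by (rule P.p_pos[OF a])
  have A: "A > 0" unfolding A_def using ppos P.singular_type1(3)[OF a] by simp
  define c0 where "c0 = sound_speed \<gamma> (\<tau> (xs, T))"
  have taxs: "ta F (X0, Y0) = \<tau> (xs, T)" "uu F (X0, Y0) = u (xs, T)"
    using point_values(3,4)[OF fp(1)] unfolding fp(2) by simp_all
  have c0: "c0 > 0" unfolding c0_def by (rule c_pos[OF fp(1)])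
  have hs: "half_slowness (X0, Y0) = 1 / (2 * c0)"
    unfolding half_slowness_def c0_def taxs by (rule speed_reciprocal[OF tau_pos[OF fp(1)], symmetric])
  have sp: "1 / (2 * half_slowness (X0, Y0)) = c0" unfolding hs using c0 by simp
  have expand: "(\<lambda>(x, t). g (x, t) - g (xs, T) - pd1 f (X0, Y0) / root 3 A * root 3 (c0 * (t - T) + (x - xs)))
      \<in> O[at (xs, T) within (UNIV \<times> {0..T})](\<lambda>(x, t). (\<bar>t - T\<bar> + \<bar>x - xs\<bar>) powr (4 / 9))"
    if f: "Ck_on (Suc (Suc 0)) G f" and g: "continuous_on (UNIV \<times> {0..T}) g"
      and fg: "\<And>z. z \<in> UNIV \<times> {0..T} \<Longrightarrow> f (Zm z) = g z" for f g
  proof -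
    have pb: "f (Zt z) = g z" if "z \<in> V" for z
      by (rule pulled_back[OF V_def Zt'(1) conjunct1[OF Zt'(2)] Zt'(3) g Ck_on_continuous[OF f] fg that])
    have f0: "f (X0, Y0) = g (xs, T)" using fg[OF fp(1)] unfolding fp(2) .
    obtain r C where r: "r > 0" and est: "\<And>z d. \<lbrakk>z \<in> box_at (X0, Y0) r; z \<in> closure U;
          d = \<bar>tt F z - T\<bar> + \<bar>xx F z - xs\<bar>; d \<le> 1\<rbrakk> \<Longrightarrow>
        \<bar>f z - f (X0, Y0) - pd1 f (X0, Y0) * root 3 ((c0 * (tt F z - T) + (xx F z - xs)) / A)\<bar>
          \<le> C * d powr (4 / 9)"
      apply (rule P.singular_expansion[OF a G' f, folded xs_def A_def, unfolded sp])
      subgoal premises h by (rule h(1)[OF h(2,4)])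
      done
    show ?thesis
    proof (rule cube_root_bigo[OF V_def \<delta> Zt'(1) Zt0 r])
      fix z assume z: "z \<in> V" "Zt z \<in> box_at (X0, Y0) r" "\<bar>snd z - T\<bar> + \<bar>fst z - xs\<bar> \<le> 1"
      note q = Zt'(2)[OF z(1)]
      have q': "Zt z \<in> closure U" "xx F (Zt z) = fst z" "tt F (Zt z) = snd z"
        by (rule conjunct1[OF conjunct2[OF q]], rule conjunct1[OF conjunct2[OF conjunct2[OF q]]],
            rule conjunct1[OF conjunct2[OF conjunct2[OF conjunct2[OF q]]]])
      have "\<bar>g z - g (xs, T) - pd1 f (X0, Y0) * root 3 ((c0 * (snd z - T) + (fst z - xs)) / A)\<bar>
          \<le> C * (\<bar>snd z - T\<bar> + \<bar>fst z - xs\<bar>) powr (4 / 9)"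
        by (rule est[OF z(2) q'(1) refl, unfolded q'(2,3) pb[OF z(1)] f0, OF z(3)])
      then show "\<bar>case z of (x, t) \<Rightarrow> g (x, t) - g (xs, T) - pd1 f (X0, Y0) / root 3 A * root 3 (c0 * (t - T) + (x - xs))\<bar>
          \<le> C * (\<bar>snd z - T\<bar> + \<bar>fst z - xs\<bar>) powr (4 / 9)"
        unfolding real_root_divide times_divide_eq_right times_divide_eq_left case_prod_beta prod.collapse .
    qed
  qed
  define \<zeta> where "\<zeta> = pd1 (ta F) (X0, Y0) / root 3 A"
  have sn: "sin (al F (X0, Y0) / 2) = - 1" unfolding a by simp
  have dta: "pd1 (ta F) (X0, Y0) = - (pp F (X0, Y0) / (2 * c0))"
    unfolding Omega_system(5)[OF O] hs sn by simp
  have duu: "pd1 (uu F) (X0, Y0) = c0 * pd1 (ta F) (X0, Y0)"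
    unfolding Omega_system(6)[OF O] sn dta using c0 by simp
  have "\<zeta> \<noteq> 0" unfolding \<zeta>_def dta using ppos c0 A by simp
  moreover have "cube_root_expansions \<gamma> T \<tau> u xs \<zeta>"
    unfolding cube_root_expansions_def Let_def c0_def[symmetric]
  proof (rule conjI)
    show "(\<lambda>(x, t). \<tau> (x, t) - \<tau> (xs, T) - \<zeta> * root 3 (c0 * (t - T) + (x - xs)))
      \<in> O[at (xs, T) within (UNIV \<times> {0..T})](\<lambda>(x, t). (\<bar>t - T\<bar> + \<bar>x - xs\<bar>) powr (4 / 9))"
      unfolding \<zeta>_def by (rule expand[where f = "ta F" and g = \<tau>, OF C2_G cont_tau point_values(3)]) simp_all
    have cz: "c0 * \<zeta> = pd1 (uu F) (X0, Y0) / root 3 A" unfolding duu \<zeta>_def by simp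
    show "(\<lambda>(x, t). u (x, t) - u (xs, T) - c0 * \<zeta> * root 3 (c0 * (t - T) + (x - xs)))
      \<in> O[at (xs, T) within (UNIV \<times> {0..T})](\<lambda>(x, t). (\<bar>t - T\<bar> + \<bar>x - xs\<bar>) powr (4 / 9))"
      unfolding cz by (rule expand[where f = "uu F" and g = u, OF C2_G cont_u point_values(4)]) simp_all
  qed
  ultimately show ?thesis unfolding xs_def by (intro exI[of _ \<zeta>] conjI)
qed

text \<open>Before \<open>T\<close> the gradient of \<open>\<varpi>\<^sub>+\<close> is \<open>(S, - c S)\<close>, and \<open>S = tan (\<beta> / 2)\<close> stays continuous up to the singular point because
  \<open>\<beta>\<close> does not reach \<open>- \<pi>\<close>.\<close>

lemma riemann_plus_C1:
  assumes Z0: "(X0, Y0) \<in> final_boundary T X Y F" and a: "al F (X0, Y0) = - pi"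
  shows "\<exists>\<delta>>0. Ck_on 1 (ball (xx F (X0, Y0), T) \<delta> \<inter> UNIV \<times> {0..T}) (riemann_plus \<gamma> \<tau> u)"
proof -
  interpret P: char_plane_flow U G T "al F" "be F" "pp F" "qq F" half_slowness "tt F" p_rate q_rate X0 Y0 "xx F" Zm
    by (rule char_plane_flow_singular[OF Z0 disjI1[OF a]])
  define xs where "xs = xx F (X0, Y0)"
  obtain \<delta> Zt where \<delta>: "\<delta> > 0" and cZt: "continuous_on (ball (xs, T) \<delta> \<inter> UNIV \<times> {0..T}) Zt"
    and Zt0: "Zt (xs, T) = (X0, Y0)"
    and Zt: "\<And>z. z \<in> ball (xs, T) \<delta> \<inter> UNIV \<times> {0..T} \<Longrightarrow>
        Zt z \<in> G \<and> Zt z \<in> closure U \<and> xx F (Zt z) = fst z \<and> tt F (Zt z) = snd z \<and> cos (be F (Zt z) / 2) > 0"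
    and Zt_Zm: "\<And>z. z \<in> ball (xs, T) \<delta> \<inter> UNIV \<times> {0..T} \<Longrightarrow> snd z < T \<Longrightarrow> Zt z = Zm z"
    apply (rule P.local_inverse[OF a, folded xs_def])
    subgoal premises h by (rule h(1)[OF h(2-)])
    done
  \<comment> \<open>Below the radius \<open>T\<close> the ball stays off the initial line, where only one-sided derivatives exist.\<close>
  define \<delta>' where "\<delta>' = min \<delta> T"
  have \<delta>': "\<delta>' > 0" "\<delta>' \<le> \<delta>" "\<delta>' \<le> T" using \<delta> T_pos by (simp_all add: \<delta>'_def)
  define A where "A = ball (xs, T) \<delta>' \<inter> UNIV \<times> {0..T}"
  have AV: "A \<subseteq> ball (xs, T) \<delta> \<inter> UNIV \<times> {0..T}"
    unfolding A_def by (rule Int_mono[OF subset_ball[OF \<delta>'(2)] order_refl])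
  have Astrip: "A \<subseteq> UNIV \<times> {0..T}" unfolding A_def by (rule Int_lower2)
  define g where "g z = tan (be F (Zt z) / 2)" for z
  define h where "h z = - c z * g z" for z
  have cbe: "continuous_on A (\<lambda>z. be F (Zt z))"
  proof (rule continuous_on_compose2[OF _ continuous_on_subset[OF cZt AV]])
    show "continuous_on G (be F)" by (rule Ck_on_continuous[OF C2_G]) simp
    show "Zt ` A \<subseteq> G" by (rule image_subsetI) (rule conjunct1[OF Zt[OF subsetD[OF AV]]])
  qed
  have cosnz: "\<forall>z\<in>A. cos (be F (Zt z) / 2) \<noteq> 0"
  proof
    fix z assume zA: "z \<in> A"
    note q = Zt[OF subsetD[OF AV zA]]
    have "cos (be F (Zt z) / 2) > 0" using q by (elim conjE)
    then show "cos (be F (Zt z) / 2) \<noteq> 0" by simp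
  qed
  have cbe2: "continuous_on A (\<lambda>z. be F (Zt z) / 2)" by (rule continuous_on_divide[OF cbe continuous_on_const]) simp
  have cg: "continuous_on A g"
    unfolding g_def tan_def
    by (rule continuous_on_divide[OF continuous_on_sin[OF cbe2] continuous_on_cos[OF cbe2] cosnz])
  have ch: "continuous_on A h"
    unfolding h_def
    by (rule continuous_on_mult[OF continuous_on_minus[OF continuous_on_subset[OF cont_c Astrip]] cg])
  have der: "(inv 1 has_derivative (\<lambda>v. g z * fst v + h z * snd v)) (at z)" if z: "z \<in> A" "snd z < T" for z
  proof -
    have zs: "z \<in> UNIV \<times> {0..T}" by (rule subsetD[OF Astrip z(1)])
    have "dist (xs, T) z < \<delta>'" using z(1) unfolding A_def by simp
    then have "\<bar>T - snd z\<bar> < T" using dist_snd_le[of "(xs, T)" z] \<delta>'(3) unfolding dist_real_def snd_conv by linarith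
    then have zi: "z \<in> UNIV \<times> {0<..<T}" "z \<in> UNIV \<times> {0..<T}" using z(2) by (auto simp: mem_Times_iff)
    have "be F (Zt z) = 2 * arctan (grad_S \<gamma> \<tau> u z)"
      unfolding Zt_Zm[OF subsetD[OF AV z(1)] z(2)] by (rule angle_values(2)[OF zi(2)])
    then have gz: "g z = pd1 u z - c z * pd1 \<tau> z" unfolding g_def by (simp add: tan_arctan grad_S_def)
    have "(\<lambda>v. g z * fst v + h z * snd v) = (\<lambda>v::real \<times> real. (pd1 u z - 1 * c z * pd1 \<tau> z) * (fst v - 1 * c z * snd v))"
      unfolding h_def gz by (simp add: fun_eq_iff algebra_simps)
    then show ?thesis using inv_derivative[OF zi(1), of 1] by simp
  qed
  have "Ck_on (Suc 0) A (inv 1)"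
  proof (rule Ck_on_SucI)
    show "(inv 1 has_derivative (\<lambda>v. g z * fst v + h z * snd v)) (at z within A)" if "z \<in> A" for z
      by (rule derivative_extends[OF A_def T_pos continuous_on_subset[OF cont_inv Astrip] cg ch der that])
    show "Ck_on 0 A g" "Ck_on 0 A h" using cg ch by simp_all
  qed
  moreover have "inv 1 = riemann_plus \<gamma> \<tau> u" by (simp add: fun_eq_iff inv_def riemann_plus_def)
  ultimately have "Ck_on 1 A (riemann_plus \<gamma> \<tau> u)" by simp
  then show ?thesis unfolding A_def xs_def using \<delta>'(1) by (intro exI[of _ \<delta>'] conjI)
qed

end

theorem theorem2:
  fixes \<gamma> taubar cbar T :: real
    and \<tau>0 u0 :: "real \<Rightarrow> real"
    and \<tau> u X Y :: "real \<times> real \<Rightarrow> real"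
    and F :: char_fields
    and D :: "((real \<Rightarrow> real) \<times> (real \<Rightarrow> real)) set"
  assumes "\<gamma> > 1" and "taubar > 0"
    and "generic_data \<gamma> taubar D"
    and "((\<lambda>x. \<tau>0 x - taubar), u0) \<in> D"
    and "cbar > 0" and "data_conditions \<gamma> cbar \<tau>0 u0"
    and "solution_until_blowup \<gamma> \<tau>0 u0 T \<tau> u"
    and "char_coordinates \<gamma> T \<tau> X Y"
    and "char_solution \<gamma> \<tau>0 u0 T \<tau> u X Y F"
  shows "(\<forall>Z. singular_point T X Y F Z \<longrightarrow> type1 F Z \<and> \<not> type2 F Z \<and> \<not> type3 F Z) \<and>
    (\<forall>Z. singular_point T X Y F Z \<and> al F Z = - pi \<longrightarrow>
       ((\<exists>G. open G \<and> Z \<in> G \<and> Ck_on 3 G (al F)) \<longrightarrow>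
          (\<exists>\<zeta>. \<zeta> \<noteq> 0 \<and> cube_root_expansions \<gamma> T \<tau> u (xx F Z) \<zeta>)) \<and>
       (\<exists>\<delta>>0. Ck_on 1 (ball (xx F Z, T) \<delta> \<inter> UNIV \<times> {0..T}) (riemann_plus \<gamma> \<tau> u)))"
proof -
  interpret singular_setting \<gamma> taubar cbar T \<tau>0 u0 \<tau> u X Y F D
    by (rule singular_setting.intro[OF assms(1,3-9)])
  show ?thesis
  proof (intro conjI allI impI)
    fix Z assume Z: "singular_point T X Y F Z"
    note types = singular_points_type1[OF Z]
    show "type1 F Z" "\<not> type2 F Z" "\<not> type3 F Z"
      by (rule conjunct1[OF types], rule conjunct1[OF conjunct2[OF types]], rule conjunct2[OF conjunct2[OF types]])
  next
    fix Z assume s: "singular_point T X Y F Z \<and> al F Z = - pi"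
    then have Z: "(fst Z, snd Z) \<in> final_boundary T X Y F" "al F (fst Z, snd Z) = - pi"
      unfolding singular_point_def by simp_all
    show "\<exists>\<delta>>0. Ck_on 1 (ball (xx F Z, T) \<delta> \<inter> UNIV \<times> {0..T}) (riemann_plus \<gamma> \<tau> u)"
      using riemann_plus_C1[OF Z] unfolding prod.collapse .
    assume "\<exists>G. open G \<and> Z \<in> G \<and> Ck_on 3 G (al F)"
    then obtain G' where G': "open G' \<and> Z \<in> G' \<and> Ck_on 3 G' (al F)" by (rule exE)
    have "open G'" "(fst Z, snd Z) \<in> G'" "Ck_on 3 G' (al F)" using G' by simp_all
    from singular_cube_root[OF Z this]
    show "\<exists>\<zeta>. \<zeta> \<noteq> 0 \<and> cube_root_expansions \<gamma> T \<tau> u (xx F Z) \<zeta>" unfolding prod.collapse .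
  qed
qed

end
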